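(* Let $n\ge1$, $\beta\ge0$, and let the couplings $J_e$ be independent and identically distributed real random variables. Let $(F_k,Q_k)_{k\ge0}$ be a small-ball profile, with associated quantities $T^{\mathrm s}_{N,j},T^{\mathrm b}_{N,j},S_N,P_N$. For every $N\ge1$ and every non-pole vertex $x$ of $\mathbb D_N$ of level $j$: 1. Free poles: $\mathbb E\langle\sigma_A\sigma_B\rangle^2=1-\mathbb E\operatorname{sech}^2\xi_N\ge1-S_N$. 2. Fixed poles, for any pole spins $s_A,s_B\in\{-1,1\}$: $\mathbb E\langle\sigma_x\rangle^2\ge1-2T^{\mathrm s}_{N,j}$. If the law of $J_e$ is symmetric, $\mathbb E\langle\sigma_x\rangle=0$. 3. Free poles: $\mathbb E\langle\sigma_A\sigma_x\rangle^2\ge(1-2T^{\mathrm s}_{N,j}-S_N)_+$, and $$\mathbb E\langle R_{12}^2\rangle\ge\Big(\frac1{|\mathcal V_N|}\sum_{z\in\mathcal V_N}\big(1-2T^{\mathrm s}_{N,k_0(z)}-S_N\big)_+\Big)^2.$$ 4. Free poles: $\mathbb P(x\notin C(A)\cup C(B))\le T^{\mathrm b}_{N,j}$ and $\mathbb P(A\not\leftrightarrow B)\le P_N$. Let $\bar X_N:=|\mathcal V_N|^{-1}\sum_{z\in\mathcal V_N}T^{\mathrm b}_{N,k_0(z)}$. Then for every $\theta\in(0,1)$, $$\mathbb P\big(B\in C(A),\ |C(A)|>(1-\theta)|\mathcal V_N|\big)\ge1-\bar X_N/\theta-P_N,$$ $$\frac{\mathbb E|C(A)|}{|\mathcal V_N|}\ge\frac1{|\mathcal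 V_N|}\sum_{z\in\mathcal V_N}\big(1-T^{\mathrm b}_{N,k_0(z)}-P_N\big)_+.$$ 5. Free poles, $1\le m\le N$: $$\mathbb P\big(M_N>(2n)^{-m}|\mathcal V_N|\big)\le P_N+v_mT^{\mathrm b}_{N,N-m+1},\qquad\mathbb EM_N/|\mathcal V_N|\le(2n)^{-m}+P_N+v_mT^{\mathrm b}_{N,N-m+1}.$$ 6. Free poles: $\mathbb E\,\mathcal I_N^2\ge(1-2\bar X_N)_+^2-P_N$ and $\mathbb E\,\mathcal I_N^2\ge\big((\mathbb E|C(A)|-\mathbb EM_N)/|\mathcal V_N|\big)_+^2$.
   Context: Lattice. $\mathbb D_0$ is the graph with two vertices (poles) $A,B$ and one edge. For $N\ge1$, $\mathbb D_N$ consists of $n$ branches in parallel between its poles $A$ and $B$; each branch is two copies of $\mathbb D_{N-1}$ (its halves) glued in series at a new vertex, the midpoint of the branch. Every copy of $\mathbb D_k$ arising in this construction is a scale-$k$ sub-diamond. A vertex $x\notin\{A,B\}$ has level $k_0(x)=j$ if it is the midpoint of a branch of a scale-$j$ sub-diamond ($1\le j\le N$). $\mathcal V_N$ is the vertex set of $\mathbb D_N$; $v_k$ is the number of non-pole vertices of $\mathbb D_k$. Gibbs measures and replicas. The free-pole Gibbs measure on $\{-1,1\}^{\mathcal V_N}$ is $\propto\exp(\beta\sum_{e=xy}J_e\sigma_x\sigma_y)$, all spins summed. The fixed-pole measure with pole spins $(s_A,s_B)$ is this measure conditioned on $\sigma_A=s_A,\sigma_B=s_B$. $\langle\cdot\rangle$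 is the corresponding Gibbs expectation. Two replicas $\sigma,\tau$ are independent given $J$ with the same Gibbs measure ($\langle\cdot\rangle$ also denotes their joint expectation); $q_x=\sigma_x\tau_x$, $R_{12}=|\mathcal V_N|^{-1}\sum_xq_x$. $\mathbb P,\mathbb E$: joint law of couplings, replicas and blue bonds. Blue bonds. Given $(J,\sigma,\tau)$, each edge $e=xy$ is independently blue with probability $1-e^{-4\beta|J_e|}$ if $J_e\sigma_x\sigma_y>0$ and $J_e\tau_x\tau_y>0$, and is not blue otherwise. $x\leftrightarrow y$: joined by blue edges; $C(x)$: blue cluster of $x$; $q$ is constant on blue clusters. $C_\pm$ is a largest blue cluster with $q\equiv\pm1$ (empty if none), $\mathcal I_N=(|C_+|-|C_-|)/|\mathcal V_N|$, $M_N=\max\{|C|:C\text{ a blue cluster},A\notin C\}$ ($0$ if none). Effective couplings. For a scale-$k$ sub-diamond $D$ with poles $a_D,b_D$ let $Z_D(s,s')$ be the Boltzmann sum over its interior spins, with couplings of $D$ only and pole spins $(s,s')$; $\xi_D=\frac12\log(Z_D(+,+)/Z_D(+,-))$, and $\xi_k$ denotes the effective coupling of a scale-$k$ sub-diamond (its law depends only on $k$). Small-ball profile: a family of nondecreasing functions $F_k,Q_k:[0,\infty)\to[0,\infty)$, $k\ge0$, such that for all $t\ge0$: $\mathbb P(|\xi_k|<t)\le F_k(t)$ and $\sup_{y\ge0}\mathbb P(||\xi_k|-y|<t)\le Q_k(t)$. With $p(s)=1/(1+e^{2s})$, $\psi(s)=1-(1-p(s))^2$, put for $k\ge1$, $N\ge1$: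 $$a^{\mathrm s}_k=\int_0^\infty\operatorname{sech}^2s\,\tanh s\,\min\{1,Q_{k-1}(s)\}\,ds,$$ $$a^{\mathrm b}_k=\int_0^\infty(-\psi'(s))\min\{1,Q_{k-1}(s)\}\,ds+\int_0^\infty4e^{-4s}\min\{1,F_{k-1}(s)\}^2\,ds,$$ $$S_N=\int_0^\infty2\operatorname{sech}^2t\,\tanh t\,\min\{1,F_N(t)\}\,dt,\qquad P_N=\int_0^\infty\operatorname{sech}^2t\,\min\{1,F_N(t)\}\,dt,$$ and for $1\le j\le N$, $T^{\mathrm s}_{N,j}=\sum_{k=j}^Na^{\mathrm s}_k$, $T^{\mathrm b}_{N,j}=\sum_{k=j}^Na^{\mathrm b}_k$; for $z\in\{A,B\}$ read $T^{\mathrm s}_{N,k_0(z)}$ and $T^{\mathrm b}_{N,k_0(z)}$ as $0$. $x_+=\max(x,0)$. *)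

theory Defs
  imports "HOL-Probability.Probability"
begin

section \<open>The diamond lattice\<close>

text \<open>
  A sub-diamond is addressed by the list of (branch, half) choices leading to it from the whole
  diamond, the innermost choice at the head of the list; \<open>[]\<close> addresses the whole diamond. In the
  pair \<open>(i, h)\<close>, \<open>i\<close> is the branch, and \<open>h\<close> says whether the half adjacent to the first
  (\<open>False\<close>) or to the second (\<open>True\<close>) pole is meant. Inside the diamond of scale \<open>N\<close> a
  sub-diamond with address \<open>w\<close> has scale \<open>N - length w\<close>; those of scale \<open>0\<close> are the edges, so an
  edge is named by an address of length \<open>N\<close>. \<open>Mid w i\<close> is the midpoint of branch \<open>i\<close> of the
  sub-diamond \<open>w\<close>.
\<close>

type_synonym address = "(nat \<times> bool) list"

datatype vertex = PoleA | PoleB | Mid address nat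

fun poles :: "address \<Rightarrow> vertex \<times> vertex" where
  "poles [] = (PoleA, PoleB)"
| "poles ((i, h) # w) =
     (if h then (Mid w i, snd (poles w)) else (fst (poles w), Mid w i))"

fun inner_vertices :: "nat \<Rightarrow> nat \<Rightarrow> address \<Rightarrow> vertex set" where
  "inner_vertices n 0 w = {}"
| "inner_vertices n (Suc k) w =
     (\<Union>i<n. insert (Mid w i)
        (inner_vertices n k ((i, False) # w) \<union> inner_vertices n k ((i, True) # w)))"

fun edges :: "nat \<Rightarrow> nat \<Rightarrow> address \<Rightarrow> address set" where
  "edges n 0 w = {w}"
| "edges n (Suc k) w = (\<Union>i<n. edges n k ((i, False) # w) \<union> edges n k ((i, True) # w))"

definition vertices :: "nat \<Rightarrow> nat \<Rightarrow> address \<Rightarrow> vertex set" where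
  "vertices n k w = {fst (poles w), snd (poles w)} \<union> inner_vertices n k w"

abbreviation diamond_edges :: "nat \<Rightarrow> nat \<Rightarrow> address set" where
  "diamond_edges n N \<equiv> edges n N []"

abbreviation diamond_vertices :: "nat \<Rightarrow> nat \<Rightarrow> vertex set" where
  "diamond_vertices n N \<equiv> vertices n N []"

abbreviation nonpole_vertices :: "nat \<Rightarrow> nat \<Rightarrow> vertex set" where
  "nonpole_vertices n N \<equiv> inner_vertices n N []"

text \<open>The level of a non-pole vertex is the scale of the sub-diamond it is a branch midpoint of.
  The value at the poles is a dummy.\<close>

fun level :: "nat \<Rightarrow> vertex \<Rightarrow> nat" where
  "level N (Mid w i) = N - length w"
| "level N _ = 0"

section \<open>Gibbs measures, replicas and effective couplings\<close>

type_synonym spins = "vertex \<Rightarrow> real"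

definition boltzmann :: "real \<Rightarrow> address set \<Rightarrow> (address \<Rightarrow> real) \<Rightarrow> spins \<Rightarrow> real" where
  "boltzmann \<beta> E J \<sigma> =
     exp (\<beta> * (\<Sum>e\<in>E. J e * \<sigma> (fst (poles e)) * \<sigma> (snd (poles e))))"

abbreviation spin_configs :: "vertex set \<Rightarrow> spins set" where
  "spin_configs V \<equiv> V \<rightarrow>\<^sub>E {-1, 1}"

definition gibbs_free :: "nat \<Rightarrow> real \<Rightarrow> nat \<Rightarrow> (address \<Rightarrow> real) \<Rightarrow> spins pmf" where
  "gibbs_free n \<beta> N J = embed_pmf (\<lambda>\<sigma>.
     if \<sigma> \<in> spin_configs (diamond_vertices n N)
     then boltzmann \<beta> (diamond_edges n N) J \<sigma> /
          (\<Sum>\<sigma>'\<in>spin_configs (diamond_vertices n N). boltzmann \<beta> (diamond_edges n N) J \<sigma>')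
     else 0)"

definition gibbs_fixed ::
  "nat \<Rightarrow> real \<Rightarrow> nat \<Rightarrow> (address \<Rightarrow> real) \<Rightarrow> real \<Rightarrow> real \<Rightarrow> spins pmf" where
  "gibbs_fixed n \<beta> N J s\<^sub>A s\<^sub>B =
     cond_pmf (gibbs_free n \<beta> N J) {\<sigma>. \<sigma> PoleA = s\<^sub>A \<and> \<sigma> PoleB = s\<^sub>B}"

definition overlap :: "nat \<Rightarrow> nat \<Rightarrow> spins \<Rightarrow> spins \<Rightarrow> real" where
  "overlap n N \<sigma> \<tau> =
     (\<Sum>x\<in>diamond_vertices n N. \<sigma> x * \<tau> x) / real (card (diamond_vertices n N))"

definition sub_partition ::
  "nat \<Rightarrow> real \<Rightarrow> nat \<Rightarrow> address \<Rightarrow> (address \<Rightarrow> real) \<Rightarrow> real \<Rightarrow> real \<Rightarrow> real" where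
  "sub_partition n \<beta> k w J s s' =
     (\<Sum>\<sigma> | \<sigma> \<in> spin_configs (vertices n k w) \<and>
            \<sigma> (fst (poles w)) = s \<and> \<sigma> (snd (poles w)) = s'.
        boltzmann \<beta> (edges n k w) J \<sigma>)"

definition eff_coupling ::
  "nat \<Rightarrow> real \<Rightarrow> nat \<Rightarrow> address \<Rightarrow> (address \<Rightarrow> real) \<Rightarrow> real" where
  "eff_coupling n \<beta> k w J =
     1/2 * ln (sub_partition n \<beta> k w J 1 1 / sub_partition n \<beta> k w J 1 (-1))"

text \<open>The random variable \<open>\<xi>\<^sub>k\<close>, realised as the effective coupling of the full diamond of
  scale \<open>k\<close>; for i.i.d. couplings every scale-\<open>k\<close> sub-diamond gives the same law.\<close>

definition \<xi> ::
  "nat \<Rightarrow> real \<Rightarrow> (address \<Rightarrow> 'a \<Rightarrow> real) \<Rightarrow> nat \<Rightarrow> 'a \<Rightarrow> real" where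
  "\<xi> n \<beta> J k \<omega> = eff_coupling n \<beta> k [] (\<lambda>e. J e \<omega>)"

section \<open>Blue bonds\<close>

definition blue_prob :: "real \<Rightarrow> (address \<Rightarrow> real) \<Rightarrow> spins \<Rightarrow> spins \<Rightarrow> address \<Rightarrow> real" where
  "blue_prob \<beta> J \<sigma> \<tau> e =
     (let x = fst (poles e); y = snd (poles e) in
      if J e * \<sigma> x * \<sigma> y > 0 \<and> J e * \<tau> x * \<tau> y > 0 then 1 - exp (-4 * \<beta> * \<bar>J e\<bar>) else 0)"

definition blue_bonds ::
  "nat \<Rightarrow> real \<Rightarrow> nat \<Rightarrow> (address \<Rightarrow> real) \<Rightarrow> spins \<Rightarrow> spins \<Rightarrow> address set pmf" where
  "blue_bonds n \<beta> N J \<sigma> \<tau> =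
     map_pmf (\<lambda>f. {e \<in> diamond_edges n N. f e})
       (Pi_pmf (diamond_edges n N) False (\<lambda>e. bernoulli_pmf (blue_prob \<beta> J \<sigma> \<tau> e)))"

definition replicas_bonds ::
  "nat \<Rightarrow> real \<Rightarrow> nat \<Rightarrow> (address \<Rightarrow> real) \<Rightarrow> (spins \<times> spins \<times> address set) pmf" where
  "replicas_bonds n \<beta> N J =
     bind_pmf (gibbs_free n \<beta> N J) (\<lambda>\<sigma>.
     bind_pmf (gibbs_free n \<beta> N J) (\<lambda>\<tau>.
     map_pmf (\<lambda>b. (\<sigma>, \<tau>, b)) (blue_bonds n \<beta> N J \<sigma> \<tau>)))"

text \<open>The joint law of the disorder \<open>\<omega>\<close> (which determines the couplings \<open>J e \<omega>\<close>), the two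
  replicas and the blue bonds.\<close>

definition joint_law ::
  "'a measure \<Rightarrow> nat \<Rightarrow> real \<Rightarrow> (address \<Rightarrow> 'a \<Rightarrow> real) \<Rightarrow> nat \<Rightarrow>
     ('a \<times> spins \<times> spins \<times> address set) measure" where
  "joint_law M n \<beta> J N =
     M \<bind> (\<lambda>\<omega>. distr (measure_pmf (replicas_bonds n \<beta> N (\<lambda>e. J e \<omega>)))
                   (M \<Otimes>\<^sub>M count_space UNIV) (Pair \<omega>))"

definition blue_adjacent :: "address set \<Rightarrow> vertex \<Rightarrow> vertex \<Rightarrow> bool" where
  "blue_adjacent b x y \<longleftrightarrow> (\<exists>e\<in>b. poles e = (x, y) \<or> poles e = (y, x))"

definition connected_by :: "address set \<Rightarrow> vertex \<Rightarrow> vertex \<Rightarrow> bool" where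
  "connected_by b = (blue_adjacent b)\<^sup>*\<^sup>*"

definition cluster :: "address set \<Rightarrow> vertex \<Rightarrow> vertex set" where
  "cluster b x = {y. connected_by b x y}"

definition clusters :: "nat \<Rightarrow> nat \<Rightarrow> address set \<Rightarrow> vertex set set" where
  "clusters n N b = cluster b ` diamond_vertices n N"

text \<open>Ties between largest clusters are broken by choice, and
  only the cardinality is ever used.\<close>

definition largest_cluster ::
  "nat \<Rightarrow> nat \<Rightarrow> real \<Rightarrow> spins \<Rightarrow> spins \<Rightarrow> address set \<Rightarrow> vertex set" where
  "largest_cluster n N s \<sigma> \<tau> b =
     (let P = (\<lambda>C. C \<in> clusters n N b \<and> (\<forall>y\<in>C. \<sigma> y * \<tau> y = s)) in
      if \<exists>C. P C then arg_max card P else {})"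

definition imbalance ::
  "nat \<Rightarrow> nat \<Rightarrow> spins \<Rightarrow> spins \<Rightarrow> address set \<Rightarrow> real" where
  "imbalance n N \<sigma> \<tau> b =
     (real (card (largest_cluster n N 1 \<sigma> \<tau> b)) - real (card (largest_cluster n N (-1) \<sigma> \<tau> b)))
       / real (card (diamond_vertices n N))"

definition max_off_cluster :: "nat \<Rightarrow> nat \<Rightarrow> address set \<Rightarrow> nat" where
  "max_off_cluster n N b = Max (insert 0 {card C | C. C \<in> clusters n N b \<and> PoleA \<notin> C})"

section \<open>Small-ball profiles\<close>

definition small_ball_profile ::
  "'a measure \<Rightarrow> nat \<Rightarrow> real \<Rightarrow> (address \<Rightarrow> 'a \<Rightarrow> real) \<Rightarrow>
     (nat \<Rightarrow> real \<Rightarrow> real) \<Rightarrow> (nat \<Rightarrow> real \<Rightarrow> real) \<Rightarrow> bool" where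
  "small_ball_profile M n \<beta> J F Q \<longleftrightarrow>
     (\<forall>k. mono_on {0..} (F k) \<and> mono_on {0..} (Q k) \<and>
       (\<forall>t\<ge>0. F k t \<ge> 0 \<and> Q k t \<ge> 0 \<and>
          \<P>(\<omega> in M. \<bar>\<xi> n \<beta> J k \<omega>\<bar> < t) \<le> F k t \<and>
          (SUP y\<in>{0..}. \<P>(\<omega> in M. \<bar>\<bar>\<xi> n \<beta> J k \<omega>\<bar> - y\<bar> < t)) \<le> Q k t))"

definition sech :: "real \<Rightarrow> real" where
  "sech x = 1 / cosh x"

definition p_fun :: "real \<Rightarrow> real" where
  "p_fun s = 1 / (1 + exp (2 * s))"

definition \<psi> :: "real \<Rightarrow> real" where
  "\<psi> s = 1 - (1 - p_fun s)\<^sup>2"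

definition a_s :: "(nat \<Rightarrow> real \<Rightarrow> real) \<Rightarrow> nat \<Rightarrow> real" where
  "a_s Q k = (LBINT s:{0..}. (sech s)\<^sup>2 * tanh s * min 1 (Q (k - 1) s))"

definition a_b :: "(nat \<Rightarrow> real \<Rightarrow> real) \<Rightarrow> (nat \<Rightarrow> real \<Rightarrow> real) \<Rightarrow> nat \<Rightarrow> real" where
  "a_b F Q k =
     (LBINT s:{0..}. (- deriv \<psi> s) * min 1 (Q (k - 1) s))
     + (LBINT s:{0..}. 4 * exp (-4 * s) * (min 1 (F (k - 1) s))\<^sup>2)"

definition S_N :: "(nat \<Rightarrow> real \<Rightarrow> real) \<Rightarrow> nat \<Rightarrow> real" where
  "S_N F N = (LBINT t:{0..}. 2 * (sech t)\<^sup>2 * tanh t * min 1 (F N t))"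

definition P_N :: "(nat \<Rightarrow> real \<Rightarrow> real) \<Rightarrow> nat \<Rightarrow> real" where
  "P_N F N = (LBINT t:{0..}. (sech t)\<^sup>2 * min 1 (F N t))"

definition T_s :: "(nat \<Rightarrow> real \<Rightarrow> real) \<Rightarrow> nat \<Rightarrow> nat \<Rightarrow> real" where
  "T_s Q N j = (\<Sum>k=j..N. a_s Q k)"

definition T_b :: "(nat \<Rightarrow> real \<Rightarrow> real) \<Rightarrow> (nat \<Rightarrow> real \<Rightarrow> real) \<Rightarrow> nat \<Rightarrow> nat \<Rightarrow> real" where
  "T_b F Q N j = (\<Sum>k=j..N. a_b F Q k)"

definition T_s_at :: "(nat \<Rightarrow> real \<Rightarrow> real) \<Rightarrow> nat \<Rightarrow> vertex \<Rightarrow> real" where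
  "T_s_at Q N z = (if z \<in> {PoleA, PoleB} then 0 else T_s Q N (level N z))"

definition T_b_at ::
  "(nat \<Rightarrow> real \<Rightarrow> real) \<Rightarrow> (nat \<Rightarrow> real \<Rightarrow> real) \<Rightarrow> nat \<Rightarrow> vertex \<Rightarrow> real" where
  "T_b_at F Q N z = (if z \<in> {PoleA, PoleB} then 0 else T_b F Q N (level N z))"

definition X_bar ::
  "(nat \<Rightarrow> real \<Rightarrow> real) \<Rightarrow> (nat \<Rightarrow> real \<Rightarrow> real) \<Rightarrow> nat \<Rightarrow> nat \<Rightarrow> real" where
  "X_bar F Q n N =
     (\<Sum>z\<in>diamond_vertices n N. T_b_at F Q N z) / real (card (diamond_vertices n N))"

end

theory Submission
  imports Defs
begin

text \<open>
  Why the bounds hold. By global spin-flip symmetry, a sub-diamond whose interior spins are summed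
  out acts as a single edge carrying its effective coupling (\<open>interior_sum_eff_coupling\<close>). Given
  everything outside a branch with halves of effective couplings \<open>x\<close> and \<open>y\<close>, its midpoint
  therefore feels a field \<open>h = \<plusminus> x \<plusminus> y\<close>, and \<open>\<bar>h\<bar>\<close> is at least the gap \<open>\<bar>\<bar>x\<bar> - \<bar>y\<bar>\<bar>\<close> for all pole spins.
  This uniformity lets estimates made conditionally on the pole spins be integrated without any
  decoupling of the disorder inside and outside the branch (\<open>integrate_local_bound\<close>).

  Overlaps. If two replicas have the same overlap at both poles of a sub-diamond, the midpoint of a
  branch has the other overlap with probability \<open>sech\<^sup>2 h / 2\<close> (\<open>mismatch_two_spins\<close>). A vertex is
  reached from the poles of the whole diamond by a chain of sub-diamonds, one for each scale, so a
  union bound along this chain (\<open>overlap_chain\<close>) controls the probability that the overlap at the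
  vertex differs from that at the poles. Since the square of a Gibbs mean of a sign is
  the mean of the product over two replicas, this gives the magnetisation and correlation bounds.
  For the second moment of the total overlap, multiply it by the overlap at \<open>A\<close> and use the
  Cauchy-Schwarz inequality (\<open>overlap_second_moment\<close>). The mean magnetisation vanishes for symmetric
  couplings because reversing the couplings at one vertex reverses its spin
  (\<open>symmetric_magnetisation\<close>).

  Blue bonds. The joint weight of two replicas and the bonds does not change when both replicas are
  flipped on a blue cluster (\<open>replica_weight_flip\<close>). Where the poles of a sub-diamond are not
  joined, flipping the cluster of one pole turns poles satisfied in both replicas into poles
  unsatisfied in both, so such a sub-diamond joins its poles at least as well as a single edge with
  the effective coupling (\<open>effective_bond\<close>). For the whole diamond this yields disconnection with
  probability at most \<open>1 - tanh \<bar>\<xi>\<bar>\<close>. For a midpoint, both replicas follow the stronger of the two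
  couplings with probability at least \<open>1 - \<psi>\<close> of the gap, and then the stronger half fails to join
  its poles with probability at most \<open>exp (-4 max \<bar>x\<bar> \<bar>y\<bar>)\<close>; the union bound along the
  chain is \<open>connection_chain\<close>.

  Disorder. The effective coupling of any sub-diamond of scale \<open>k\<close> has the law of \<open>\<xi>\<close> at \<open>k\<close>, and
  those of the two halves of a branch are independent, so the small-ball bounds apply to the gap and
  to the maximum. All local costs are decreasing functions vanishing at infinity, and
  \<open>expectation_le_small_ball_integral\<close> turns small-ball bounds into the integrals of the theorem.

  Cluster sizes. The bounds on the largest clusters follow by linearity of the expectation,
  Markov's inequality and two deterministic facts: if the poles are joined to each other and to all
  vertices of high level, a cluster avoiding \<open>A\<close> is confined to the interior of one small sub-diamond
  (\<open>off_cluster_small\<close>); and of the largest clusters of the two overlaps, one is at least as large as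
  the cluster of \<open>A\<close> while the other avoids \<open>A\<close> (\<open>imbalance_ge\<close>).
\<close>

section \<open>Addresses, interiors and edges\<close>

definition addr :: "nat \<Rightarrow> address \<Rightarrow> bool" where
  "addr n w \<longleftrightarrow> (\<forall>(i, h)\<in>set w. i < n)"

lemma addr_simps [simp]:
  "addr n []" "addr n (x # w) \<longleftrightarrow> fst x < n \<and> addr n w" "addr n (u @ w) \<longleftrightarrow> addr n u \<and> addr n w"
  by (auto simp: addr_def)

lemma edges_eq: "edges n k w = {u @ w | u. length u = k \<and> addr n u}"
proof (induction k arbitrary: w)
  case (Suc k)
  have *: "length u = Suc k \<longleftrightarrow> (\<exists>v i h. u = v @ [(i, h)] \<and> length v = k)" for u :: address
    by (cases u rule: rev_cases) auto
  show ?case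
  proof (intro equalityI subsetI)
    fix e assume "e \<in> edges n (Suc k) w"
    then obtain i h v where "i < n" "e = v @ (i, h) # w" "length v = k" "addr n v"
      by (auto simp: Suc)
    then show "e \<in> {u @ w | u. length u = Suc k \<and> addr n u}"
      by (intro CollectI exI[of _ "v @ [(i, h)]"]) auto
  next
    fix e assume "e \<in> {u @ w | u. length u = Suc k \<and> addr n u}"
    then obtain v i h where v: "e = v @ (i, h) # w" "length v = k" "addr n v" "i < n"
      by (auto simp: *)
    then have "e \<in> edges n k ((i, h) # w)" by (auto simp: Suc)
    then show "e \<in> edges n (Suc k) w" using v(4) by (cases h) auto
  qed
qed auto

lemma inner_vertices_eq:
  "inner_vertices n k w = {Mid (u @ w) i | u i. length u < k \<and> addr n u \<and> i < n}"
proof (induction k arbitrary: w)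
  case (Suc k)
  show ?case
  proof (intro equalityI subsetI)
    fix x assume "x \<in> inner_vertices n (Suc k) w"
    then obtain i where i: "i < n" and
      "x = Mid w i \<or> (\<exists>v h l. x = Mid (v @ (i, h) # w) l \<and> length v < k \<and> addr n v \<and> l < n)"
      by (auto simp: Suc)
    then show "x \<in> {Mid (u @ w) i | u i. length u < Suc k \<and> addr n u \<and> i < n}"
    proof (elim disjE exE conjE)
      fix v h l assume "x = Mid (v @ (i, h) # w) l" "length v < k" "addr n v" "l < n"
      then show ?thesis using i by (intro CollectI exI[of _ "v @ [(i, h)]"] exI[of _ l]) auto
    qed auto
  next
    fix x assume "x \<in> {Mid (u @ w) i | u i. length u < Suc k \<and> addr n u \<and> i < n}"
    then obtain u l where u: "x = Mid (u @ w) l" "length u < Suc k" "addr n u" "l < n" by auto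
    show "x \<in> inner_vertices n (Suc k) w"
    proof (cases u rule: rev_cases)
      case (snoc v y)
      obtain i h where y: "y = (i, h)" by (cases y)
      have "x \<in> inner_vertices n k ((i, h) # w)" "i < n"
        using u snoc y by (auto simp: Suc)
      then show ?thesis by (cases h) auto
    qed (use u in auto)
  qed
qed auto

lemma finite_edges [simp]: "finite (edges n k w)"
  by (induction k arbitrary: w) auto

lemma finite_inner_vertices [simp]: "finite (inner_vertices n k w)"
  by (induction k arbitrary: w) auto

lemma finite_vertices [simp]: "finite (vertices n k w)"
  by (simp add: vertices_def)

text \<open>The midpoint of a branch of \<open>v\<close> is a pole only of addresses extending that branch. Hence
  an edge meets the interior of a sub-diamond only if it belongs to it, and the Gibbs measure
  inside a sub-diamond sees the outside only through the poles.\<close>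

lemma Mid_pole_address:
  "Mid v i \<in> {fst (poles e), snd (poles e)} \<Longrightarrow> \<exists>t h. e = t @ (i, h) # v"
proof (induction e rule: poles.induct)
  case (2 j h w)
  then consider "v = w" "i = j" | "Mid v i \<in> {fst (poles w), snd (poles w)}"
    by (cases h) auto
  then show ?case
  proof cases
    case 2
    then obtain t g where "w = t @ (i, g) # v" using "2.IH" by blast
    then show ?thesis by (intro exI[of _ "(j, h) # t"] exI[of _ g]) auto
  qed auto
qed auto

lemma Mid_not_pole [simp]:
  "Mid (u @ w) i \<noteq> fst (poles w)" "Mid (u @ w) i \<noteq> snd (poles w)"
  "fst (poles w) \<noteq> Mid (u @ w) i" "snd (poles w) \<noteq> Mid (u @ w) i"
  using Mid_pole_address[of "u @ w" i w] by (auto dest!: arg_cong[of _ _ length])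

lemma Mid_not_pole' [simp]:
  "Mid w i \<noteq> fst (poles w)" "Mid w i \<noteq> snd (poles w)"
  "fst (poles w) \<noteq> Mid w i" "snd (poles w) \<noteq> Mid w i"
  using Mid_not_pole[of "[]" w i] by auto

lemma poles_neq [simp]: "fst (poles w) \<noteq> snd (poles w)" "snd (poles w) \<noteq> fst (poles w)"
proof -
  have "fst (poles w) \<noteq> snd (poles w)"
  proof (cases w)
    case (Cons x v)
    obtain i h where x: "x = (i, h)" by (cases x)
    show ?thesis using Cons x by auto
  qed auto
  then show "fst (poles w) \<noteq> snd (poles w)" "snd (poles w) \<noteq> fst (poles w)" by auto
qed

lemma poles_append_in_vertices:
  "length u \<le> k \<Longrightarrow> addr n u \<Longrightarrow>
    fst (poles (u @ w)) \<in> vertices n k w \<and> snd (poles (u @ w)) \<in> vertices n k w"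
proof (induction u)
  case (Cons x u)
  obtain i h where x: "x = (i, h)" by (cases x)
  have "Mid (u @ w) i \<in> inner_vertices n k w"
    using Cons.prems x by (auto simp: inner_vertices_eq)
  then show ?case
    using Cons x by (auto simp: vertices_def)
qed (auto simp: vertices_def)

lemma edge_ends_in_vertices:
  assumes "e \<in> edges n k w"
  shows "fst (poles e) \<in> vertices n k w" "snd (poles e) \<in> vertices n k w"
  using assms poles_append_in_vertices by (auto simp: edges_eq)

lemma edge_meets_inner:
  assumes "e \<in> edges n N []" "Mid v i \<in> {fst (poles e), snd (poles e)}"
  obtains t h where "e = t @ (i, h) # v" "addr n t" "addr n v" "i < n"
  using Mid_pole_address[OF assms(2)] assms(1) by (auto simp: edges_eq)

lemma edge_off_inner:
  assumes "e \<in> edges n N [] - edges n k w" "length w + k = N"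
  shows "fst (poles e) \<notin> inner_vertices n k w" "snd (poles e) \<notin> inner_vertices n k w"
proof -
  have "x \<notin> {fst (poles e), snd (poles e)}" if x: "x \<in> inner_vertices n k w" for x
  proof
    assume "x \<in> {fst (poles e), snd (poles e)}"
    moreover obtain u i where u: "x = Mid (u @ w) i" using x by (auto simp: inner_vertices_eq)
    ultimately have "Mid (u @ w) i \<in> {fst (poles e), snd (poles e)}" by simp
    then obtain t h where e: "e = t @ (i, h) # u @ w" "addr n t" "addr n (u @ w)" "i < n"
      using edge_meets_inner assms(1) by blast
    then have "e \<in> edges n k w"
      using assms unfolding edges_eq
      by (intro CollectI exI[of _ "t @ (i, h) # u"]) auto
    then show False using assms(1) by simp
  qed
  then show "fst (poles e) \<notin> inner_vertices n k w" "snd (poles e) \<notin> inner_vertices n k w" by auto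
qed

lemma poles_not_inner [simp]:
  "fst (poles w) \<notin> inner_vertices n k w" "snd (poles w) \<notin> inner_vertices n k w"
  by (auto simp: inner_vertices_eq)

lemma poles_in_diamond:
  assumes "addr n w" "length w \<le> N"
  shows "fst (poles w) \<in> vertices n N []" "snd (poles w) \<in> vertices n N []"
  using poles_append_in_vertices[of w N n "[]"] assms by auto

text \<open>The spins to be summed out in order to find the conditional law of a midpoint given the
  poles.\<close>

definition branch_interior :: "nat \<Rightarrow> nat \<Rightarrow> address \<Rightarrow> nat \<Rightarrow> vertex set" where
  "branch_interior n k w i =
     insert (Mid w i) (inner_vertices n k ((i, False) # w) \<union> inner_vertices n k ((i, True) # w))"

definition branch_edges :: "nat \<Rightarrow> nat \<Rightarrow> address \<Rightarrow> nat \<Rightarrow> address set" where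
  "branch_edges n k w i = edges n k ((i, False) # w) \<union> edges n k ((i, True) # w)"

lemma finite_branch [simp]:
  "finite (branch_interior n k w i)" "finite (branch_edges n k w i)"
  by (simp_all add: branch_interior_def branch_edges_def)

lemma append_Cons_eq_same_tail:
  "u @ x # w = u' @ x' # w \<Longrightarrow> x = x' \<and> u = u'"
proof -
  assume *: "u @ x # w = u' @ x' # w"
  then have "length u = length u'" by (auto dest: arg_cong[of _ _ length])
  with * show ?thesis by simp
qed

lemma halves_disjoint:
  "edges n k ((i, False) # w) \<inter> edges n k ((i, True) # w) = {}"
  "inner_vertices n k ((i, False) # w) \<inter> inner_vertices n k ((i, True) # w) = {}"
  "Mid w i \<notin> inner_vertices n k ((i, h) # w)"
proof -
  show "edges n k ((i, False) # w) \<inter> edges n k ((i, True) # w) = {}"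
    by (auto simp: edges_eq dest!: append_Cons_eq_same_tail)
  show "inner_vertices n k ((i, False) # w) \<inter> inner_vertices n k ((i, True) # w) = {}"
    by (auto simp: inner_vertices_eq dest!: append_Cons_eq_same_tail)
  show "Mid w i \<notin> inner_vertices n k ((i, h) # w)"
    by (auto simp: inner_vertices_eq dest: arg_cong[of _ _ length])
qed

lemma branch_in_diamond:
  assumes "i < n" "length w + Suc k = N" "addr n w"
  shows "branch_interior n k w i \<subseteq> inner_vertices n N []"
    and "branch_edges n k w i \<subseteq> edges n N []"
  using assms
  by (auto simp: branch_interior_def branch_edges_def edges_eq inner_vertices_eq)

lemma edge_off_branch:
  assumes e: "e \<in> edges n N [] - branch_edges n k w i" and N: "length w + Suc k = N"
  shows "fst (poles e) \<notin> branch_interior n k w i" "snd (poles e) \<notin> branch_interior n k w i"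
proof -
  have "fst (poles e) \<noteq> Mid w i \<and> snd (poles e) \<noteq> Mid w i"
  proof (rule ccontr)
    assume "\<not> ?thesis"
    then have "Mid w i \<in> {fst (poles e), snd (poles e)}" by auto
    then obtain t h where t: "e = t @ (i, h) # w" "addr n t"
      using edge_meets_inner e by blast
    have "length e = N" using e by (auto simp: edges_eq)
    then have "e \<in> edges n k ((i, h) # w)" using t N by (auto simp: edges_eq)
    then show False using e by (cases h) (auto simp: branch_edges_def)
  qed
  moreover have "fst (poles e) \<notin> inner_vertices n k ((i, h) # w) \<and>
    snd (poles e) \<notin> inner_vertices n k ((i, h) # w)" for h
    using edge_off_inner[of e n N k "(i, h) # w"] e N by (cases h) (auto simp: branch_edges_def)
  ultimately show "fst (poles e) \<notin> branch_interior n k w i" "snd (poles e) \<notin> branch_interior n k w i"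
    by (auto simp: branch_interior_def)
qed

lemma half_poles [simp]:
  "fst (poles ((i, False) # w)) = fst (poles w)" "snd (poles ((i, False) # w)) = Mid w i"
  "fst (poles ((i, True) # w)) = Mid w i" "snd (poles ((i, True) # w)) = snd (poles w)"
  by auto

lemma poles_not_branch_interior [simp]:
  "fst (poles w) \<notin> branch_interior n k w i" "snd (poles w) \<notin> branch_interior n k w i"
proof -
  have "fst (poles w) \<noteq> Mid (u @ (i, h) # w) l" "snd (poles w) \<noteq> Mid (u @ (i, h) # w) l" for u h l
    using Mid_not_pole[of "u @ [(i, h)]" w l] by simp_all
  then show "fst (poles w) \<notin> branch_interior n k w i" "snd (poles w) \<notin> branch_interior n k w i"
    by (simp_all add: branch_interior_def inner_vertices_eq)
qed

section \<open>Sums over spin configurations\<close>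

text \<open>Summing over these configurations is the unnormalised conditional expectation given the spins
  outside \<open>I\<close>. The frozen spins are kept in the configuration, so that such sums can be nested.\<close>

definition configs :: "vertex set \<Rightarrow> spins \<Rightarrow> spins set" where
  "configs I \<sigma> = {\<rho>. (\<forall>v\<in>I. \<rho> v \<in> {-1, 1}) \<and> (\<forall>v. v \<notin> I \<longrightarrow> \<rho> v = \<sigma> v)}"

lemma configs_empty [simp]: "configs {} \<sigma> = {\<sigma>}"
  by (auto simp: configs_def)

lemma spin_configs_eq: "spin_configs V = configs V (\<lambda>_. undefined)"
  by (auto simp: configs_def PiE_iff extensional_def Pi_iff)

lemma configs_off: "\<rho> \<in> configs I \<sigma> \<Longrightarrow> v \<notin> I \<Longrightarrow> \<rho> v = \<sigma> v"
  by (auto simp: configs_def)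

lemma configs_on: "\<rho> \<in> configs I \<sigma> \<Longrightarrow> v \<in> I \<Longrightarrow> \<rho> v \<in> {-1, 1}"
  by (auto simp: configs_def)

lemma configs_Un: "configs (I \<union> K) \<sigma> = (\<Union>\<rho>\<in>configs I \<sigma>. configs K \<rho>)"
proof (intro equalityI subsetI)
  fix \<rho> assume \<rho>: "\<rho> \<in> configs (I \<union> K) \<sigma>"
  have "(\<lambda>v. if v \<in> I then \<rho> v else \<sigma> v) \<in> configs I \<sigma>"
    "\<rho> \<in> configs K (\<lambda>v. if v \<in> I then \<rho> v else \<sigma> v)"
    using \<rho> by (auto simp: configs_def)
  then show "\<rho> \<in> (\<Union>\<rho>\<in>configs I \<sigma>. configs K \<rho>)" by blast
next
  fix \<rho>' assume "\<rho>' \<in> (\<Union>\<rho>\<in>configs I \<sigma>. configs K \<rho>)"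
  then obtain \<rho> where \<rho>: "\<rho> \<in> configs I \<sigma>" "\<rho>' \<in> configs K \<rho>" by blast
  show "\<rho>' \<in> configs (I \<union> K) \<sigma>"
    unfolding configs_def
  proof (intro CollectI conjI ballI allI impI)
    fix v assume "v \<in> I \<union> K"
    then show "\<rho>' v \<in> {-1, 1}" using \<rho> by (cases "v \<in> K") (auto simp: configs_def)
  next
    fix v assume "v \<notin> I \<union> K"
    then show "\<rho>' v = \<sigma> v" using \<rho> by (auto simp: configs_def)
  qed
qed

lemma configs_singleton: "configs {v} \<sigma> = {\<sigma>(v := -1), \<sigma>(v := 1)}"
  by (auto simp: configs_def fun_eq_iff)

lemma finite_configs [simp]: "finite I \<Longrightarrow> finite (configs I \<sigma>)"
proof (induction I arbitrary: \<sigma> rule: finite_induct)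
  case (insert v I)
  have "configs (insert v I) \<sigma> = (\<Union>\<rho>\<in>configs {v} \<sigma>. configs I \<rho>)"
    using configs_Un[of "{v}" I] by simp
  then show ?case by (simp add: configs_singleton insert.IH)
qed simp

lemma configs_nonempty [simp]: "configs I \<sigma> \<noteq> {}"
proof -
  have "(\<lambda>v. if v \<in> I then 1 else \<sigma> v) \<in> configs I \<sigma>" by (auto simp: configs_def)
  then show ?thesis by blast
qed

text \<open>The tower property of conditional expectations.\<close>

lemma sum_configs_Un:
  assumes "finite I" "finite K" "I \<inter> K = {}"
  shows "(\<Sum>\<rho>\<in>configs (I \<union> K) \<sigma>. f \<rho>) = (\<Sum>\<rho>\<in>configs I \<sigma>. \<Sum>\<rho>'\<in>configs K \<rho>. f \<rho>')"
  unfolding configs_Un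
proof (rule sum.UNION_disjoint)
  show "\<forall>\<rho>\<in>configs I \<sigma>. \<forall>\<rho>'\<in>configs I \<sigma>. \<rho> \<noteq> \<rho>' \<longrightarrow> configs K \<rho> \<inter> configs K \<rho>' = {}"
  proof (intro ballI impI, rule ccontr)
    fix \<rho> \<rho>' assume *: "\<rho> \<in> configs I \<sigma>" "\<rho>' \<in> configs I \<sigma>" "\<rho> \<noteq> \<rho>'"
      and "configs K \<rho> \<inter> configs K \<rho>' \<noteq> {}"
    then obtain \<pi> where \<pi>: "\<pi> \<in> configs K \<rho>" "\<pi> \<in> configs K \<rho>'" by blast
    have "\<rho> v = \<rho>' v" for v
    proof (cases "v \<in> K")
      case True
      then have "v \<notin> I" using assms by blast
      then show ?thesis using * by (simp add: configs_off[of _ I \<sigma>])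
    next
      case False
      then show ?thesis using configs_off[OF \<pi>(1) False] configs_off[OF \<pi>(2) False] by simp
    qed
    with * show False by blast
  qed
qed (use assms in auto)

lemma sum_configs_singleton:
  "(\<Sum>\<rho>\<in>configs {v} \<sigma>. f \<rho>) = f (\<sigma>(v := -1)) + (f (\<sigma>(v := 1)) :: real)"
proof -
  have "\<sigma>(v := -1) \<noteq> \<sigma>(v := 1 :: real)"
  proof
    assume "\<sigma>(v := -1) = \<sigma>(v := 1 :: real)"
    then have "(\<sigma>(v := -1)) v = (\<sigma>(v := 1 :: real)) v" by (rule fun_cong)
    then show False by simp
  qed
  then show ?thesis by (simp add: configs_singleton)
qed

text \<open>Configurations remember all frozen spins; this lemma forgets the irrelevant ones, so that the
  sum over the interior of a sub-diamond becomes a function of its pole spins.\<close>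

lemma sum_configs_start_cong:
  assumes "\<And>v. v \<in> U \<Longrightarrow> v \<notin> I \<Longrightarrow> \<sigma> v = \<sigma>' v"
    and "\<And>\<rho> \<rho>'. (\<And>v. v \<in> U \<Longrightarrow> \<rho> v = \<rho>' v) \<Longrightarrow> f \<rho> = f \<rho>'"
  shows "(\<Sum>\<rho>\<in>configs I \<sigma>. f \<rho>) = (\<Sum>\<rho>\<in>configs I \<sigma>'. f \<rho>)"
  by (rule sum.reindex_bij_witness[where i = "\<lambda>\<rho> v. if v \<in> I then \<rho> v else \<sigma> v"
        and j = "\<lambda>\<rho> v. if v \<in> I then \<rho> v else \<sigma>' v"])
     (auto simp: configs_def fun_eq_iff assms(1) intro!: assms(2))

section \<open>Boltzmann weights and effective couplings\<close>

lemma boltzmann_pos [simp]: "boltzmann \<beta> E J \<sigma> > 0" "boltzmann \<beta> E J \<sigma> \<ge> 0"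
  by (auto simp: boltzmann_def)

lemma boltzmann_Un:
  assumes "finite E" "finite E'" "E \<inter> E' = {}"
  shows "boltzmann \<beta> (E \<union> E') J \<sigma> = boltzmann \<beta> E J \<sigma> * boltzmann \<beta> E' J \<sigma>"
  using assms by (simp add: boltzmann_def sum.union_disjoint algebra_simps exp_add)

lemma boltzmann_cong:
  assumes "\<And>e. e \<in> E \<Longrightarrow> \<sigma> (fst (poles e)) = \<sigma>' (fst (poles e)) \<and> \<sigma> (snd (poles e)) = \<sigma>' (snd (poles e))"
  shows "boltzmann \<beta> E J \<sigma> = boltzmann \<beta> E J \<sigma>'"
  using assms by (auto simp: boltzmann_def intro!: sum.cong)

lemma boltzmann_uminus: "boltzmann \<beta> E J (\<lambda>v. - \<sigma> v) = boltzmann \<beta> E J \<sigma>"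
  by (simp add: boltzmann_def)

definition interior_sum :: "nat \<Rightarrow> real \<Rightarrow> nat \<Rightarrow> address \<Rightarrow> (address \<Rightarrow> real) \<Rightarrow> spins \<Rightarrow> real" where
  "interior_sum n \<beta> k w J \<sigma> =
     (\<Sum>\<rho>\<in>configs (inner_vertices n k w) \<sigma>. boltzmann \<beta> (edges n k w) J \<rho>)"

lemma interior_sum_cong:
  assumes "\<sigma> (fst (poles w)) = \<sigma>' (fst (poles w))" "\<sigma> (snd (poles w)) = \<sigma>' (snd (poles w))"
  shows "interior_sum n \<beta> k w J \<sigma> = interior_sum n \<beta> k w J \<sigma>'"
  unfolding interior_sum_def
  by (rule sum_configs_start_cong[where U = "vertices n k w"])
     (use assms edge_ends_in_vertices in \<open>auto simp: vertices_def intro!: boltzmann_cong\<close>)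

lemma interior_sum_pos: "interior_sum n \<beta> k w J \<sigma> > 0"
  unfolding interior_sum_def by (intro sum_pos) auto

lemma interior_sum_uminus: "interior_sum n \<beta> k w J (\<lambda>v. - \<sigma> v) = interior_sum n \<beta> k w J \<sigma>"
  unfolding interior_sum_def
  by (rule sum.reindex_bij_witness[where i = "\<lambda>\<rho> v. - \<rho> v" and j = "\<lambda>\<rho> v. - \<rho> v"])
     (auto simp: configs_def boltzmann_uminus)

lemma sub_partition_eq:
  assumes s: "s \<in> {-1, 1}" "s' \<in> {-1, 1}"
    and \<sigma>: "\<sigma> (fst (poles w)) = s" "\<sigma> (snd (poles w)) = s'"
  shows "sub_partition n \<beta> k w J s s' = interior_sum n \<beta> k w J \<sigma>"
proof -
  let ?\<sigma> = "(\<lambda>_. undefined)(fst (poles w) := s, snd (poles w) := s')"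
  have "{\<sigma> \<in> spin_configs (vertices n k w). \<sigma> (fst (poles w)) = s \<and> \<sigma> (snd (poles w)) = s'}
      = configs (inner_vertices n k w) ?\<sigma>"
  proof (intro equalityI subsetI)
    fix \<rho> assume "\<rho> \<in> {\<sigma> \<in> spin_configs (vertices n k w). \<sigma> (fst (poles w)) = s \<and> \<sigma> (snd (poles w)) = s'}"
    then show "\<rho> \<in> configs (inner_vertices n k w) ?\<sigma>"
      unfolding spin_configs_eq by (auto simp: configs_def vertices_def)
  next
    fix \<rho> assume \<rho>: "\<rho> \<in> configs (inner_vertices n k w) ?\<sigma>"
    then have "\<rho> (fst (poles w)) = s" "\<rho> (snd (poles w)) = s'"
      by (simp_all add: configs_off)
    with \<rho> s show "\<rho> \<in> {\<sigma> \<in> spin_configs (vertices n k w). \<sigma> (fst (poles w)) = s \<and> \<sigma> (snd (poles w)) = s'}"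
      unfolding spin_configs_eq by (auto simp: configs_def vertices_def)
  qed
  then have "sub_partition n \<beta> k w J s s' = interior_sum n \<beta> k w J ?\<sigma>"
    by (simp add: sub_partition_def interior_sum_def)
  also have "\<dots> = interior_sum n \<beta> k w J \<sigma>"
    using \<sigma> by (intro interior_sum_cong) auto
  finally show ?thesis .
qed

lemma sub_partition_pos: "s \<in> {-1, 1} \<Longrightarrow> s' \<in> {-1, 1} \<Longrightarrow> sub_partition n \<beta> k w J s s' > 0"
  using sub_partition_eq[of s s' "(\<lambda>_. s)(snd (poles w) := s')" w n \<beta> k J] interior_sum_pos
  by simp

definition coupling_const :: "nat \<Rightarrow> real \<Rightarrow> nat \<Rightarrow> address \<Rightarrow> (address \<Rightarrow> real) \<Rightarrow> real" where
  "coupling_const n \<beta> k w J = sqrt (sub_partition n \<beta> k w J 1 1 * sub_partition n \<beta> k w J 1 (-1))"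

lemma coupling_const_pos: "coupling_const n \<beta> k w J > 0"
  by (simp add: coupling_const_def sub_partition_pos)

text \<open>By the global spin-flip symmetry the partition function takes only two values as a function
  of the pole spins, so a sub-diamond with its interior summed out acts as a single edge carrying
  the effective coupling.\<close>

lemma interior_sum_eff_coupling:
  assumes "\<sigma> (fst (poles w)) \<in> {-1, 1}" "\<sigma> (snd (poles w)) \<in> {-1, 1}"
  shows "interior_sum n \<beta> k w J \<sigma> = coupling_const n \<beta> k w J *
    exp (eff_coupling n \<beta> k w J * \<sigma> (fst (poles w)) * \<sigma> (snd (poles w)))"
proof -
  define p q where "p = sub_partition n \<beta> k w J 1 1" and "q = sub_partition n \<beta> k w J 1 (-1)"
  have pos: "p > 0" "q > 0" by (simp_all add: p_def q_def sub_partition_pos)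
  have ln: "ln (sqrt x) = ln x / 2" if "x > 0" for x :: real using that by (simp add: ln_sqrt)
  have 1: "sqrt (p * q) * exp (1/2 * ln (p / q)) = p"
  proof -
    have "exp (1/2 * ln (p / q)) = exp (ln (sqrt (p / q)))" using pos by (simp add: ln)
    also have "\<dots> = sqrt (p / q)" using pos by simp
    finally show ?thesis using pos by (simp add: real_sqrt_mult[symmetric] flip: power2_eq_square)
  qed
  have 2: "sqrt (p * q) * exp (- (1/2 * ln (p / q))) = q"
  proof -
    have "exp (- (1/2 * ln (p / q))) = exp (ln (sqrt (q / p)))"
      using pos by (simp add: ln ln_div field_simps)
    also have "\<dots> = sqrt (q / p)" using pos by simp
    finally show ?thesis using pos by (simp add: real_sqrt_mult[symmetric] flip: power2_eq_square)
  qed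
  have flip: "interior_sum n \<beta> k w J \<sigma> = sub_partition n \<beta> k w J (-s) (-s')"
    if "s \<in> {-1, 1}" "s' \<in> {-1, 1}" "\<sigma> (fst (poles w)) = s" "\<sigma> (snd (poles w)) = s'" for s s'
    using sub_partition_eq[of "-s" "-s'" "\<lambda>v. - \<sigma> v" w n \<beta> k J] that
    by (auto simp: interior_sum_uminus)
  have same: "interior_sum n \<beta> k w J \<sigma> = sub_partition n \<beta> k w J s s'"
    if "s \<in> {-1, 1}" "s' \<in> {-1, 1}" "\<sigma> (fst (poles w)) = s" "\<sigma> (snd (poles w)) = s'" for s s'
    using sub_partition_eq[of s s' \<sigma> w n \<beta> k J] that by auto
  have "interior_sum n \<beta> k w J \<sigma> = (if \<sigma> (fst (poles w)) = \<sigma> (snd (poles w)) then p else q)"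
  proof (cases "\<sigma> (fst (poles w)) = 1")
    case True
    then show ?thesis using same[of 1 1] same[of 1 "-1"] assms by (auto simp: p_def q_def)
  next
    case False
    then show ?thesis using flip[of "-1" 1] flip[of "-1" "-1"] assms by (auto simp: p_def q_def)
  qed
  then show ?thesis
    using assms 1 2 by (auto simp: coupling_const_def eff_coupling_def simp flip: p_def q_def)
qed

section \<open>Blue bonds and cluster flips\<close>

lemma blue_prob_bounds: "\<beta> \<ge> 0 \<Longrightarrow> 0 \<le> blue_prob \<beta> J \<sigma> \<tau> e \<and> blue_prob \<beta> J \<sigma> \<tau> e \<le> 1"
  by (auto simp: blue_prob_def Let_def)

definition blue_law :: "real \<Rightarrow> address set \<Rightarrow> (address \<Rightarrow> real) \<Rightarrow> spins \<Rightarrow> spins \<Rightarrow> address set pmf" where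
  "blue_law \<beta> E J \<sigma> \<tau> =
     map_pmf (\<lambda>f. {e \<in> E. f e}) (Pi_pmf E False (\<lambda>e. bernoulli_pmf (blue_prob \<beta> J \<sigma> \<tau> e)))"

definition bond_weight :: "real \<Rightarrow> address set \<Rightarrow> (address \<Rightarrow> real) \<Rightarrow> spins \<Rightarrow> spins \<Rightarrow> address set \<Rightarrow> real" where
  "bond_weight \<beta> E J \<sigma> \<tau> b =
     (\<Prod>e\<in>E. if e \<in> b then blue_prob \<beta> J \<sigma> \<tau> e else 1 - blue_prob \<beta> J \<sigma> \<tau> e)"

lemma blue_bonds_eq: "blue_bonds n \<beta> N J \<sigma> \<tau> = blue_law \<beta> (edges n N []) J \<sigma> \<tau>"
  by (simp add: blue_bonds_def blue_law_def)

lemma pmf_blue_law: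
  assumes "finite E" "\<beta> \<ge> 0"
  shows "pmf (blue_law \<beta> E J \<sigma> \<tau>) b = (if b \<subseteq> E then bond_weight \<beta> E J \<sigma> \<tau> b else 0)"
proof (cases "b \<subseteq> E")
  case True
  let ?P = "Pi_pmf E False (\<lambda>e. bernoulli_pmf (blue_prob \<beta> J \<sigma> \<tau> e))"
  have "pmf (blue_law \<beta> E J \<sigma> \<tau>) b = measure ?P {f. {e \<in> E. f e} = b}"
    by (simp add: blue_law_def pmf_map vimage_def)
  also have "\<dots> = measure ?P {\<lambda>e. e \<in> b}"
    using set_Pi_pmf_subset[OF assms(1), of False "\<lambda>e. bernoulli_pmf (blue_prob \<beta> J \<sigma> \<tau> e)"] True
    by (intro measure_prob_cong_0) (auto simp: pmf_eq_0_set_pmf fun_eq_iff)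
  also have "\<dots> = pmf ?P (\<lambda>e. e \<in> b)" by (simp add: measure_pmf_single)
  also have "\<dots> = bond_weight \<beta> E J \<sigma> \<tau> b"
    using True assms(1) blue_prob_bounds[OF assms(2)]
    by (auto simp: pmf_Pi bond_weight_def intro!: prod.cong)
  finally show ?thesis using True by simp
next
  case False
  then have "b \<notin> set_pmf (blue_law \<beta> E J \<sigma> \<tau>)" by (auto simp: blue_law_def)
  then show ?thesis using False by (simp add: pmf_eq_0_set_pmf)
qed

lemma set_blue_law: "set_pmf (blue_law \<beta> E J \<sigma> \<tau>) \<subseteq> Pow E"
  by (auto simp: blue_law_def)

text \<open>Whether a half of a branch joins its poles through its own edges is thus an event for the
  bonds of that half alone.\<close>

lemma blue_law_restrict:
  assumes "finite E" "E' \<subseteq> E"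
  shows "map_pmf (\<lambda>b. b \<inter> E') (blue_law \<beta> E J \<sigma> \<tau>) = blue_law \<beta> E' J \<sigma> \<tau>"
  unfolding blue_law_def using assms
  by (subst Pi_pmf_subset[of E E']) (auto simp: pmf.map_comp intro!: map_pmf_cong)

definition noncon_prob :: "real \<Rightarrow> address set \<Rightarrow> (address \<Rightarrow> real) \<Rightarrow> vertex \<Rightarrow> vertex \<Rightarrow> spins \<Rightarrow> spins \<Rightarrow> real" where
  "noncon_prob \<beta> E J x y \<sigma> \<tau> = measure_pmf.prob (blue_law \<beta> E J \<sigma> \<tau>) {b. \<not> connected_by b x y}"

lemma noncon_prob_eq:
  assumes "finite E" "\<beta> \<ge> 0"
  shows "noncon_prob \<beta> E J x y \<sigma> \<tau> =
    (\<Sum>b | b \<subseteq> E \<and> \<not> connected_by b x y. bond_weight \<beta> E J \<sigma> \<tau> b)"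
proof -
  have "noncon_prob \<beta> E J x y \<sigma> \<tau> =
      measure_pmf.prob (blue_law \<beta> E J \<sigma> \<tau>) {b. b \<subseteq> E \<and> \<not> connected_by b x y}"
    unfolding noncon_prob_def using set_blue_law[of \<beta> E J \<sigma> \<tau>]
    by (intro measure_prob_cong_0) (auto simp: pmf_eq_0_set_pmf)
  also have "\<dots> = (\<Sum>b | b \<subseteq> E \<and> \<not> connected_by b x y. pmf (blue_law \<beta> E J \<sigma> \<tau>) b)"
    using assms by (intro measure_measure_pmf_finite) auto
  finally show ?thesis using assms by (simp add: pmf_blue_law)
qed

lemma blue_adjacent_sym: "blue_adjacent b x y \<Longrightarrow> blue_adjacent b y x"
  by (auto simp: blue_adjacent_def)

lemma connected_by_sym: "connected_by b x y \<Longrightarrow> connected_by b y x"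
  unfolding connected_by_def
  by (rule sympD[OF symp_rtranclp[OF sympI[OF blue_adjacent_sym]]])

lemma connected_by_refl [simp]: "connected_by b x x"
  by (simp add: connected_by_def)

lemma connected_by_trans: "connected_by b x y \<Longrightarrow> connected_by b y z \<Longrightarrow> connected_by b x z"
  by (simp add: connected_by_def)

lemma connected_by_mono: "b \<subseteq> b' \<Longrightarrow> connected_by b x y \<Longrightarrow> connected_by b' x y"
  unfolding connected_by_def
  by (erule rtranclp_mono[THEN predicate2D, rotated]) (fastforce simp: blue_adjacent_def)

lemma cluster_edge:
  assumes "e \<in> b"
  shows "fst (poles e) \<in> cluster b y \<longleftrightarrow> snd (poles e) \<in> cluster b y"
proof -
  have "blue_adjacent b (fst (poles e)) (snd (poles e))"
    using assms by (auto simp: blue_adjacent_def)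
  then have "connected_by b (fst (poles e)) (snd (poles e))"
    by (simp add: connected_by_def r_into_rtranclp)
  then show ?thesis
    unfolding cluster_def mem_Collect_eq by (blast intro: connected_by_trans connected_by_sym)
qed

lemma cluster_subset:
  assumes "\<And>e. e \<in> b \<Longrightarrow> fst (poles e) \<in> U \<and> snd (poles e) \<in> U" "y \<in> U"
  shows "cluster b y \<subseteq> U"
proof
  fix z assume "z \<in> cluster b y"
  then have "(blue_adjacent b)\<^sup>*\<^sup>* y z" by (simp add: cluster_def connected_by_def)
  then show "z \<in> U"
    by induction (use assms in \<open>fastforce simp: blue_adjacent_def\<close>)+
qed

definition flip :: "vertex set \<Rightarrow> spins \<Rightarrow> spins" where
  "flip C \<sigma> v = (if v \<in> C then - \<sigma> v else \<sigma> v)"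

definition replica_weight :: "real \<Rightarrow> address set \<Rightarrow> (address \<Rightarrow> real) \<Rightarrow> address set \<Rightarrow> spins \<Rightarrow> spins \<Rightarrow> real" where
  "replica_weight \<beta> E J b \<sigma> \<tau> =
     boltzmann \<beta> E J \<sigma> * boltzmann \<beta> E J \<tau> * bond_weight \<beta> E J \<sigma> \<tau> b"

text \<open>Here \<open>s\<close> and \<open>t\<close> are the products of the spins at the ends of the edge in the two replicas.
  The factor \<open>exp (-4 \<beta> \<bar>j\<bar>)\<close> cuts the case of two satisfied replicas down to the weight of two
  unsatisfied ones; this is what the choice of the bond probability achieves.\<close>

lemma nonblue_weight:
  fixes s t j :: real
  assumes "s \<in> {-1, 1}" "t \<in> {-1, 1}"
  shows "exp (\<beta> * (j * s)) * exp (\<beta> * (j * t)) *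
      (1 - (if j * s > 0 \<and> j * t > 0 then 1 - exp (-4 * \<beta> * \<bar>j\<bar>) else 0)) =
    (if s = t then exp (-2 * \<beta> * \<bar>j\<bar>) else 1)"
proof -
  have "exp (\<beta> * j) * exp (\<beta> * j) * exp (-4 * \<beta> * j) = exp (-2 * \<beta> * j)"
    "exp (\<beta> * j) * exp (\<beta> * j) = exp (2 * \<beta> * j)"
    "exp (- (\<beta> * j)) * exp (- (\<beta> * j)) = exp (-2 * \<beta> * j)"
    "exp (- (\<beta> * j)) * exp (- (\<beta> * j)) * exp (4 * \<beta> * j) = exp (2 * \<beta> * j)"
    "exp (- (\<beta> * j)) * exp (\<beta> * j) = 1" "exp (\<beta> * j) * exp (- (\<beta> * j)) = 1"
    by (simp_all add: mult_exp_exp algebra_simps)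
  then show ?thesis
    using assms by (cases j "0 :: real" rule: linorder_cases) (elim insertE emptyE; simp)+
qed

text \<open>Along a blue edge both ends are flipped or none. On any other edge the weight depends only on
  whether the overlaps at its ends agree, and overlaps do not change when both replicas are
  flipped.\<close>

lemma replica_weight_flip:
  assumes E: "finite E"
    and C: "\<And>e. e \<in> E \<Longrightarrow> e \<in> b \<Longrightarrow> fst (poles e) \<in> C \<longleftrightarrow> snd (poles e) \<in> C"
    and \<sigma>: "\<And>e. e \<in> E \<Longrightarrow> \<sigma> (fst (poles e)) \<in> {-1, 1} \<and> \<sigma> (snd (poles e)) \<in> {-1, 1}"
    and \<tau>: "\<And>e. e \<in> E \<Longrightarrow> \<tau> (fst (poles e)) \<in> {-1, 1} \<and> \<tau> (snd (poles e)) \<in> {-1, 1}"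
  shows "replica_weight \<beta> E J b (flip C \<sigma>) (flip C \<tau>) = replica_weight \<beta> E J b \<sigma> \<tau>"
proof -
  define g where "g e \<sigma> \<tau> = exp (\<beta> * (J e * \<sigma> (fst (poles e)) * \<sigma> (snd (poles e)))) *
      exp (\<beta> * (J e * \<tau> (fst (poles e)) * \<tau> (snd (poles e)))) *
      (if e \<in> b then blue_prob \<beta> J \<sigma> \<tau> e else 1 - blue_prob \<beta> J \<sigma> \<tau> e)" for e \<sigma> \<tau>
  have prod: "replica_weight \<beta> E J b \<sigma> \<tau> = (\<Prod>e\<in>E. g e \<sigma> \<tau>)" for \<sigma> \<tau>
    using E by (simp add: replica_weight_def boltzmann_def bond_weight_def g_def prod.distrib
        sum_distrib_left exp_sum)
  have "g e (flip C \<sigma>) (flip C \<tau>) = g e \<sigma> \<tau>" if e: "e \<in> E" for e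
  proof (cases "fst (poles e) \<in> C \<longleftrightarrow> snd (poles e) \<in> C")
    case True
    then show ?thesis by (auto simp: g_def flip_def blue_prob_def Let_def)
  next
    case False
    with C e have nb: "e \<notin> b" by blast
    define s t where "s = \<sigma> (fst (poles e)) * \<sigma> (snd (poles e))"
      and "t = \<tau> (fst (poles e)) * \<tau> (snd (poles e))"
    have st: "s \<in> {-1, 1}" "t \<in> {-1, 1}" using \<sigma>[OF e] \<tau>[OF e] by (auto simp: s_def t_def)
    have g: "g e \<sigma> \<tau> = exp (\<beta> * (J e * s)) * exp (\<beta> * (J e * t)) *
        (1 - (if J e * s > 0 \<and> J e * t > 0 then 1 - exp (-4 * \<beta> * \<bar>J e\<bar>) else 0))"
      using nb by (simp add: g_def blue_prob_def Let_def s_def t_def mult.assoc)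
    have flipped: "flip C \<rho> (fst (poles e)) * flip C \<rho> (snd (poles e)) = - (\<rho> (fst (poles e)) * \<rho> (snd (poles e)))" for \<rho>
      using False by (auto simp: flip_def)
    have g': "g e (flip C \<sigma>) (flip C \<tau>) = exp (\<beta> * (J e * - s)) * exp (\<beta> * (J e * - t)) *
        (1 - (if J e * - s > 0 \<and> J e * - t > 0 then 1 - exp (-4 * \<beta> * \<bar>J e\<bar>) else 0))"
      using nb unfolding g_def blue_prob_def Let_def s_def t_def mult.assoc flipped by simp
    have neg: "- s \<in> {-1, 1}" "- t \<in> {-1, 1}" using st by auto
    show ?thesis
      unfolding g g' nonblue_weight[OF st] nonblue_weight[OF neg] by simp
  qed
  then show ?thesis by (simp add: prod)
qed

text \<open>If \<open>x\<close> and \<open>y\<close> are not joined, the cluster of \<open>y\<close> consists of \<open>y\<close> and summed-out vertices, so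
  flipping it is a bijection between the configurations with given spins at \<open>x\<close> and \<open>y\<close> and those
  with the spin at \<open>y\<close> reversed.\<close>

lemma sum_flip_cluster:
  assumes E: "finite E" and b: "b \<subseteq> E" and nc: "\<not> connected_by b x y"
    and xy: "x \<notin> I" "y \<notin> I" "x \<noteq> y"
    and ends: "\<And>e. e \<in> E \<Longrightarrow> fst (poles e) \<in> insert x (insert y I) \<and> snd (poles e) \<in> insert x (insert y I)"
    and \<sigma>: "\<sigma> x \<in> {-1, 1}" "\<sigma> y \<in> {-1, 1}" and \<tau>: "\<tau> x \<in> {-1, 1}" "\<tau> y \<in> {-1, 1}"
  shows "(\<Sum>\<rho>\<in>configs I \<sigma>. \<Sum>\<rho>'\<in>configs I \<tau>. replica_weight \<beta> E J b \<rho> \<rho>') =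
    (\<Sum>\<rho>\<in>configs I (\<sigma>(y := - \<sigma> y)). \<Sum>\<rho>'\<in>configs I (\<tau>(y := - \<tau> y)). replica_weight \<beta> E J b \<rho> \<rho>')"
proof -
  define C where "C = cluster b y"
  have "C \<subseteq> insert x (insert y I)"
    unfolding C_def using ends b by (intro cluster_subset) auto
  moreover have "x \<notin> C" using nc connected_by_sym by (auto simp: C_def cluster_def)
  ultimately have C: "C \<subseteq> insert y I" by auto
  have yC: "y \<in> C" by (simp add: C_def cluster_def)
  have flip_configs: "flip C \<rho> \<in> configs I (\<sigma>(y := - \<sigma> y))" if "\<rho> \<in> configs I \<sigma>" for \<rho> \<sigma>
    using that C yC by (auto simp: configs_def flip_def xy)
  have flip_configs': "flip C \<rho> \<in> configs I \<sigma>" if "\<rho> \<in> configs I (\<sigma>(y := - \<sigma> y))" for \<rho> \<sigma>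
    using flip_configs[OF that] by (simp add: fun_upd_idem)
  have ff: "flip C (flip C \<rho>) = \<rho>" for \<rho> by (auto simp: flip_def fun_eq_iff)
  have pm: "\<rho> v \<in> {-1, 1}" if "\<rho> \<in> configs I \<sigma>" "v \<in> insert x (insert y I)" "\<sigma> x \<in> {-1, 1}" "\<sigma> y \<in> {-1, 1}" for \<rho> \<sigma> v
    using that by (cases "v \<in> I") (auto simp: configs_def)
  have eq: "replica_weight \<beta> E J b (flip C \<rho>) (flip C \<rho>') = replica_weight \<beta> E J b \<rho> \<rho>'"
    if "\<rho> \<in> configs I \<sigma>" "\<rho>' \<in> configs I \<tau>" for \<rho> \<rho>'
  proof (rule replica_weight_flip[OF E])
    show "fst (poles e) \<in> C \<longleftrightarrow> snd (poles e) \<in> C" if "e \<in> b" for e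
      unfolding C_def by (rule cluster_edge[OF that])
  next
    fix e assume e: "e \<in> E"
    show "\<rho> (fst (poles e)) \<in> {-1, 1} \<and> \<rho> (snd (poles e)) \<in> {-1, 1}"
      using pm[OF that(1) _ \<sigma>] ends[OF e] by blast
    show "\<rho>' (fst (poles e)) \<in> {-1, 1} \<and> \<rho>' (snd (poles e)) \<in> {-1, 1}"
      using pm[OF that(2) _ \<tau>] ends[OF e] by blast
  qed
  show ?thesis
  proof (rule sum.reindex_bij_witness[where i = "flip C" and j = "flip C"], goal_cases)
    case (5 \<rho>)
    then have \<rho>: "\<rho> \<in> configs I \<sigma>" .
    show ?case
    proof (rule sum.reindex_bij_witness[where i = "flip C" and j = "flip C"], goal_cases)
      case (5 \<rho>')
      then show ?case using eq[OF \<rho> flip_configs'[OF 5]] by (simp add: ff)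
    qed (simp_all add: ff flip_configs flip_configs')
  qed (simp_all add: ff flip_configs flip_configs')
qed

lemma sum_swap3:
  "(\<Sum>x\<in>A. \<Sum>y\<in>B. \<Sum>z\<in>C. f x y z) = (\<Sum>z\<in>C. \<Sum>x\<in>A. \<Sum>y\<in>B. f x y z)"
proof -
  have "(\<Sum>x\<in>A. \<Sum>y\<in>B. \<Sum>z\<in>C. f x y z) = (\<Sum>x\<in>A. \<Sum>z\<in>C. \<Sum>y\<in>B. f x y z)"
    by (intro sum.cong refl sum.swap)
  also have "\<dots> = (\<Sum>z\<in>C. \<Sum>x\<in>A. \<Sum>y\<in>B. f x y z)" by (rule sum.swap)
  finally show ?thesis .
qed

text \<open>Sum the previous identity over the bonds that do not join \<open>x\<close> to \<open>y\<close>, and drop this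
  restriction after the flip.\<close>

lemma noncon_weight_le_reversed:
  assumes E: "finite E" and I: "finite I" and \<beta>: "\<beta> \<ge> 0"
    and xy: "x \<notin> I" "y \<notin> I" "x \<noteq> y"
    and ends: "\<And>e. e \<in> E \<Longrightarrow> fst (poles e) \<in> insert x (insert y I) \<and> snd (poles e) \<in> insert x (insert y I)"
    and \<sigma>: "\<sigma> x \<in> {-1, 1}" "\<sigma> y \<in> {-1, 1}" and \<tau>: "\<tau> x \<in> {-1, 1}" "\<tau> y \<in> {-1, 1}"
  shows "(\<Sum>\<rho>\<in>configs I \<sigma>. \<Sum>\<rho>'\<in>configs I \<tau>.
      boltzmann \<beta> E J \<rho> * boltzmann \<beta> E J \<rho>' * noncon_prob \<beta> E J x y \<rho> \<rho>') \<le>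
    (\<Sum>\<rho>\<in>configs I (\<sigma>(y := - \<sigma> y)). boltzmann \<beta> E J \<rho>) *
    (\<Sum>\<rho>'\<in>configs I (\<tau>(y := - \<tau> y)). boltzmann \<beta> E J \<rho>')"
proof -
  let ?B = "{b. b \<subseteq> E \<and> \<not> connected_by b x y}"
  have fB: "finite ?B" using E by simp
  have sum_W: "boltzmann \<beta> E J \<rho> * boltzmann \<beta> E J \<rho>' * noncon_prob \<beta> E J x y \<rho> \<rho>' =
      (\<Sum>b\<in>?B. replica_weight \<beta> E J b \<rho> \<rho>')" for \<rho> \<rho>'
    by (simp add: noncon_prob_eq[OF E \<beta>] replica_weight_def sum_distrib_left)
  have "(\<Sum>\<rho>\<in>configs I \<sigma>. \<Sum>\<rho>'\<in>configs I \<tau>.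
      boltzmann \<beta> E J \<rho> * boltzmann \<beta> E J \<rho>' * noncon_prob \<beta> E J x y \<rho> \<rho>') =
     (\<Sum>b\<in>?B. \<Sum>\<rho>\<in>configs I \<sigma>. \<Sum>\<rho>'\<in>configs I \<tau>. replica_weight \<beta> E J b \<rho> \<rho>')"
    unfolding sum_W by (rule sum_swap3)
  also have "\<dots> = (\<Sum>b\<in>?B. \<Sum>\<rho>\<in>configs I (\<sigma>(y := - \<sigma> y)). \<Sum>\<rho>'\<in>configs I (\<tau>(y := - \<tau> y)).
      replica_weight \<beta> E J b \<rho> \<rho>')"
  proof (rule sum.cong[OF refl])
    fix b assume b: "b \<in> ?B"
    show "(\<Sum>\<rho>\<in>configs I \<sigma>. \<Sum>\<rho>'\<in>configs I \<tau>. replica_weight \<beta> E J b \<rho> \<rho>') =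
      (\<Sum>\<rho>\<in>configs I (\<sigma>(y := - \<sigma> y)). \<Sum>\<rho>'\<in>configs I (\<tau>(y := - \<tau> y)). replica_weight \<beta> E J b \<rho> \<rho>')"
      by (rule sum_flip_cluster[OF E _ _ xy ends \<sigma> \<tau>]) (use b in simp_all)
  qed
  also have "\<dots> = (\<Sum>\<rho>\<in>configs I (\<sigma>(y := - \<sigma> y)). \<Sum>\<rho>'\<in>configs I (\<tau>(y := - \<tau> y)).
      boltzmann \<beta> E J \<rho> * boltzmann \<beta> E J \<rho>' * noncon_prob \<beta> E J x y \<rho> \<rho>')"
    unfolding sum_W by (rule sum_swap3[symmetric])
  also have "\<dots> \<le> (\<Sum>\<rho>\<in>configs I (\<sigma>(y := - \<sigma> y)). \<Sum>\<rho>'\<in>configs I (\<tau>(y := - \<tau> y)).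
      boltzmann \<beta> E J \<rho> * boltzmann \<beta> E J \<rho>')"
    by (rule sum_mono, rule sum_mono, rule mult_right_le_one_le) (simp_all add: noncon_prob_def)
  also have "\<dots> = (\<Sum>\<rho>\<in>configs I (\<sigma>(y := - \<sigma> y)). boltzmann \<beta> E J \<rho>) *
      (\<Sum>\<rho>'\<in>configs I (\<tau>(y := - \<tau> y)). boltzmann \<beta> E J \<rho>')"
    by (rule sum_product[symmetric])
  finally show ?thesis .
qed

section \<open>Conditioning on everything outside a branch\<close>

text \<open>Edges outside \<open>L\<close> do not meet \<open>K\<close>, so their weight and \<open>G\<close> factor out of the conditional sum
  over the spins in \<open>K\<close>. The constant \<open>c\<close> must not depend on the spins outside \<open>K\<close>: it is then
  also a bound under the full measure, whatever the outside couplings are.\<close>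

lemma integrate_local_bound:
  fixes G f :: "spins \<Rightarrow> spins \<Rightarrow> real"
  assumes V: "finite V" "K \<subseteq> V" and E: "finite E" "L \<subseteq> E"
    and off: "\<And>e. e \<in> E - L \<Longrightarrow> fst (poles e) \<notin> K \<and> snd (poles e) \<notin> K"
    and G_nonneg: "\<And>\<sigma> \<tau>. G \<sigma> \<tau> \<ge> 0"
    and G_cong: "\<And>\<sigma> \<sigma>' \<tau> \<tau>'. (\<And>v. v \<notin> K \<Longrightarrow> \<sigma> v = \<sigma>' v \<and> \<tau> v = \<tau>' v) \<Longrightarrow> G \<sigma> \<tau> = G \<sigma>' \<tau>'"
    and local: "\<And>\<sigma> \<tau>. \<forall>v\<in>V - K. \<sigma> v \<in> {-1, 1} \<and> \<tau> v \<in> {-1, 1} \<Longrightarrow>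
      (\<Sum>\<rho>\<in>configs K \<sigma>. \<Sum>\<rho>'\<in>configs K \<tau>. boltzmann \<beta> L J \<rho> * boltzmann \<beta> L J \<rho>' * f \<rho> \<rho>') \<le>
      c * (\<Sum>\<rho>\<in>configs K \<sigma>. \<Sum>\<rho>'\<in>configs K \<tau>. boltzmann \<beta> L J \<rho> * boltzmann \<beta> L J \<rho>')"
  shows "(\<Sum>\<sigma>\<in>configs V s. \<Sum>\<tau>\<in>configs V t. G \<sigma> \<tau> * boltzmann \<beta> E J \<sigma> * boltzmann \<beta> E J \<tau> * f \<sigma> \<tau>) \<le>
    c * (\<Sum>\<sigma>\<in>configs V s. \<Sum>\<tau>\<in>configs V t. G \<sigma> \<tau> * boltzmann \<beta> E J \<sigma> * boltzmann \<beta> E J \<tau>)"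
proof -
  let ?R = "boltzmann \<beta> (E - L) J" and ?L = "boltzmann \<beta> L J"
  have VK: "V = (V - K) \<union> K" using V by blast
  have split: "(\<Sum>\<sigma>\<in>configs V s. \<Sum>\<tau>\<in>configs V t. G \<sigma> \<tau> * boltzmann \<beta> E J \<sigma> * boltzmann \<beta> E J \<tau> * h \<sigma> \<tau>) =
    (\<Sum>\<sigma>\<in>configs (V - K) s. \<Sum>\<tau>\<in>configs (V - K) t. (G \<sigma> \<tau> * ?R \<sigma> * ?R \<tau>) *
      (\<Sum>\<rho>\<in>configs K \<sigma>. \<Sum>\<rho>'\<in>configs K \<tau>. ?L \<rho> * ?L \<rho>' * h \<rho> \<rho>'))" for h
  proof -
    have fK: "finite K" using V finite_subset by blast
    have su: "(\<Sum>\<sigma>\<in>configs V s. F \<sigma>) = (\<Sum>\<sigma>\<in>configs (V - K) s. \<Sum>\<rho>\<in>configs K \<sigma>. F \<rho>)" for F :: "spins \<Rightarrow> real" and s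
      using sum_configs_Un[of "V - K" K F s] VK V fK by auto
    have "(\<Sum>\<sigma>\<in>configs V s. \<Sum>\<tau>\<in>configs V t. G \<sigma> \<tau> * boltzmann \<beta> E J \<sigma> * boltzmann \<beta> E J \<tau> * h \<sigma> \<tau>) =
      (\<Sum>\<sigma>\<in>configs (V - K) s. \<Sum>\<rho>\<in>configs K \<sigma>. \<Sum>\<tau>\<in>configs (V - K) t. \<Sum>\<rho>'\<in>configs K \<tau>.
        G \<rho> \<rho>' * boltzmann \<beta> E J \<rho> * boltzmann \<beta> E J \<rho>' * h \<rho> \<rho>')"
      unfolding su ..
    also have "\<dots> = (\<Sum>\<sigma>\<in>configs (V - K) s. \<Sum>\<tau>\<in>configs (V - K) t. \<Sum>\<rho>\<in>configs K \<sigma>. \<Sum>\<rho>'\<in>configs K \<tau>.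
        G \<rho> \<rho>' * boltzmann \<beta> E J \<rho> * boltzmann \<beta> E J \<rho>' * h \<rho> \<rho>')"
      by (rule sum.cong[OF refl sum.swap])
    also have "\<dots> = (\<Sum>\<sigma>\<in>configs (V - K) s. \<Sum>\<tau>\<in>configs (V - K) t. \<Sum>\<rho>\<in>configs K \<sigma>. \<Sum>\<rho>'\<in>configs K \<tau>.
        (G \<sigma> \<tau> * ?R \<sigma> * ?R \<tau>) * (?L \<rho> * ?L \<rho>' * h \<rho> \<rho>'))"
    proof (intro sum.cong refl)
      fix \<sigma> \<tau> \<rho> \<rho>' assume \<rho>: "\<rho> \<in> configs K \<sigma>" "\<rho>' \<in> configs K \<tau>"
      have EL: "boltzmann \<beta> E J \<pi> = ?R \<pi> * ?L \<pi>" for \<pi>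
        using boltzmann_Un[of "E - L" L \<beta> J \<pi>] E
        by (simp add: Un_absorb2 finite_subset Int_Diff Int_commute)
      have "G \<rho> \<rho>' = G \<sigma> \<tau>" by (rule G_cong) (use \<rho> configs_off in auto)
      moreover have "?R \<rho> = ?R \<sigma>" "?R \<rho>' = ?R \<tau>"
        using off \<rho> by (auto intro!: boltzmann_cong simp: configs_off)
      ultimately show "G \<rho> \<rho>' * boltzmann \<beta> E J \<rho> * boltzmann \<beta> E J \<rho>' * h \<rho> \<rho>' =
          (G \<sigma> \<tau> * ?R \<sigma> * ?R \<tau>) * (?L \<rho> * ?L \<rho>' * h \<rho> \<rho>')"
        by (simp add: EL)
    qed
    finally show ?thesis by (simp add: sum_distrib_left)
  qed
  have "(\<Sum>\<sigma>\<in>configs V s. \<Sum>\<tau>\<in>configs V t. G \<sigma> \<tau> * boltzmann \<beta> E J \<sigma> * boltzmann \<beta> E J \<tau> * f \<sigma> \<tau>) \<le>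
    (\<Sum>\<sigma>\<in>configs (V - K) s. \<Sum>\<tau>\<in>configs (V - K) t. (G \<sigma> \<tau> * ?R \<sigma> * ?R \<tau>) *
      (c * (\<Sum>\<rho>\<in>configs K \<sigma>. \<Sum>\<rho>'\<in>configs K \<tau>. ?L \<rho> * ?L \<rho>')))"
    unfolding split[of f]
    by (intro sum_mono mult_left_mono local ballI) (auto simp: G_nonneg dest: configs_on)
  also have "\<dots> = c * (\<Sum>\<sigma>\<in>configs (V - K) s. \<Sum>\<tau>\<in>configs (V - K) t. (G \<sigma> \<tau> * ?R \<sigma> * ?R \<tau>) *
      (\<Sum>\<rho>\<in>configs K \<sigma>. \<Sum>\<rho>'\<in>configs K \<tau>. ?L \<rho> * ?L \<rho>'))"
    by (simp add: sum_distrib_left mult_ac)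
  also have "\<dots> = c * (\<Sum>\<sigma>\<in>configs V s. \<Sum>\<tau>\<in>configs V t. G \<sigma> \<tau> * boltzmann \<beta> E J \<sigma> * boltzmann \<beta> E J \<tau>)"
    using split[of "\<lambda>_ _. 1"] by simp
  finally show ?thesis .
qed

text \<open>The interior of the half opposite to \<open>h\<close>, which \<open>f\<close> does not see, is replaced by its partition
  function; the spins of the half \<open>h\<close> stay, since \<open>f\<close> may be a probability about its bonds.\<close>

lemma branch_sum:
  fixes f :: "spins \<Rightarrow> real"
  assumes f: "\<And>\<rho> \<rho>'. (\<And>v. v \<notin> inner_vertices n k ((i, \<not> h) # w) \<Longrightarrow> \<rho> v = \<rho>' v) \<Longrightarrow> f \<rho> = f \<rho>'"
  shows "(\<Sum>\<rho>\<in>configs (branch_interior n k w i) \<sigma>. boltzmann \<beta> (branch_edges n k w i) J \<rho> * f \<rho>) =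
    (\<Sum>s\<in>{-1, 1}. interior_sum n \<beta> k ((i, \<not> h) # w) J (\<sigma>(Mid w i := s)) *
      (\<Sum>\<rho>\<in>configs (inner_vertices n k ((i, h) # w)) (\<sigma>(Mid w i := s)).
         boltzmann \<beta> (edges n k ((i, h) # w)) J \<rho> * f \<rho>))"
proof -
  let ?I = "inner_vertices n k ((i, h) # w)" and ?I' = "inner_vertices n k ((i, \<not> h) # w)"
  let ?B = "boltzmann \<beta> (edges n k ((i, h) # w)) J" and ?B' = "boltzmann \<beta> (edges n k ((i, \<not> h) # w)) J"
  have disj: "?I \<inter> ?I' = {}" "edges n k ((i, h) # w) \<inter> edges n k ((i, \<not> h) # w) = {}"
    using halves_disjoint(1,2)[of n k i w] by (cases h; auto)+
  have K: "branch_interior n k w i = {Mid w i} \<union> (?I \<union> ?I')"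
    by (cases h) (auto simp: branch_interior_def)
  have B: "boltzmann \<beta> (branch_edges n k w i) J \<rho> = ?B \<rho> * ?B' \<rho>" for \<rho>
    using boltzmann_Un[of "edges n k ((i, h) # w)" "edges n k ((i, \<not> h) # w)" \<beta> J \<rho>] disj
    by (cases h) (auto simp: branch_edges_def Un_commute)
  have pole_I: "v \<notin> ?I'" if "v \<in> vertices n k ((i, h) # w)" for v
  proof
    assume "v \<in> ?I'"
    moreover have "v \<in> {Mid w i, fst (poles w), snd (poles w)} \<or> v \<in> ?I"
      using that by (cases h) (auto simp: vertices_def)
    moreover have "Mid w i \<notin> ?I'" "fst (poles w) \<notin> ?I'" "snd (poles w) \<notin> ?I'"
      using poles_not_branch_interior[of w n k i] K halves_disjoint(3) by auto
    ultimately show False using disj by auto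
  qed
  have inner: "(\<Sum>\<rho>'\<in>configs ?I' \<rho>. ?B \<rho>' * ?B' \<rho>' * f \<rho>') =
      ?B \<rho> * f \<rho> * interior_sum n \<beta> k ((i, \<not> h) # w) J \<pi>"
    if "\<rho> \<in> configs ?I \<pi>" for \<rho> \<pi>
  proof -
    have "?B \<rho>' * ?B' \<rho>' * f \<rho>' = ?B \<rho> * f \<rho> * ?B' \<rho>'" if "\<rho>' \<in> configs ?I' \<rho>" for \<rho>'
    proof -
      have "f \<rho>' = f \<rho>" by (rule f) (use that configs_off in auto)
      moreover have "?B \<rho>' = ?B \<rho>"
        using that pole_I edge_ends_in_vertices
        by (intro boltzmann_cong) (metis configs_off)
      ultimately show ?thesis by simp
    qed
    then have "(\<Sum>\<rho>'\<in>configs ?I' \<rho>. ?B \<rho>' * ?B' \<rho>' * f \<rho>') = ?B \<rho> * f \<rho> * interior_sum n \<beta> k ((i, \<not> h) # w) J \<rho>"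
      unfolding interior_sum_def sum_distrib_left by (rule sum.cong[OF refl])
    also have "interior_sum n \<beta> k ((i, \<not> h) # w) J \<rho> = interior_sum n \<beta> k ((i, \<not> h) # w) J \<pi>"
    proof -
      have "Mid w i \<notin> ?I" "fst (poles w) \<notin> ?I" "snd (poles w) \<notin> ?I"
        using poles_not_branch_interior[of w n k i] K halves_disjoint(3) by auto
      then show ?thesis
        using that by (intro interior_sum_cong) (cases h; simp add: configs_off)+
    qed
    finally show ?thesis .
  qed
  have "(\<Sum>\<rho>\<in>configs (branch_interior n k w i) \<sigma>. boltzmann \<beta> (branch_edges n k w i) J \<rho> * f \<rho>) =
    (\<Sum>\<pi>\<in>configs {Mid w i} \<sigma>. \<Sum>\<rho>\<in>configs ?I \<pi>. \<Sum>\<rho>'\<in>configs ?I' \<rho>. ?B \<rho>' * ?B' \<rho>' * f \<rho>')"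
    unfolding K B
    using disj halves_disjoint(3)[of w i n k] by (subst sum_configs_Un; simp add: sum_configs_Un)
  also have "\<dots> = (\<Sum>\<pi>\<in>configs {Mid w i} \<sigma>. \<Sum>\<rho>\<in>configs ?I \<pi>.
      ?B \<rho> * f \<rho> * interior_sum n \<beta> k ((i, \<not> h) # w) J \<pi>)"
    by (intro sum.cong refl inner)
  also have "\<dots> = (\<Sum>\<pi>\<in>configs {Mid w i} \<sigma>. interior_sum n \<beta> k ((i, \<not> h) # w) J \<pi> *
      (\<Sum>\<rho>\<in>configs ?I \<pi>. ?B \<rho> * f \<rho>))"
    by (simp add: sum_distrib_left mult.commute)
  finally show ?thesis by (simp add: sum_configs_singleton)
qed

definition far_pole :: "bool \<Rightarrow> address \<Rightarrow> vertex" where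
  "far_pole h w = (if h then snd (poles w) else fst (poles w))"

lemma interior_sum_half:
  assumes "\<sigma> (far_pole h w) \<in> {-1, 1}" "s \<in> {-1, 1}"
  shows "interior_sum n \<beta> k ((i, h) # w) J (\<sigma>(Mid w i := s)) =
    coupling_const n \<beta> k ((i, h) # w) J * exp (eff_coupling n \<beta> k ((i, h) # w) J * \<sigma> (far_pole h w) * s)"
  using assms
  by (subst interior_sum_eff_coupling; cases h) (simp_all add: far_pole_def mult_ac)

lemma branch_sum2:
  fixes f :: "spins \<Rightarrow> spins \<Rightarrow> real"
  assumes f: "\<And>\<rho> \<rho>' \<pi> \<pi>'. (\<And>v. v \<notin> inner_vertices n k ((i, \<not> h) # w) \<Longrightarrow> \<rho> v = \<rho>' v \<and> \<pi> v = \<pi>' v) \<Longrightarrow>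
    f \<rho> \<pi> = f \<rho>' \<pi>'"
  shows "(\<Sum>\<rho>\<in>configs (branch_interior n k w i) \<sigma>. \<Sum>\<pi>\<in>configs (branch_interior n k w i) \<tau>.
      boltzmann \<beta> (branch_edges n k w i) J \<rho> * boltzmann \<beta> (branch_edges n k w i) J \<pi> * f \<rho> \<pi>) =
    (\<Sum>s\<in>{-1, 1}. \<Sum>t\<in>{-1, 1}.
      interior_sum n \<beta> k ((i, \<not> h) # w) J (\<sigma>(Mid w i := s)) *
      interior_sum n \<beta> k ((i, \<not> h) # w) J (\<tau>(Mid w i := t)) *
      (\<Sum>\<rho>\<in>configs (inner_vertices n k ((i, h) # w)) (\<sigma>(Mid w i := s)).
       \<Sum>\<pi>\<in>configs (inner_vertices n k ((i, h) # w)) (\<tau>(Mid w i := t)).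
         boltzmann \<beta> (edges n k ((i, h) # w)) J \<rho> * boltzmann \<beta> (edges n k ((i, h) # w)) J \<pi> * f \<rho> \<pi>))"
proof -
  let ?K = "branch_interior n k w i" and ?L = "boltzmann \<beta> (branch_edges n k w i) J"
  let ?I = "inner_vertices n k ((i, h) # w)" and ?B = "boltzmann \<beta> (edges n k ((i, h) # w)) J"
  let ?Z = "interior_sum n \<beta> k ((i, \<not> h) # w) J"
  have "(\<Sum>\<rho>\<in>configs ?K \<sigma>. \<Sum>\<pi>\<in>configs ?K \<tau>. ?L \<rho> * ?L \<pi> * f \<rho> \<pi>) =
    (\<Sum>\<rho>\<in>configs ?K \<sigma>. ?L \<rho> * (\<Sum>\<pi>\<in>configs ?K \<tau>. ?L \<pi> * f \<rho> \<pi>))"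
    by (simp add: sum_distrib_left mult.assoc)
  also have "\<dots> = (\<Sum>s\<in>{-1, 1}. ?Z (\<sigma>(Mid w i := s)) * (\<Sum>\<rho>\<in>configs ?I (\<sigma>(Mid w i := s)).
      ?B \<rho> * (\<Sum>\<pi>\<in>configs ?K \<tau>. ?L \<pi> * f \<rho> \<pi>)))"
    by (rule branch_sum) (intro sum.cong refl arg_cong2[of _ _ _ _ "(*)"] f, auto)
  also have "\<dots> = (\<Sum>s\<in>{-1, 1}. ?Z (\<sigma>(Mid w i := s)) * (\<Sum>\<rho>\<in>configs ?I (\<sigma>(Mid w i := s)).
      ?B \<rho> * (\<Sum>t\<in>{-1, 1}. ?Z (\<tau>(Mid w i := t)) * (\<Sum>\<pi>\<in>configs ?I (\<tau>(Mid w i := t)). ?B \<pi> * f \<rho> \<pi>))))"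
    by (subst branch_sum[where h = h and f = "f _"]) (auto intro!: f)
  also have "\<dots> = (\<Sum>s\<in>{-1, 1}. \<Sum>t\<in>{-1, 1}. ?Z (\<sigma>(Mid w i := s)) * ?Z (\<tau>(Mid w i := t)) *
      (\<Sum>\<rho>\<in>configs ?I (\<sigma>(Mid w i := s)). \<Sum>\<pi>\<in>configs ?I (\<tau>(Mid w i := t)). ?B \<rho> * ?B \<pi> * f \<rho> \<pi>))"
    unfolding sum_distrib_left
    by (rule sum.cong[OF refl], subst sum.swap) (simp add: mult_ac)
  finally show ?thesis .
qed

section \<open>One midpoint with given pole spins\<close>

lemma cosh_mono_abs: "\<bar>x\<bar> \<le> \<bar>y\<bar> \<Longrightarrow> cosh x \<le> cosh (y :: real)"
  using cosh_real_nonneg_le_iff[of "\<bar>x\<bar>" "\<bar>y\<bar>"] by simp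

lemma two_spin_sum:
  fixes h h' :: real
  shows "(\<Sum>s\<in>{-1, 1}. \<Sum>t\<in>{-1, 1}. exp (h * s) * exp (h' * t)) = (2 * cosh h) * (2 * cosh h')"
  by (simp add: cosh_def algebra_simps)

text \<open>If the overlaps at the two poles agree, the fields on the midpoint in the two replicas are
  equal up to the sign given by that overlap, and the wrong overlap at the midpoint has
  probability \<open>2 / (2 cosh h)\<^sup>2\<close>, where \<open>h\<close> is this field.\<close>

lemma mismatch_two_spins:
  fixes x y a b a' b' :: real
  assumes "a \<in> {-1, 1}" "b \<in> {-1, 1}" "a' \<in> {-1, 1}" "b' \<in> {-1, 1}"
  shows "(\<Sum>s\<in>{-1, 1}. \<Sum>t\<in>{-1, 1}. exp ((x * a + y * b) * s) * exp ((x * a' + y * b') * t) *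
      of_bool (s * t \<noteq> a * a' \<and> a * a' = b * b')) \<le>
    (sech (\<bar>\<bar>x\<bar> - \<bar>y\<bar>\<bar>))\<^sup>2 / 2 *
    (\<Sum>s\<in>{-1, 1}. \<Sum>t\<in>{-1, 1}. exp ((x * a + y * b) * s) * exp ((x * a' + y * b') * t))"
proof (cases "a * a' = b * b'")
  case True
  define h where "h = x * a + y * b"
  have h': "x * a' + y * b' = a * a' * h"
    using assms True by (auto simp: h_def)
  have abs: "\<bar>\<bar>\<bar>x\<bar> - \<bar>y\<bar>\<bar>\<bar> \<le> \<bar>h\<bar>"
    using assms(1,2) by (auto simp: h_def)
  have q: "a * a' \<in> {-1, 1}" using assms by auto
  have c: "cosh (a * a' * h) = cosh h" using q by auto
  have "(\<Sum>s\<in>{-1, 1}. \<Sum>t\<in>{-1, 1}. exp (h * s) * exp (a * a' * h * t) * of_bool (s * t \<noteq> a * a' \<and> a * a' = b * b')) = 2"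
    using True[symmetric] q by (auto simp: exp_minus)
  also have "\<dots> \<le> (sech (\<bar>\<bar>x\<bar> - \<bar>y\<bar>\<bar>))\<^sup>2 / 2 * ((2 * cosh h) * (2 * cosh h))"
  proof -
    let ?u = "\<bar>\<bar>x\<bar> - \<bar>y\<bar>\<bar>"
    have "cosh ?u \<le> cosh h" using abs by (rule cosh_mono_abs)
    then have "(cosh ?u)\<^sup>2 \<le> (cosh h)\<^sup>2" by (intro power_mono) auto
    then show ?thesis
      by (simp add: sech_def power_divide divide_simps power2_eq_square[of "cosh h"])
  qed
  finally show ?thesis
    unfolding two_spin_sum h' h_def[symmetric] c by simp
qed (auto intro!: mult_nonneg_nonneg sum_nonneg)

text \<open>A spin in a field \<open>u\<close> follows the field with probability \<open>1 - p u\<close>, which increases with the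
  field.\<close>

lemma p_fun_le:
  fixes u h :: real
  assumes "u \<le> h"
  shows "exp h \<ge> (1 - p_fun u) * (2 * cosh h)"
proof -
  have "1 - p_fun u = 1 / (1 + exp (-2 * u))"
  proof -
    define e where "e = exp (2 * u)"
    have "e > 0" by (simp add: e_def)
    then have "1 - 1 / (1 + e) = 1 / (1 + 1 / e)" by (simp add: divide_simps add_pos_pos)
    then show ?thesis by (simp add: p_fun_def e_def exp_minus inverse_eq_divide)
  qed
  also have "\<dots> \<le> 1 / (1 + exp (-2 * h))"
    using assms by (intro divide_left_mono) (auto simp: add_pos_pos)
  also have "\<dots> * (2 * cosh h) = exp h"
  proof -
    have "2 * cosh h = exp h * (1 + exp (-2 * h))"
      by (simp add: cosh_def algebra_simps mult_exp_exp)
    then show ?thesis by (simp add: add_pos_pos less_imp_neq[symmetric])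
  qed
  finally show ?thesis by (simp add: mult_right_mono)
qed

lemma p_fun_bounds: "0 \<le> p_fun u" "p_fun u \<le> 1"
  by (auto simp: p_fun_def divide_simps add_pos_pos add_nonneg_nonneg)

text \<open>Here \<open>x\<close> is the stronger of the two couplings at the midpoint: both replicas follow it with
  probability at least \<open>(1 - p u)\<^sup>2 = 1 - \<psi> u\<close>.\<close>

lemma follow_stronger_coupling:
  fixes x y c d c' d' :: real
  assumes cd: "c \<in> {-1, 1}" "d \<in> {-1, 1}" "c' \<in> {-1, 1}" "d' \<in> {-1, 1}" and xy: "\<bar>y\<bar> \<le> \<bar>x\<bar>"
  shows "(\<Sum>s\<in>{-1, 1}. \<Sum>t\<in>{-1, 1}. exp ((x * c + y * d) * s) * exp ((x * c' + y * d') * t) *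
      (if x * c * s \<ge> 0 \<and> x * c' * t \<ge> 0 then exp (-4 * \<bar>x\<bar>) else 1)) \<le>
    (\<psi> (\<bar>\<bar>x\<bar> - \<bar>y\<bar>\<bar>) + exp (-4 * \<bar>x\<bar>)) *
    (\<Sum>s\<in>{-1, 1}. \<Sum>t\<in>{-1, 1}. exp ((x * c + y * d) * s) * exp ((x * c' + y * d') * t))"
proof -
  define u where "u = \<bar>\<bar>x\<bar> - \<bar>y\<bar>\<bar>"
  define \<epsilon> where "\<epsilon> = exp (-4 * \<bar>x\<bar>)"
  have \<psi>: "\<psi> u = 1 - (1 - p_fun u)\<^sup>2" by (simp add: \<psi>_def)
  have p: "0 \<le> p_fun u" "p_fun u \<le> 1" by (rule p_fun_bounds)+
  have \<epsilon>: "0 < \<epsilon>" "\<epsilon> \<le> 1" by (auto simp: \<epsilon>_def)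
  have psi0: "0 \<le> \<psi> u"
    unfolding \<psi> using p power_le_one[of "1 - p_fun u" 2] by simp
  show ?thesis
  proof (cases "x = 0")
    case True
    with psi0 show ?thesis by (simp add: u_def algebra_simps)
  next
    case False
    define S T where "S = sgn x * c" and "T = sgn x * c'"
    define h h' where "h = \<bar>x\<bar> + y * d * S" and "h' = \<bar>x\<bar> + y * d' * T"
    have ST: "S \<in> {-1, 1}" "T \<in> {-1, 1}" using cd False by (auto simp: S_def T_def sgn_if)
    have xS: "x * c * s \<ge> 0 \<longleftrightarrow> s = S" "x * c' * s \<ge> 0 \<longleftrightarrow> s = T" if "s \<in> {-1, 1}" for s
      using that cd False by (auto simp: S_def T_def sgn_if)
    have xh: "(x * c + y * d) * S = h" "(x * c' + y * d') * T = h'"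
      "(x * c + y * d) * - S = - h" "(x * c' + y * d') * - T = - h'"
      using cd False by (auto simp: S_def T_def h_def h'_def sgn_if algebra_simps)
    have uh: "u \<le> h" "u \<le> h'"
      using cd ST xy by (auto simp: u_def h_def h'_def)
    have re: "(\<Sum>s\<in>{-1, 1}. \<Sum>t\<in>{-1, 1}. F s t) = F S T + F S (- T) + F (- S) T + F (- S) (- T)" for F :: "real \<Rightarrow> real \<Rightarrow> real"
      using ST by auto
    have ne: "- S \<noteq> S" "- T \<noteq> T" using ST by auto
    have sat: "(x * c * S \<ge> 0) = True" "(x * c' * T \<ge> 0) = True"
      "(x * c * - S \<ge> 0) = False" "(x * c' * - T \<ge> 0) = False"
      using xS[of S] xS[of T] xS[of "-S"] xS[of "-T"] ST ne by auto
    have tot: "(\<Sum>s\<in>{-1, 1}. \<Sum>t\<in>{-1, 1}. exp ((x * c + y * d) * s) * exp ((x * c' + y * d') * t)) =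
        (2 * cosh h) * (2 * cosh h')"
    proof -
      have "cosh (a * r) = cosh a" if "r \<in> {-1, 1}" for a r :: real using that by auto
      from this[OF ST(1), of "x * c + y * d"] this[OF ST(2), of "x * c' + y * d'"]
      have "cosh (x * c + y * d) = cosh h" "cosh (x * c' + y * d') = cosh h'"
        using xh by simp_all
      then show ?thesis unfolding two_spin_sum by (simp only:)
    qed
    have "(\<Sum>s\<in>{-1, 1}. \<Sum>t\<in>{-1, 1}. exp ((x * c + y * d) * s) * exp ((x * c' + y * d') * t) *
        (if x * c * s \<ge> 0 \<and> x * c' * t \<ge> 0 then \<epsilon> else 1)) =
        (2 * cosh h) * (2 * cosh h') - (1 - \<epsilon>) * (exp h * exp h')"
      unfolding re xh sat by (simp add: cosh_def algebra_simps)
    also have "\<dots> \<le> (2 * cosh h) * (2 * cosh h') - (1 - \<epsilon>) *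
        (((1 - p_fun u) * (2 * cosh h)) * ((1 - p_fun u) * (2 * cosh h')))"
      using p \<epsilon> uh by (intro diff_left_mono mult_left_mono mult_mono p_fun_le) auto
    also have "\<dots> = (1 - (1 - \<epsilon>) * (1 - p_fun u)\<^sup>2) * ((2 * cosh h) * (2 * cosh h'))"
      by (simp add: power2_eq_square algebra_simps)
    also have "\<dots> \<le> (\<psi> u + \<epsilon>) * ((2 * cosh h) * (2 * cosh h'))"
    proof (rule mult_right_mono)
      have "\<epsilon> * (1 - p_fun u)\<^sup>2 \<le> \<epsilon>" using \<epsilon> p by (simp add: power_le_one mult_left_le)
      then show "1 - (1 - \<epsilon>) * (1 - p_fun u)\<^sup>2 \<le> \<psi> u + \<epsilon>" by (simp add: \<psi> algebra_simps)
    qed simp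
    finally show ?thesis unfolding tot by (simp only: \<epsilon>_def u_def)
  qed
qed

text \<open>Reversing one pole in both replicas turns two satisfied effective couplings into two
  unsatisfied ones, whose weight is smaller by the factor \<open>exp (-4 \<bar>\<xi>\<bar>)\<close>. If not both are
  satisfied, the trivial bound suffices.\<close>

lemma effective_bond:
  fixes n k :: nat and J :: "address \<Rightarrow> real"
  assumes \<beta>: "\<beta> \<ge> 0"
    and \<sigma>: "\<sigma> (fst (poles w)) \<in> {-1, 1}" "\<sigma> (snd (poles w)) \<in> {-1, 1}"
    and \<tau>: "\<tau> (fst (poles w)) \<in> {-1, 1}" "\<tau> (snd (poles w)) \<in> {-1, 1}"
  defines "\<xi>w \<equiv> eff_coupling n \<beta> k w J"
  shows "(\<Sum>\<rho>\<in>configs (inner_vertices n k w) \<sigma>. \<Sum>\<pi>\<in>configs (inner_vertices n k w) \<tau>.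
      boltzmann \<beta> (edges n k w) J \<rho> * boltzmann \<beta> (edges n k w) J \<pi> *
      noncon_prob \<beta> (edges n k w) J (fst (poles w)) (snd (poles w)) \<rho> \<pi>) \<le>
    interior_sum n \<beta> k w J \<sigma> * interior_sum n \<beta> k w J \<tau> *
    (if \<xi>w * \<sigma> (fst (poles w)) * \<sigma> (snd (poles w)) \<ge> 0 \<and> \<xi>w * \<tau> (fst (poles w)) * \<tau> (snd (poles w)) \<ge> 0
     then exp (-4 * \<bar>\<xi>w\<bar>) else 1)"
    (is "?N \<le> _ * (if ?sat then _ else _)")
proof (cases ?sat)
  case False
  have "?N \<le> (\<Sum>\<rho>\<in>configs (inner_vertices n k w) \<sigma>. \<Sum>\<pi>\<in>configs (inner_vertices n k w) \<tau>.
      boltzmann \<beta> (edges n k w) J \<rho> * boltzmann \<beta> (edges n k w) J \<pi>)"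
    by (rule sum_mono, rule sum_mono, rule mult_right_le_one_le) (simp_all add: noncon_prob_def)
  also have "\<dots> = interior_sum n \<beta> k w J \<sigma> * interior_sum n \<beta> k w J \<tau>"
    unfolding interior_sum_def by (rule sum_product[symmetric])
  finally show ?thesis unfolding if_not_P[OF False] by simp
next
  case True
  let ?y = "snd (poles w)" and ?x = "fst (poles w)"
  let ?K = "coupling_const n \<beta> k w J"
  have "?N \<le> interior_sum n \<beta> k w J (\<sigma>(?y := - \<sigma> ?y)) * interior_sum n \<beta> k w J (\<tau>(?y := - \<tau> ?y))"
    unfolding interior_sum_def
    using \<sigma> \<tau> edge_ends_in_vertices[of _ n k w]
    by (intro noncon_weight_le_reversed \<beta>) (auto simp: vertices_def)
  also have "\<dots> = (?K * exp (- (\<xi>w * \<sigma> ?x * \<sigma> ?y))) * (?K * exp (- (\<xi>w * \<tau> ?x * \<tau> ?y)))"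
    using \<sigma> \<tau> by (subst (1 2) interior_sum_eff_coupling) (auto simp: \<xi>w_def)
  also have "\<dots> = (?K * exp (\<xi>w * \<sigma> ?x * \<sigma> ?y)) * (?K * exp (\<xi>w * \<tau> ?x * \<tau> ?y)) * exp (-4 * \<bar>\<xi>w\<bar>)"
  proof -
    have "\<xi>w * \<sigma> ?x * \<sigma> ?y = \<bar>\<xi>w\<bar>" "\<xi>w * \<tau> ?x * \<tau> ?y = \<bar>\<xi>w\<bar>"
      using True \<sigma> \<tau> by auto
    then show ?thesis by (simp add: mult_exp_exp algebra_simps)
  qed
  also have "\<dots> = interior_sum n \<beta> k w J \<sigma> * interior_sum n \<beta> k w J \<tau> * exp (-4 * \<bar>\<xi>w\<bar>)"
    using \<sigma> \<tau> by (subst (1 2) interior_sum_eff_coupling) (auto simp: \<xi>w_def)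
  finally show ?thesis using True by simp
qed

lemma noncon_prob_cong:
  assumes "\<And>e. e \<in> E \<Longrightarrow> \<rho> (fst (poles e)) = \<rho>' (fst (poles e)) \<and> \<rho> (snd (poles e)) = \<rho>' (snd (poles e)) \<and>
      \<pi> (fst (poles e)) = \<pi>' (fst (poles e)) \<and> \<pi> (snd (poles e)) = \<pi>' (snd (poles e))"
    and E: "finite E"
  shows "noncon_prob \<beta> E J x y \<rho> \<pi> = noncon_prob \<beta> E J x y \<rho>' \<pi>'"
proof -
  have "blue_law \<beta> E J \<rho> \<pi> = blue_law \<beta> E J \<rho>' \<pi>'"
    unfolding blue_law_def
    using assms by (intro map_pmf_cong Pi_pmf_cong refl) (simp add: blue_prob_def)
  then show ?thesis by (simp add: noncon_prob_def)
qed

context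
  fixes n k :: nat and w :: address and i :: nat and J :: "address \<Rightarrow> real" and \<beta> :: real
    and \<sigma> \<tau> :: spins
  assumes \<beta>: "\<beta> \<ge> 0"
    and \<sigma>: "\<sigma> (fst (poles w)) \<in> {-1, 1}" "\<sigma> (snd (poles w)) \<in> {-1, 1}"
    and \<tau>: "\<tau> (fst (poles w)) \<in> {-1, 1}" "\<tau> (snd (poles w)) \<in> {-1, 1}"
begin

abbreviation (input) "Br \<equiv> branch_interior n k w i"
abbreviation (input) "BL \<equiv> boltzmann \<beta> (branch_edges n k w i) J"
abbreviation (input) "half_coupling h \<equiv> eff_coupling n \<beta> k ((i, h) # w) J"

lemma far_spins: "\<sigma> (far_pole h w) \<in> {-1, 1}" "\<tau> (far_pole h w) \<in> {-1, 1}"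
  using \<sigma> \<tau> by (auto simp: far_pole_def)

lemma half_weights:
  assumes "s \<in> {-1, 1}" "\<rho> \<in> {\<sigma>, \<tau>}"
  shows "interior_sum n \<beta> k ((i, h) # w) J (\<rho>(Mid w i := s)) *
    interior_sum n \<beta> k ((i, \<not> h) # w) J (\<rho>(Mid w i := s)) =
    coupling_const n \<beta> k ((i, h) # w) J * coupling_const n \<beta> k ((i, \<not> h) # w) J *
    exp ((half_coupling h * \<rho> (far_pole h w) + half_coupling (\<not> h) * \<rho> (far_pole (\<not> h) w)) * s)"
  using far_spins assms
  by (auto simp: interior_sum_half algebra_simps mult_exp_exp)

text \<open>Both local estimates have this form: the conditional weight of an event is bounded, for each
  pair of spins at the midpoint, by \<open>g\<close> times the total weight.\<close>

lemma branch_bound: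
  fixes f g
  assumes f: "\<And>\<rho> \<rho>' \<pi> \<pi>'. (\<And>v. v \<notin> inner_vertices n k ((i, \<not> h) # w) \<Longrightarrow> \<rho> v = \<rho>' v \<and> \<pi> v = \<pi>' v) \<Longrightarrow>
      f \<rho> \<pi> = f \<rho>' \<pi>'"
    and le: "\<And>s t. s \<in> {-1, 1} \<Longrightarrow> t \<in> {-1, 1} \<Longrightarrow>
      (\<Sum>\<rho>\<in>configs (inner_vertices n k ((i, h) # w)) (\<sigma>(Mid w i := s)).
       \<Sum>\<pi>\<in>configs (inner_vertices n k ((i, h) # w)) (\<tau>(Mid w i := t)).
         boltzmann \<beta> (edges n k ((i, h) # w)) J \<rho> * boltzmann \<beta> (edges n k ((i, h) # w)) J \<pi> * f \<rho> \<pi>) \<le>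
      interior_sum n \<beta> k ((i, h) # w) J (\<sigma>(Mid w i := s)) *
      interior_sum n \<beta> k ((i, h) # w) J (\<tau>(Mid w i := t)) * g s t"
    and bound: "(\<Sum>s\<in>{-1, 1}. \<Sum>t\<in>{-1, 1}.
        exp ((half_coupling h * \<sigma> (far_pole h w) + half_coupling (\<not> h) * \<sigma> (far_pole (\<not> h) w)) * s) *
        exp ((half_coupling h * \<tau> (far_pole h w) + half_coupling (\<not> h) * \<tau> (far_pole (\<not> h) w)) * t) * g s t) \<le>
      c * (\<Sum>s\<in>{-1, 1}. \<Sum>t\<in>{-1, 1}.
        exp ((half_coupling h * \<sigma> (far_pole h w) + half_coupling (\<not> h) * \<sigma> (far_pole (\<not> h) w)) * s) *
        exp ((half_coupling h * \<tau> (far_pole h w) + half_coupling (\<not> h) * \<tau> (far_pole (\<not> h) w)) * t))"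
      (is "?S \<le> c * ?T")
  shows "(\<Sum>\<rho>\<in>configs Br \<sigma>. \<Sum>\<pi>\<in>configs Br \<tau>. BL \<rho> * BL \<pi> * f \<rho> \<pi>) \<le>
    c * (\<Sum>\<rho>\<in>configs Br \<sigma>. \<Sum>\<pi>\<in>configs Br \<tau>. BL \<rho> * BL \<pi>)"
proof -
  let ?Z = "\<lambda>h. interior_sum n \<beta> k ((i, h) # w) J" and ?m = "Mid w i"
  define K where "K = coupling_const n \<beta> k ((i, h) # w) J * coupling_const n \<beta> k ((i, \<not> h) # w) J"
  have regroup: "?Z (\<not> h) (\<sigma>(?m := s)) * ?Z (\<not> h) (\<tau>(?m := t)) *
      (?Z h (\<sigma>(?m := s)) * ?Z h (\<tau>(?m := t)) * r) = K\<^sup>2 *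
      (exp ((half_coupling h * \<sigma> (far_pole h w) + half_coupling (\<not> h) * \<sigma> (far_pole (\<not> h) w)) * s) *
       exp ((half_coupling h * \<tau> (far_pole h w) + half_coupling (\<not> h) * \<tau> (far_pole (\<not> h) w)) * t) * r)"
    if "s \<in> {-1, 1}" "t \<in> {-1, 1}" for s t r
  proof -
    have "?Z (\<not> h) (\<sigma>(?m := s)) * ?Z (\<not> h) (\<tau>(?m := t)) * (?Z h (\<sigma>(?m := s)) * ?Z h (\<tau>(?m := t)) * r) =
      (?Z h (\<sigma>(?m := s)) * ?Z (\<not> h) (\<sigma>(?m := s))) * (?Z h (\<tau>(?m := t)) * ?Z (\<not> h) (\<tau>(?m := t))) * r"
      by (simp add: mult_ac)
    also have "\<dots> = K\<^sup>2 *
      (exp ((half_coupling h * \<sigma> (far_pole h w) + half_coupling (\<not> h) * \<sigma> (far_pole (\<not> h) w)) * s) *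
       exp ((half_coupling h * \<tau> (far_pole h w) + half_coupling (\<not> h) * \<tau> (far_pole (\<not> h) w)) * t) * r)"
      using half_weights[OF that(1), of \<sigma> h] half_weights[OF that(2), of \<tau> h]
      by (simp add: K_def power2_eq_square)
    finally show ?thesis .
  qed
  have "(\<Sum>\<rho>\<in>configs Br \<sigma>. \<Sum>\<pi>\<in>configs Br \<tau>. BL \<rho> * BL \<pi> * f \<rho> \<pi>) \<le>
    (\<Sum>s\<in>{-1, 1}. \<Sum>t\<in>{-1, 1}. ?Z (\<not> h) (\<sigma>(?m := s)) * ?Z (\<not> h) (\<tau>(?m := t)) *
      (?Z h (\<sigma>(?m := s)) * ?Z h (\<tau>(?m := t)) * g s t))"
    by (subst branch_sum2[where h = h], rule f, blast, rule sum_mono, rule sum_mono, rule mult_left_mono[OF le])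
       (auto intro!: mult_nonneg_nonneg less_imp_le[OF interior_sum_pos])
  also have "\<dots> = K\<^sup>2 * ?S"
    unfolding sum_distrib_left by (rule sum.cong[OF refl], rule sum.cong[OF refl], rule regroup)
  also have "\<dots> \<le> K\<^sup>2 * (c * ?T)" by (rule mult_left_mono[OF bound]) simp
  also have "\<dots> = c * (K\<^sup>2 * ?T)" by simp
  also have "K\<^sup>2 * ?T = (\<Sum>s\<in>{-1, 1}. \<Sum>t\<in>{-1, 1}. ?Z (\<not> h) (\<sigma>(?m := s)) * ?Z (\<not> h) (\<tau>(?m := t)) *
      (?Z h (\<sigma>(?m := s)) * ?Z h (\<tau>(?m := t)) * 1))"
    unfolding sum_distrib_left
    by (rule sum.cong[OF refl], rule sum.cong[OF refl], subst regroup) simp_all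
  also have "\<dots> = (\<Sum>\<rho>\<in>configs Br \<sigma>. \<Sum>\<pi>\<in>configs Br \<tau>. BL \<rho> * BL \<pi> * 1)"
    by (subst branch_sum2[of n k i h w "\<lambda>_ _. 1"]) (simp_all add: interior_sum_def sum_product)
  finally show ?thesis by simp
qed

lemma mismatch_local:
  "(\<Sum>\<rho>\<in>configs Br \<sigma>. \<Sum>\<pi>\<in>configs Br \<tau>. BL \<rho> * BL \<pi> *
      of_bool (\<rho> (Mid w i) * \<pi> (Mid w i) \<noteq> \<rho> (fst (poles w)) * \<pi> (fst (poles w)) \<and>
        \<rho> (fst (poles w)) * \<pi> (fst (poles w)) = \<rho> (snd (poles w)) * \<pi> (snd (poles w)))) \<le>
    (sech (\<bar>\<bar>half_coupling False\<bar> - \<bar>half_coupling True\<bar>\<bar>))\<^sup>2 / 2 *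
    (\<Sum>\<rho>\<in>configs Br \<sigma>. \<Sum>\<pi>\<in>configs Br \<tau>. BL \<rho> * BL \<pi>)"
proof (rule branch_bound[where h = False and g = "\<lambda>s t. of_bool (s * t \<noteq> \<sigma> (fst (poles w)) * \<tau> (fst (poles w)) \<and>
        \<sigma> (fst (poles w)) * \<tau> (fst (poles w)) = \<sigma> (snd (poles w)) * \<tau> (snd (poles w)))"], goal_cases)
  case (1 \<rho> \<rho>' \<pi> \<pi>')
  have "Mid w i \<notin> inner_vertices n k ((i, True) # w)" "fst (poles w) \<notin> inner_vertices n k ((i, True) # w)"
    "snd (poles w) \<notin> inner_vertices n k ((i, True) # w)"
    using poles_not_branch_interior[of w n k i] halves_disjoint(3)[of w i n k True]
    by (auto simp: branch_interior_def)
  then show ?case using 1 by simp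
next
  case (2 s t)
  have "Mid w i \<notin> inner_vertices n k ((i, False) # w)" "fst (poles w) \<notin> inner_vertices n k ((i, False) # w)"
    "snd (poles w) \<notin> inner_vertices n k ((i, False) # w)"
    using poles_not_branch_interior[of w n k i] halves_disjoint(3)[of w i n k False]
    by (auto simp: branch_interior_def)
  then have "(\<Sum>\<rho>\<in>configs (inner_vertices n k ((i, False) # w)) (\<sigma>(Mid w i := s)).
      \<Sum>\<pi>\<in>configs (inner_vertices n k ((i, False) # w)) (\<tau>(Mid w i := t)).
        boltzmann \<beta> (edges n k ((i, False) # w)) J \<rho> * boltzmann \<beta> (edges n k ((i, False) # w)) J \<pi> *
        of_bool (\<rho> (Mid w i) * \<pi> (Mid w i) \<noteq> \<rho> (fst (poles w)) * \<pi> (fst (poles w)) \<and>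
          \<rho> (fst (poles w)) * \<pi> (fst (poles w)) = \<rho> (snd (poles w)) * \<pi> (snd (poles w)))) =
      (\<Sum>\<rho>\<in>configs (inner_vertices n k ((i, False) # w)) (\<sigma>(Mid w i := s)).
      \<Sum>\<pi>\<in>configs (inner_vertices n k ((i, False) # w)) (\<tau>(Mid w i := t)).
        boltzmann \<beta> (edges n k ((i, False) # w)) J \<rho> * boltzmann \<beta> (edges n k ((i, False) # w)) J \<pi> *
        of_bool (s * t \<noteq> \<sigma> (fst (poles w)) * \<tau> (fst (poles w)) \<and>
        \<sigma> (fst (poles w)) * \<tau> (fst (poles w)) = \<sigma> (snd (poles w)) * \<tau> (snd (poles w))))"
    by (intro sum.cong refl) (simp add: configs_off)
  moreover have "interior_sum n \<beta> k ((i, False) # w) J (\<sigma>(Mid w i := s)) *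
      interior_sum n \<beta> k ((i, False) # w) J (\<tau>(Mid w i := t)) =
      (\<Sum>\<rho>\<in>configs (inner_vertices n k ((i, False) # w)) (\<sigma>(Mid w i := s)).
      \<Sum>\<pi>\<in>configs (inner_vertices n k ((i, False) # w)) (\<tau>(Mid w i := t)).
        boltzmann \<beta> (edges n k ((i, False) # w)) J \<rho> * boltzmann \<beta> (edges n k ((i, False) # w)) J \<pi>)"
    unfolding interior_sum_def by (rule sum_product)
  ultimately show ?case
    by (simp only: sum_distrib_right order_refl)
next
  case 3
  then show ?case
    using mismatch_two_spins[of "\<sigma> (fst (poles w))" "\<sigma> (snd (poles w))" "\<tau> (fst (poles w))" "\<tau> (snd (poles w))"] \<sigma> \<tau>
    by (simp add: far_pole_def)
qed

text \<open>The half \<open>h\<close> is the stronger one, and only its bonds are used.\<close>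

lemma disconnection_local:
  assumes "\<bar>half_coupling (\<not> h)\<bar> \<le> \<bar>half_coupling h\<bar>"
  shows "(\<Sum>\<rho>\<in>configs Br \<sigma>. \<Sum>\<pi>\<in>configs Br \<tau>. BL \<rho> * BL \<pi> *
      noncon_prob \<beta> (edges n k ((i, h) # w)) J (fst (poles ((i, h) # w))) (snd (poles ((i, h) # w))) \<rho> \<pi>) \<le>
    (\<psi> (\<bar>\<bar>half_coupling h\<bar> - \<bar>half_coupling (\<not> h)\<bar>\<bar>) + exp (-4 * \<bar>half_coupling h\<bar>)) *
    (\<Sum>\<rho>\<in>configs Br \<sigma>. \<Sum>\<pi>\<in>configs Br \<tau>. BL \<rho> * BL \<pi>)"
proof (rule branch_bound[where h = h and g = "\<lambda>s t.
    if half_coupling h * \<sigma> (far_pole h w) * s \<ge> 0 \<and> half_coupling h * \<tau> (far_pole h w) * t \<ge> 0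
    then exp (-4 * \<bar>half_coupling h\<bar>) else 1"], goal_cases)
  case (1 \<rho> \<rho>' \<pi> \<pi>')
  have "v \<notin> inner_vertices n k ((i, \<not> h) # w)" if "v \<in> vertices n k ((i, h) # w)" for v
    using that halves_disjoint(1,2)[of n k i w] halves_disjoint(3)[of w i n k] poles_not_branch_interior[of w n k i]
    by (cases h) (auto simp: vertices_def branch_interior_def)
  then show ?case
    using 1 edge_ends_in_vertices[of _ n k "(i, h) # w"] by (intro noncon_prob_cong) auto
next
  case (2 s t)
  have "fst (poles ((i, h) # w)) = (if h then Mid w i else far_pole h w)"
    "snd (poles ((i, h) # w)) = (if h then far_pole h w else Mid w i)" "far_pole h w \<noteq> Mid w i"
    by (auto simp: far_pole_def)
  then show ?case
    using effective_bond[OF \<beta>, of "\<sigma>(Mid w i := s)" "(i, h) # w" "\<tau>(Mid w i := t)" n k J] far_spins[of h] 2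
    by (cases h) (simp_all add: mult_ac del: if_split)
next
  case 3
  show ?case
    by (rule follow_stronger_coupling) (use far_spins assms in auto)
qed

end

section \<open>Gibbs measures with free or fixed poles\<close>

abbreviation (input) "start \<equiv> (\<lambda>_. undefined) :: spins"

definition partition_sum :: "nat \<Rightarrow> real \<Rightarrow> nat \<Rightarrow> (address \<Rightarrow> real) \<Rightarrow> real" where
  "partition_sum n \<beta> N J = (\<Sum>\<sigma>\<in>configs (vertices n N []) start. boltzmann \<beta> (edges n N []) J \<sigma>)"

lemma partition_sum_pos: "partition_sum n \<beta> N J > 0"
  unfolding partition_sum_def by (intro sum_pos) auto

lemma pmf_gibbs_free:
  "pmf (gibbs_free n \<beta> N J) \<sigma> = (if \<sigma> \<in> configs (vertices n N []) start
     then boltzmann \<beta> (edges n N []) J \<sigma> / partition_sum n \<beta> N J else 0)"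
  unfolding gibbs_free_def spin_configs_eq partition_sum_def[symmetric]
proof (rule pmf_embed_pmf)
  let ?f = "\<lambda>\<sigma>. if \<sigma> \<in> configs (vertices n N []) start
     then boltzmann \<beta> (edges n N []) J \<sigma> / partition_sum n \<beta> N J else 0"
  show nn: "0 \<le> ?f \<sigma>" for \<sigma> using partition_sum_pos[of n \<beta> N J] by simp
  have "(\<integral>\<^sup>+ \<sigma>. ennreal (?f \<sigma>) \<partial>count_space UNIV) =
      (\<Sum>\<sigma>\<in>configs (vertices n N []) start. ennreal (?f \<sigma>))"
    by (rule nn_integral_count_space') auto
  also have "\<dots> = ennreal (\<Sum>\<sigma>\<in>configs (vertices n N []) start. ?f \<sigma>)"
    using nn by (intro sum_ennreal) blast
  also have "(\<Sum>\<sigma>\<in>configs (vertices n N []) start. ?f \<sigma>) = 1"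
    using partition_sum_pos[of n \<beta> N J]
    by (simp add: sum_divide_distrib[symmetric] partition_sum_def[symmetric])
  finally show "(\<integral>\<^sup>+ \<sigma>. ennreal (?f \<sigma>) \<partial>count_space UNIV) = 1" by simp
qed

text \<open>Gibbs measures reweighted by a function of the pole spins; the free and the fixed-pole
  measures are of this form, and conditioning on all spins outside a branch does not see the
  reweighting.\<close>

definition pole_gibbs :: "nat \<Rightarrow> real \<Rightarrow> nat \<Rightarrow> (address \<Rightarrow> real) \<Rightarrow> spins pmf \<Rightarrow> bool" where
  "pole_gibbs n \<beta> N J p \<longleftrightarrow> (\<exists>g. (\<forall>\<sigma>. g \<sigma> \<ge> 0) \<and>
     (\<forall>\<sigma> \<sigma>'. \<sigma> PoleA = \<sigma>' PoleA \<longrightarrow> \<sigma> PoleB = \<sigma>' PoleB \<longrightarrow> g \<sigma> = g \<sigma>') \<and>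
     (\<forall>\<sigma>. pmf p \<sigma> = (if \<sigma> \<in> configs (vertices n N []) start
        then g \<sigma> * boltzmann \<beta> (edges n N []) J \<sigma> else 0)))"

lemma pole_gibbs_free: "pole_gibbs n \<beta> N J (gibbs_free n \<beta> N J)"
  unfolding pole_gibbs_def
  by (rule exI[of _ "\<lambda>_. 1 / partition_sum n \<beta> N J"])
     (simp add: pmf_gibbs_free less_imp_le[OF partition_sum_pos])

lemma set_pole_gibbs: "pole_gibbs n \<beta> N J p \<Longrightarrow> set_pmf p \<subseteq> configs (vertices n N []) start"
  unfolding pole_gibbs_def by (metis set_pmf_iff subsetI)

lemma pole_gibbs_spins:
  assumes "pole_gibbs n \<beta> N J p" "\<sigma> \<in> set_pmf p" "v \<in> vertices n N []"
  shows "\<sigma> v \<in> {-1, 1}"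
  using configs_on set_pole_gibbs assms by blast

lemma poles_in_vertices [simp]: "PoleA \<in> vertices n N []" "PoleB \<in> vertices n N []"
  by (simp_all add: vertices_def)

lemma gibbs_free_meets_poles:
  assumes "s \<in> {-1, 1}" "s' \<in> {-1, 1}"
  shows "set_pmf (gibbs_free n \<beta> N J) \<inter> {\<sigma>. \<sigma> PoleA = s \<and> \<sigma> PoleB = s'} \<noteq> {}"
proof -
  let ?\<sigma> = "\<lambda>v. if v = PoleA then s else if v = PoleB then s' else if v \<in> vertices n N [] then 1 else undefined"
  have "?\<sigma> \<in> configs (vertices n N []) start"
    using assms by (auto simp: configs_def)
  then have "pmf (gibbs_free n \<beta> N J) ?\<sigma> \<noteq> 0"
    using partition_sum_pos[of n \<beta> N J] by (simp add: pmf_gibbs_free less_imp_neq[symmetric])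
  then have "?\<sigma> \<in> set_pmf (gibbs_free n \<beta> N J) \<inter> {\<sigma>. \<sigma> PoleA = s \<and> \<sigma> PoleB = s'}"
    by (auto simp: set_pmf_iff)
  then show ?thesis by blast
qed

lemma pmf_gibbs_fixed:
  assumes "s \<in> {-1, 1}" "s' \<in> {-1, 1}"
  shows "pmf (gibbs_fixed n \<beta> N J s s') \<sigma> = (if \<sigma> PoleA = s \<and> \<sigma> PoleB = s' then
    pmf (gibbs_free n \<beta> N J) \<sigma> / measure (gibbs_free n \<beta> N J) {\<sigma>. \<sigma> PoleA = s \<and> \<sigma> PoleB = s'} else 0)"
  unfolding gibbs_fixed_def using gibbs_free_meets_poles[OF assms] by (subst pmf_cond) auto

lemma pole_gibbs_fixed:
  assumes "s \<in> {-1, 1}" "s' \<in> {-1, 1}"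
  shows "pole_gibbs n \<beta> N J (gibbs_fixed n \<beta> N J s s')"
  unfolding pole_gibbs_def
  by (rule exI[of _ "\<lambda>\<sigma>. if \<sigma> PoleA = s \<and> \<sigma> PoleB = s' then 1 / partition_sum n \<beta> N J /
       measure (gibbs_free n \<beta> N J) {\<sigma>. \<sigma> PoleA = s \<and> \<sigma> PoleB = s'} else 0"])
     (auto simp: pmf_gibbs_fixed[OF assms] pmf_gibbs_free less_imp_le[OF partition_sum_pos])

lemma expectation_pair_finite:
  fixes f :: "'a \<times> 'b \<Rightarrow> real"
  assumes "finite A" "finite B" "set_pmf p \<subseteq> A" "set_pmf q \<subseteq> B"
  shows "measure_pmf.expectation (pair_pmf p q) f = (\<Sum>x\<in>A. \<Sum>y\<in>B. pmf p x * pmf q y * f (x, y))"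
proof -
  have "measure_pmf.expectation (pair_pmf p q) f = (\<Sum>z\<in>A \<times> B. pmf (pair_pmf p q) z *\<^sub>R f z)"
    by (rule integral_measure_pmf) (use assms in auto)
  also have "\<dots> = (\<Sum>x\<in>A. \<Sum>y\<in>B. pmf p x * pmf q y * f (x, y))"
    unfolding sum.cartesian_product by (rule sum.cong) (auto simp: pmf_pair)
  finally show ?thesis .
qed

lemma prob_cong_support:
  assumes "\<And>z. z \<in> set_pmf p \<Longrightarrow> z \<in> A \<longleftrightarrow> z \<in> B"
  shows "measure_pmf.prob p A = measure_pmf.prob p B"
  using assms by (intro measure_pmf.finite_measure_eq_AE) (auto simp: AE_measure_pmf_iff)

lemma pole_gibbs_branch_bound:
  assumes p: "pole_gibbs n \<beta> N J p" and w: "addr n w" "length w + Suc k = N" "i < n"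
    and local: "\<And>\<sigma> \<tau>. \<sigma> (fst (poles w)) \<in> {-1, 1} \<Longrightarrow> \<sigma> (snd (poles w)) \<in> {-1, 1} \<Longrightarrow>
       \<tau> (fst (poles w)) \<in> {-1, 1} \<Longrightarrow> \<tau> (snd (poles w)) \<in> {-1, 1} \<Longrightarrow>
      (\<Sum>\<rho>\<in>configs (branch_interior n k w i) \<sigma>. \<Sum>\<pi>\<in>configs (branch_interior n k w i) \<tau>.
        boltzmann \<beta> (branch_edges n k w i) J \<rho> * boltzmann \<beta> (branch_edges n k w i) J \<pi> * f \<rho> \<pi>) \<le>
      c * (\<Sum>\<rho>\<in>configs (branch_interior n k w i) \<sigma>. \<Sum>\<pi>\<in>configs (branch_interior n k w i) \<tau>.
        boltzmann \<beta> (branch_edges n k w i) J \<rho> * boltzmann \<beta> (branch_edges n k w i) J \<pi>)"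
  shows "measure_pmf.expectation (pair_pmf p p) (\<lambda>(\<sigma>, \<tau>). f \<sigma> \<tau>) \<le> c"
proof -
  let ?V = "vertices n N []" and ?B = "boltzmann \<beta> (edges n N []) J" and ?K = "branch_interior n k w i"
  obtain g where g: "\<And>\<sigma>. g \<sigma> \<ge> 0" "\<And>\<sigma> \<sigma>'. \<sigma> PoleA = \<sigma>' PoleA \<Longrightarrow> \<sigma> PoleB = \<sigma>' PoleB \<Longrightarrow> g \<sigma> = g \<sigma>'"
    "\<And>\<sigma>. pmf p \<sigma> = (if \<sigma> \<in> configs ?V start then g \<sigma> * ?B \<sigma> else 0)"
    using p unfolding pole_gibbs_def by blast
  have E: "measure_pmf.expectation (pair_pmf p p) (\<lambda>(\<sigma>, \<tau>). h \<sigma> \<tau>) =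
    (\<Sum>\<sigma>\<in>configs ?V start. \<Sum>\<tau>\<in>configs ?V start. (g \<sigma> * g \<tau>) * ?B \<sigma> * ?B \<tau> * h \<sigma> \<tau>)" for h
    by (subst expectation_pair_finite[of "configs ?V start" "configs ?V start"])
       (use set_pole_gibbs[OF p] in \<open>auto simp: g(3) intro!: sum.cong\<close>)
  have "measure_pmf.expectation (pair_pmf p p) (\<lambda>(\<sigma>, \<tau>). f \<sigma> \<tau>) \<le>
    c * (\<Sum>\<sigma>\<in>configs ?V start. \<Sum>\<tau>\<in>configs ?V start. (g \<sigma> * g \<tau>) * ?B \<sigma> * ?B \<tau>)"
    unfolding E
  proof (rule integrate_local_bound[where K = ?K and L = "branch_edges n k w i"])
    have K: "?K \<subseteq> inner_vertices n N []" using branch_in_diamond[of i n w k N] w by auto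
    then show "?K \<subseteq> ?V" by (auto simp: vertices_def)
    show "branch_edges n k w i \<subseteq> edges n N []" using branch_in_diamond[of i n w k N] w by auto
    have pK: "PoleA \<notin> ?K" "PoleB \<notin> ?K" using K by (auto simp: inner_vertices_eq)
    show "fst (poles e) \<notin> ?K \<and> snd (poles e) \<notin> ?K" if "e \<in> edges n N [] - branch_edges n k w i" for e
      using edge_off_branch[OF that w(2)] by blast
    show "g \<sigma> * g \<tau> = g \<sigma>' * g \<tau>'" if "\<And>v. v \<notin> ?K \<Longrightarrow> \<sigma> v = \<sigma>' v \<and> \<tau> v = \<tau>' v" for \<sigma> \<sigma>' \<tau> \<tau>'
      using g(2)[of \<sigma> \<sigma>'] g(2)[of \<tau> \<tau>'] that pK by auto
    show "(\<Sum>\<rho>\<in>configs ?K \<sigma>. \<Sum>\<pi>\<in>configs ?K \<tau>.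
        boltzmann \<beta> (branch_edges n k w i) J \<rho> * boltzmann \<beta> (branch_edges n k w i) J \<pi> * f \<rho> \<pi>) \<le>
      c * (\<Sum>\<rho>\<in>configs ?K \<sigma>. \<Sum>\<pi>\<in>configs ?K \<tau>.
        boltzmann \<beta> (branch_edges n k w i) J \<rho> * boltzmann \<beta> (branch_edges n k w i) J \<pi>)"
      if "\<forall>v\<in>?V - ?K. \<sigma> v \<in> {-1, 1} \<and> \<tau> v \<in> {-1, 1}" for \<sigma> \<tau>
    proof (rule local)
      have "fst (poles w) \<in> ?V - ?K" "snd (poles w) \<in> ?V - ?K"
        using poles_in_diamond[of n w N] w by auto
      then show "\<sigma> (fst (poles w)) \<in> {-1, 1}" "\<sigma> (snd (poles w)) \<in> {-1, 1}"
        "\<tau> (fst (poles w)) \<in> {-1, 1}" "\<tau> (snd (poles w)) \<in> {-1, 1}" using that by blast+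
    qed
  qed (auto simp: g(1))
  also have "(\<Sum>\<sigma>\<in>configs ?V start. \<Sum>\<tau>\<in>configs ?V start. (g \<sigma> * g \<tau>) * ?B \<sigma> * ?B \<tau>) = 1"
    using E[of "\<lambda>_ _. 1"] by (simp add: case_prod_unfold)
  finally show ?thesis by simp
qed

section \<open>Overlaps along the chain of sub-diamonds containing a vertex\<close>

definition half_gap :: "nat \<Rightarrow> real \<Rightarrow> nat \<Rightarrow> (address \<Rightarrow> real) \<Rightarrow> address \<Rightarrow> nat \<Rightarrow> real" where
  "half_gap n \<beta> N J w i =
     \<bar>\<bar>eff_coupling n \<beta> (N - Suc (length w)) ((i, False) # w) J\<bar> -
      \<bar>eff_coupling n \<beta> (N - Suc (length w)) ((i, True) # w) J\<bar>\<bar>"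

definition half_max :: "nat \<Rightarrow> real \<Rightarrow> nat \<Rightarrow> (address \<Rightarrow> real) \<Rightarrow> address \<Rightarrow> nat \<Rightarrow> real" where
  "half_max n \<beta> N J w i =
     max \<bar>eff_coupling n \<beta> (N - Suc (length w)) ((i, False) # w) J\<bar>
         \<bar>eff_coupling n \<beta> (N - Suc (length w)) ((i, True) # w) J\<bar>"

text \<open>The cost of a union bound over the nested sub-diamonds between the whole diamond and \<open>w\<close>, when
  branch \<open>i\<close> of the sub-diamond \<open>v\<close> fails with probability at most \<open>r v i\<close>.\<close>

fun chain_cost :: "(address \<Rightarrow> nat \<Rightarrow> real) \<Rightarrow> address \<Rightarrow> real" where
  "chain_cost r [] = 0"
| "chain_cost r ((i, h) # w) = chain_cost r w + r w i"

abbreviation (input) overlap_at :: "spins \<times> spins \<Rightarrow> vertex \<Rightarrow> real" where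
  "overlap_at z v \<equiv> fst z v * snd z v"

lemma overlap_mismatch_prob:
  assumes p: "pole_gibbs n \<beta> N J p" and \<beta>: "\<beta> \<ge> 0" and w: "addr n w" "length w < N" "i < n"
  shows "measure_pmf.prob (pair_pmf p p) {z. overlap_at z (Mid w i) \<noteq> overlap_at z (fst (poles w)) \<and>
      overlap_at z (fst (poles w)) = overlap_at z (snd (poles w))} \<le> (sech (half_gap n \<beta> N J w i))\<^sup>2 / 2"
    (is "measure_pmf.prob _ ?S \<le> _")
proof -
  have N: "length w + Suc (N - Suc (length w)) = N" using w by simp
  have "measure_pmf.prob (pair_pmf p p) ?S = measure_pmf.expectation (pair_pmf p p) (indicator ?S)"
    by simp
  also have "indicator ?S = (\<lambda>(\<rho>, \<pi>). of_bool (\<rho> (Mid w i) * \<pi> (Mid w i) \<noteq> \<rho> (fst (poles w)) * \<pi> (fst (poles w)) \<and>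
        \<rho> (fst (poles w)) * \<pi> (fst (poles w)) = \<rho> (snd (poles w)) * \<pi> (snd (poles w))) :: real)"
    by (auto simp: indicator_def fun_eq_iff)
  also have "measure_pmf.expectation (pair_pmf p p) \<dots> \<le> (sech (half_gap n \<beta> N J w i))\<^sup>2 / 2"
    unfolding half_gap_def
    by (rule pole_gibbs_branch_bound[OF p w(1) N w(3)], rule mismatch_local[OF \<beta>])
  finally show ?thesis .
qed

text \<open>Descending to \<open>w\<close>, the first midpoint whose overlap differs from that at \<open>A\<close> belongs to a
  sub-diamond with equal overlaps at its poles.\<close>

lemma overlap_chain:
  assumes p: "pole_gibbs n \<beta> N J p" and \<beta>: "\<beta> \<ge> 0" and w: "addr n w" "length w \<le> N"
  shows "measure_pmf.prob (pair_pmf p p) {z. \<not> (overlap_at z (fst (poles w)) = overlap_at z PoleA \<and>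
      overlap_at z (snd (poles w)) = overlap_at z PoleA)} \<le>
    measure_pmf.prob (pair_pmf p p) {z. overlap_at z PoleB \<noteq> overlap_at z PoleA} +
    chain_cost (\<lambda>v i. (sech (half_gap n \<beta> N J v i))\<^sup>2 / 2) w"
  using w
proof (induction w)
  case (Cons x w)
  obtain i h where x: "x = (i, h)" by (cases x)
  let ?bad = "\<lambda>w. {z. \<not> (overlap_at z (fst (poles w)) = overlap_at z PoleA \<and>
      overlap_at z (snd (poles w)) = overlap_at z PoleA)}"
  let ?M = "{z. overlap_at z (Mid w i) \<noteq> overlap_at z (fst (poles w)) \<and>
      overlap_at z (fst (poles w)) = overlap_at z (snd (poles w))}"
  have "measure_pmf.prob (pair_pmf p p) (?bad (x # w)) \<le> measure_pmf.prob (pair_pmf p p) (?bad w \<union> ?M)"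
    by (intro measure_pmf.finite_measure_mono) (auto simp: x)
  also have "\<dots> \<le> measure_pmf.prob (pair_pmf p p) (?bad w) + measure_pmf.prob (pair_pmf p p) ?M"
    by (rule measure_Un_le) auto
  finally show ?case
    using Cons overlap_mismatch_prob[OF p \<beta>, of w i] x by auto
qed simp

text \<open>Two replicas linearise the square of a mean.\<close>

lemma expectation_spin_squared:
  assumes fin: "finite (set_pmf p)" and f: "\<And>\<sigma>. \<sigma> \<in> set_pmf p \<Longrightarrow> f \<sigma> \<in> {-1, 1 :: real}"
  shows "(measure_pmf.expectation p f)\<^sup>2 = measure_pmf.expectation (pair_pmf p p) (\<lambda>(\<sigma>, \<tau>). f \<sigma> * f \<tau>)"
    and "(measure_pmf.expectation p f)\<^sup>2 =
      1 - 2 * measure_pmf.prob (pair_pmf p p) {(\<sigma>, \<tau>). f \<sigma> \<noteq> f \<tau>}"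
proof -
  have "(measure_pmf.expectation p f)\<^sup>2 = (\<Sum>\<sigma>\<in>set_pmf p. pmf p \<sigma> * f \<sigma>)\<^sup>2"
    by (subst integral_measure_pmf[OF fin]) auto
  then show 1: "(measure_pmf.expectation p f)\<^sup>2 = measure_pmf.expectation (pair_pmf p p) (\<lambda>(\<sigma>, \<tau>). f \<sigma> * f \<tau>)"
    using fin by (simp add: expectation_pair_finite[of "set_pmf p" "set_pmf p"] power2_eq_square sum_product mult_ac)
  also have "\<dots> = measure_pmf.expectation (pair_pmf p p) (\<lambda>z. 1 - 2 * indicator {(\<sigma>, \<tau>). f \<sigma> \<noteq> f \<tau>} z)"
  proof (intro integral_cong_AE)
    have "f \<sigma> * f \<tau> = 1 - 2 * indicator {(\<sigma>, \<tau>). f \<sigma> \<noteq> f \<tau>} (\<sigma>, \<tau>)"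
      if "\<sigma> \<in> set_pmf p" "\<tau> \<in> set_pmf p" for \<sigma> \<tau>
      using f[OF that(1)] f[OF that(2)] by auto
    then show "AE z in measure_pmf (pair_pmf p p). (case z of (\<sigma>, \<tau>) \<Rightarrow> f \<sigma> * f \<tau>) =
        1 - 2 * indicator {(\<sigma>, \<tau>). f \<sigma> \<noteq> f \<tau>} z"
      by (auto simp: AE_measure_pmf_iff)
  qed auto
  also have "\<dots> = 1 - 2 * measure_pmf.prob (pair_pmf p p) {(\<sigma>, \<tau>). f \<sigma> \<noteq> f \<tau>}"
    using fin by (subst Bochner_Integration.integral_diff) (auto intro: integrable_measure_pmf_finite)
  finally show "(measure_pmf.expectation p f)\<^sup>2 =
      1 - 2 * measure_pmf.prob (pair_pmf p p) {(\<sigma>, \<tau>). f \<sigma> \<noteq> f \<tau>}" .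
qed

lemma finite_set_pole_gibbs: "pole_gibbs n \<beta> N J p \<Longrightarrow> finite (set_pmf p)"
  using finite_subset[OF set_pole_gibbs] by auto

lemma midpoint_overlap_le:
  assumes p: "pole_gibbs n \<beta> N J p" and \<beta>: "\<beta> \<ge> 0" and w: "addr n w" "length w < N" "i < n"
  shows "measure_pmf.prob (pair_pmf p p) {z. overlap_at z (Mid w i) \<noteq> overlap_at z PoleA} \<le>
    measure_pmf.prob (pair_pmf p p) {z. overlap_at z PoleB \<noteq> overlap_at z PoleA} +
    chain_cost (\<lambda>v i. (sech (half_gap n \<beta> N J v i))\<^sup>2 / 2) ((i, False) # w)"
  by (rule order_trans[OF _ overlap_chain[OF p \<beta>]])
     (use w in \<open>auto intro!: measure_pmf.finite_measure_mono\<close>)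

text \<open>With fixed poles the replicas agree at both poles, so only the chain contributes.\<close>

lemma fixed_magnetisation_ge:
  assumes s: "s \<in> {-1, 1}" "s' \<in> {-1, 1}" and \<beta>: "\<beta> \<ge> 0" and w: "addr n w" "length w < N" "i < n"
  shows "1 - chain_cost (\<lambda>v i. (sech (half_gap n \<beta> N J v i))\<^sup>2) ((i, False) # w) \<le>
    (measure_pmf.expectation (gibbs_fixed n \<beta> N J s s') (\<lambda>\<sigma>. \<sigma> (Mid w i)))\<^sup>2"
proof -
  let ?p = "gibbs_fixed n \<beta> N J s s'"
  have p: "pole_gibbs n \<beta> N J ?p" by (rule pole_gibbs_fixed[OF s])
  have V: "Mid w i \<in> vertices n N []" using w by (auto simp: vertices_def inner_vertices_eq)
  have poles: "\<sigma> PoleA = s \<and> \<sigma> PoleB = s'" if "\<sigma> \<in> set_pmf ?p" for \<sigma>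
    using that pmf_gibbs_fixed[OF s, of n \<beta> N J \<sigma>] by (auto simp: set_pmf_iff split: if_splits)
  have half: "chain_cost (\<lambda>v i. r v i / 2) u = chain_cost r u / 2" for r u
    by (induction r u rule: chain_cost.induct) (auto simp: field_simps)
  have 0: "measure_pmf.prob (pair_pmf ?p ?p) {z. overlap_at z PoleB \<noteq> overlap_at z PoleA} = 0"
  proof -
    have "s * s = 1" "s' * s' = 1" using s by auto
    then show ?thesis by (auto simp: measure_pmf_zero_iff dest!: poles)
  qed
  have "measure_pmf.prob (pair_pmf ?p ?p) {(\<sigma>, \<tau>). \<sigma> (Mid w i) \<noteq> \<tau> (Mid w i)} =
      measure_pmf.prob (pair_pmf ?p ?p) {z. overlap_at z (Mid w i) \<noteq> overlap_at z PoleA}"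
  proof (rule prob_cong_support)
    fix z assume "z \<in> set_pmf (pair_pmf ?p ?p)"
    then have "fst z \<in> set_pmf ?p" "snd z \<in> set_pmf ?p" by auto
    then show "z \<in> {(\<sigma>, \<tau>). \<sigma> (Mid w i) \<noteq> \<tau> (Mid w i)} \<longleftrightarrow>
        z \<in> {z. overlap_at z (Mid w i) \<noteq> overlap_at z PoleA}"
      using poles[of "fst z"] poles[of "snd z"] s pole_gibbs_spins[OF p _ V, of "fst z"]
          pole_gibbs_spins[OF p _ V, of "snd z"] by (auto simp: case_prod_unfold)
  qed
  then show ?thesis
    using midpoint_overlap_le[OF p \<beta> w] pole_gibbs_spins[OF p _ V]
    by (subst expectation_spin_squared(2)[OF finite_set_pole_gibbs[OF p]])
       (auto simp: 0 half simp del: chain_cost.simps)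
qed

text \<open>With free poles the correlation of the poles accounts for different overlaps at \<open>A\<close> and \<open>B\<close>.\<close>

lemma free_correlation_ge:
  fixes J :: "address \<Rightarrow> real"
  assumes \<beta>: "\<beta> \<ge> 0" and w: "addr n w" "length w < N" "i < n"
  defines "p \<equiv> gibbs_free n \<beta> N J"
  shows "(measure_pmf.expectation p (\<lambda>\<sigma>. \<sigma> PoleA * \<sigma> PoleB))\<^sup>2 -
      chain_cost (\<lambda>v i. (sech (half_gap n \<beta> N J v i))\<^sup>2) ((i, False) # w) \<le>
    (measure_pmf.expectation p (\<lambda>\<sigma>. \<sigma> PoleA * \<sigma> (Mid w i)))\<^sup>2"
proof -
  have p: "pole_gibbs n \<beta> N J p" unfolding p_def by (rule pole_gibbs_free)
  have half: "chain_cost (\<lambda>v i. r v i / 2) u = chain_cost r u / 2" for r u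
    by (induction r u rule: chain_cost.induct) (auto simp: field_simps)
  have V: "Mid w i \<in> vertices n N []" using w by (auto simp: vertices_def inner_vertices_eq)
  have sq: "(measure_pmf.expectation p (\<lambda>\<sigma>. \<sigma> PoleA * \<sigma> v))\<^sup>2 =
      1 - 2 * measure_pmf.prob (pair_pmf p p) {z. overlap_at z v \<noteq> overlap_at z PoleA}"
    if v: "v \<in> vertices n N []" for v
  proof -
    have pm: "\<sigma> PoleA \<in> {-1, 1}" "\<sigma> v \<in> {-1, 1}" if "\<sigma> \<in> set_pmf p" for \<sigma>
      using pole_gibbs_spins[OF p that] v by auto
    have "measure_pmf.prob (pair_pmf p p) {(\<sigma>, \<tau>). \<sigma> PoleA * \<sigma> v \<noteq> \<tau> PoleA * \<tau> v} =
      measure_pmf.prob (pair_pmf p p) {z. overlap_at z v \<noteq> overlap_at z PoleA}"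
    proof (rule prob_cong_support)
      fix z assume "z \<in> set_pmf (pair_pmf p p)"
      then have "fst z \<in> set_pmf p" "snd z \<in> set_pmf p" by auto
      then show "z \<in> {(\<sigma>, \<tau>). \<sigma> PoleA * \<sigma> v \<noteq> \<tau> PoleA * \<tau> v} \<longleftrightarrow>
          z \<in> {z. overlap_at z v \<noteq> overlap_at z PoleA}"
        using pm[of "fst z"] pm[of "snd z"] by (auto simp: case_prod_unfold)
    qed
    then show ?thesis
      using pm by (subst expectation_spin_squared(2)[OF finite_set_pole_gibbs[OF p]]) fastforce+
  qed
  show ?thesis
    using midpoint_overlap_le[OF p \<beta> w]
    by (simp add: sq V half del: chain_cost.simps)
qed

section \<open>Free poles: the pole correlation and the blue bonds\<close>

lemma sum_diamond_configs:
  "(\<Sum>\<sigma>\<in>configs (vertices n N []) rest. f \<sigma>) =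
    (\<Sum>a\<in>{-1, 1}. \<Sum>b\<in>{-1, 1}. \<Sum>\<rho>\<in>configs (inner_vertices n N []) (rest(PoleA := a, PoleB := b)). f \<rho> :: real)"
proof -
  let ?I = "inner_vertices n N []"
  have V: "vertices n N [] = {PoleA} \<union> ({PoleB} \<union> ?I)"
    by (auto simp: vertices_def)
  have I: "PoleA \<notin> ?I" "PoleB \<notin> ?I"
    by (auto simp: inner_vertices_eq)
  have A: "(\<Sum>\<sigma>\<in>configs ({PoleA} \<union> ({PoleB} \<union> ?I)) rest. f \<sigma>) =
      (\<Sum>\<sigma>\<in>configs {PoleA} rest. \<Sum>\<rho>\<in>configs ({PoleB} \<union> ?I) \<sigma>. f \<rho>)"
    by (rule sum_configs_Un) (use I in auto)
  have B: "(\<Sum>\<rho>\<in>configs ({PoleB} \<union> ?I) \<sigma>. f \<rho>) =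
      (\<Sum>\<pi>\<in>configs {PoleB} \<sigma>. \<Sum>\<rho>\<in>configs ?I \<pi>. f \<rho>)" for \<sigma>
    by (rule sum_configs_Un) (use I in auto)
  show ?thesis unfolding V A B sum_configs_singleton by simp
qed

lemma sum_diamond_pole_function:
  "(\<Sum>\<sigma>\<in>configs (vertices n N []) rest. boltzmann \<beta> (edges n N []) J \<sigma> * h (\<sigma> PoleA) (\<sigma> PoleB)) =
    coupling_const n \<beta> N [] J * (\<Sum>a\<in>{-1, 1}. \<Sum>b\<in>{-1, 1}. exp (eff_coupling n \<beta> N [] J * a * b) * h a b)"
proof -
  have "(\<Sum>\<rho>\<in>configs (inner_vertices n N []) (rest(PoleA := a, PoleB := b)).
      boltzmann \<beta> (edges n N []) J \<rho> * h (\<rho> PoleA) (\<rho> PoleB)) =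
    coupling_const n \<beta> N [] J * exp (eff_coupling n \<beta> N [] J * a * b) * h a b"
    if "a \<in> {-1, 1}" "b \<in> {-1, 1}" for a b
  proof -
    have "PoleA \<notin> inner_vertices n N []" "PoleB \<notin> inner_vertices n N []"
      by (auto simp: inner_vertices_eq)
    then have "(\<Sum>\<rho>\<in>configs (inner_vertices n N []) (rest(PoleA := a, PoleB := b)).
        boltzmann \<beta> (edges n N []) J \<rho> * h (\<rho> PoleA) (\<rho> PoleB)) =
      interior_sum n \<beta> N [] J (rest(PoleA := a, PoleB := b)) * h a b"
      unfolding interior_sum_def sum_distrib_right
      by (intro sum.cong refl) (simp add: configs_off)
    then show ?thesis
      using that by (simp add: interior_sum_eff_coupling)
  qed
  then show ?thesis
    unfolding sum_diamond_configs sum_distrib_left by (simp add: mult.assoc)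
qed

lemma partition_sum_eq:
  "partition_sum n \<beta> N J = 4 * coupling_const n \<beta> N [] J * cosh (eff_coupling n \<beta> N [] J)"
  using sum_diamond_pole_function[where h = "\<lambda>_ _. 1" and rest = start]
  by (simp add: partition_sum_def cosh_def field_simps)

lemma expectation_gibbs_free:
  fixes f :: "spins \<Rightarrow> real"
  shows "measure_pmf.expectation (gibbs_free n \<beta> N J) f =
    (\<Sum>\<sigma>\<in>configs (vertices n N []) start. boltzmann \<beta> (edges n N []) J \<sigma> * f \<sigma>) / partition_sum n \<beta> N J"
proof -
  have "measure_pmf.expectation (gibbs_free n \<beta> N J) f =
      (\<Sum>\<sigma>\<in>configs (vertices n N []) start. pmf (gibbs_free n \<beta> N J) \<sigma> *\<^sub>R f \<sigma>)"
    by (rule integral_measure_pmf) (use set_pole_gibbs[OF pole_gibbs_free, of n \<beta> N J] in auto)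
  then show ?thesis by (simp add: pmf_gibbs_free sum_divide_distrib)
qed

lemma pole_correlation:
  "measure_pmf.expectation (gibbs_free n \<beta> N J) (\<lambda>\<sigma>. \<sigma> PoleA * \<sigma> PoleB) = tanh (eff_coupling n \<beta> N [] J)"
proof -
  have 4: "(\<Sum>a\<in>{-1, 1}. \<Sum>b\<in>{-1, 1}. exp (x * a * b) * (a * b)) = 4 * sinh x" for x :: real
    by (simp add: sinh_def field_simps)
  have "measure_pmf.expectation (gibbs_free n \<beta> N J) (\<lambda>\<sigma>. \<sigma> PoleA * \<sigma> PoleB) =
    (coupling_const n \<beta> N [] J * (4 * sinh (eff_coupling n \<beta> N [] J))) /
    (coupling_const n \<beta> N [] J * (4 * cosh (eff_coupling n \<beta> N [] J)))"
    unfolding expectation_gibbs_free partition_sum_eq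
    by (subst sum_diamond_pole_function[where h = "(*)"], subst 4) (simp only: mult_ac)
  then show ?thesis
    using coupling_const_pos[of n \<beta> N "[]" J] by (simp add: tanh_def)
qed

lemma replicas_bonds_prob:
  "measure_pmf.prob (replicas_bonds n \<beta> N J) S =
    measure_pmf.expectation (pair_pmf (gibbs_free n \<beta> N J) (gibbs_free n \<beta> N J))
      (\<lambda>(\<sigma>, \<tau>). measure_pmf.prob (blue_law \<beta> (edges n N []) J \<sigma> \<tau>) {b. (\<sigma>, \<tau>, b) \<in> S})"
proof -
  let ?G = "gibbs_free n \<beta> N J" and ?V = "configs (vertices n N []) start"
  have R: "replicas_bonds n \<beta> N J = bind_pmf (pair_pmf ?G ?G)
      (\<lambda>(\<sigma>, \<tau>). map_pmf (\<lambda>b. (\<sigma>, \<tau>, b)) (blue_law \<beta> (edges n N []) J \<sigma> \<tau>))"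
    by (simp add: replicas_bonds_def pair_pmf_def bind_assoc_pmf bind_return_pmf blue_bonds_eq)
  have fin: "finite (set_pmf (blue_law \<beta> (edges n N []) J \<sigma> \<tau>))" for \<sigma> \<tau>
    by (rule finite_subset[OF set_blue_law]) simp
  have supp: "set_pmf (pair_pmf ?G ?G) \<subseteq> ?V \<times> ?V"
    using set_pole_gibbs[OF pole_gibbs_free, of n \<beta> N J] by auto
  have "measure_pmf.prob (replicas_bonds n \<beta> N J) S = measure_pmf.expectation (replicas_bonds n \<beta> N J) (indicator S)"
    by simp
  also have "\<dots> = (\<Sum>z\<in>?V \<times> ?V. pmf (pair_pmf ?G ?G) z *\<^sub>R
      measure_pmf.expectation (case z of (\<sigma>, \<tau>) \<Rightarrow> map_pmf (\<lambda>b. (\<sigma>, \<tau>, b)) (blue_law \<beta> (edges n N []) J \<sigma> \<tau>)) (indicator S))"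
    unfolding R by (rule pmf_expectation_bind) (use supp fin in auto)
  also have "\<dots> = (\<Sum>z\<in>?V \<times> ?V. pmf (pair_pmf ?G ?G) z *\<^sub>R
      (case z of (\<sigma>, \<tau>) \<Rightarrow> measure_pmf.prob (blue_law \<beta> (edges n N []) J \<sigma> \<tau>) {b. (\<sigma>, \<tau>, b) \<in> S}))"
    by (intro sum.cong refl) (auto simp: vimage_def)
  also have "\<dots> = measure_pmf.expectation (pair_pmf ?G ?G)
      (\<lambda>(\<sigma>, \<tau>). measure_pmf.prob (blue_law \<beta> (edges n N []) J \<sigma> \<tau>) {b. (\<sigma>, \<tau>, b) \<in> S})"
    by (rule integral_measure_pmf[symmetric]) (use supp in auto)
  finally show ?thesis .
qed

text \<open>An edge can be blue only if both replicas satisfy it, and then its ends have equal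
  overlaps.\<close>

lemma set_replicas_bonds:
  assumes "(\<sigma>, \<tau>, b) \<in> set_pmf (replicas_bonds n \<beta> N J)" and \<beta>: "\<beta> \<ge> 0"
  shows "\<sigma> \<in> configs (vertices n N []) start" "\<tau> \<in> configs (vertices n N []) start" "b \<subseteq> edges n N []"
    and "\<And>e. e \<in> b \<Longrightarrow> \<sigma> (fst (poles e)) * \<tau> (fst (poles e)) = \<sigma> (snd (poles e)) * \<tau> (snd (poles e))"
proof -
  have *: "\<sigma> \<in> set_pmf (gibbs_free n \<beta> N J)" "\<tau> \<in> set_pmf (gibbs_free n \<beta> N J)"
    "b \<in> set_pmf (blue_law \<beta> (edges n N []) J \<sigma> \<tau>)"
    using assms by (auto simp: replicas_bonds_def blue_bonds_eq)
  then show \<sigma>: "\<sigma> \<in> configs (vertices n N []) start" and \<tau>: "\<tau> \<in> configs (vertices n N []) start"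
    and b: "b \<subseteq> edges n N []"
    using set_pole_gibbs[OF pole_gibbs_free] set_blue_law by blast+
  fix e assume e: "e \<in> b"
  have "bond_weight \<beta> (edges n N []) J \<sigma> \<tau> b \<noteq> 0"
    using *(3) b pmf_blue_law[OF _ \<beta>, of "edges n N []" J \<sigma> \<tau> b] by (simp add: set_pmf_iff)
  moreover have eE: "e \<in> edges n N []" using e b by blast
  ultimately have "(if e \<in> b then blue_prob \<beta> J \<sigma> \<tau> e else 1 - blue_prob \<beta> J \<sigma> \<tau> e) \<noteq> 0"
    unfolding bond_weight_def prod_zero_iff[OF finite_edges] by blast
  then have "blue_prob \<beta> J \<sigma> \<tau> e \<noteq> 0" using e by simp
  then have pos: "J e * \<sigma> (fst (poles e)) * \<sigma> (snd (poles e)) > 0" "J e * \<tau> (fst (poles e)) * \<tau> (snd (poles e)) > 0"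
    by (auto simp: blue_prob_def Let_def split: if_splits)
  have "e \<in> edges n N []" using e b by blast
  then have "fst (poles e) \<in> vertices n N []" "snd (poles e) \<in> vertices n N []"
    using edge_ends_in_vertices by auto
  then have "\<sigma> (fst (poles e)) \<in> {-1, 1}" "\<sigma> (snd (poles e)) \<in> {-1, 1}"
    "\<tau> (fst (poles e)) \<in> {-1, 1}" "\<tau> (snd (poles e)) \<in> {-1, 1}"
    using configs_on[OF \<sigma>] configs_on[OF \<tau>] by auto
  then show "\<sigma> (fst (poles e)) * \<tau> (fst (poles e)) = \<sigma> (snd (poles e)) * \<tau> (snd (poles e))"
    using pos by auto
qed

text \<open>Four of the sixteen choices of the pole spins satisfy both replicas and four satisfy neither;
  after the reduction by \<open>exp (-4 \<bar>x\<bar>)\<close> each of these eight weighs \<open>exp (-2 \<bar>x\<bar>)\<close>. The other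
  eight weigh \<open>1\<close>.\<close>

lemma pole_disconnection_sum:
  fixes x :: real
  shows "(\<Sum>a\<in>{-1, 1}. \<Sum>b\<in>{-1, 1}. \<Sum>a'\<in>{-1, 1}. \<Sum>b'\<in>{-1, 1}. exp (x * a * b) * exp (x * a' * b') *
      (if x * a * b \<ge> 0 \<and> x * a' * b' \<ge> 0 then exp (-4 * \<bar>x\<bar>) else 1)) =
    (1 - tanh \<bar>x\<bar>) * (4 * cosh x)\<^sup>2"
proof -
  have "(1 - tanh y) * (4 * cosh y)\<^sup>2 = 8 + 8 * exp (-2 * y)" for y :: real
  proof -
    have "(1 - tanh y) * (4 * cosh y)\<^sup>2 = (cosh y - sinh y) * (16 * cosh y)"
      by (simp add: tanh_def field_simps power2_eq_square)
    also have "\<dots> = exp (- y) * (8 * (exp y + exp (- y)))"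
      unfolding cosh_minus_sinh by (simp add: cosh_def)
    also have "\<dots> = 8 + 8 * exp (-2 * y)"
    proof -
      have "exp (- y) * exp y = 1" "exp (- y) * exp (- y) = exp (-2 * y)"
        by (simp_all add: mult_exp_exp)
      then show ?thesis by algebra
    qed
    finally show ?thesis .
  qed
  from this[of "\<bar>x\<bar>"] have R: "(1 - tanh \<bar>x\<bar>) * (4 * cosh x)\<^sup>2 = 8 + 8 * exp (-2 * \<bar>x\<bar>)"
    by (simp only: cosh_real_abs)
  show ?thesis
    unfolding R by (cases x "0 :: real" rule: linorder_cases) (simp_all add: mult_exp_exp)
qed

lemma poles_disconnected_prob:
  assumes \<beta>: "\<beta> \<ge> 0"
  shows "measure_pmf.prob (replicas_bonds n \<beta> N J) {(\<sigma>, \<tau>, b). \<not> connected_by b PoleA PoleB} \<le>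
    1 - tanh \<bar>eff_coupling n \<beta> N [] J\<bar>"
proof -
  let ?V = "vertices n N []" and ?I = "inner_vertices n N []" and ?B = "boltzmann \<beta> (edges n N []) J"
  let ?G = "gibbs_free n \<beta> N J" and ?Z = "partition_sum n \<beta> N J" and ?K = "coupling_const n \<beta> N [] J"
  define x where "x = eff_coupling n \<beta> N [] J"
  let ?nc = "noncon_prob \<beta> (edges n N []) J PoleA PoleB"
  have "measure_pmf.prob (replicas_bonds n \<beta> N J) {(\<sigma>, \<tau>, b). \<not> connected_by b PoleA PoleB} =
      measure_pmf.expectation (pair_pmf ?G ?G) (\<lambda>(\<sigma>, \<tau>). ?nc \<sigma> \<tau>)"
    by (simp add: replicas_bonds_prob noncon_prob_def)
  also have "\<dots> = (\<Sum>\<sigma>\<in>configs ?V start. \<Sum>\<tau>\<in>configs ?V start. ?B \<sigma> * ?B \<tau> * ?nc \<sigma> \<tau>) / ?Z\<^sup>2"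
    by (subst expectation_pair_finite[of "configs ?V start" "configs ?V start"])
       (use set_pole_gibbs[OF pole_gibbs_free] in
         \<open>auto simp: pmf_gibbs_free sum_divide_distrib power2_eq_square intro!: sum.cong\<close>)
  also have "\<dots> \<le> ((1 - tanh \<bar>x\<bar>) * ?Z\<^sup>2) / ?Z\<^sup>2"
  proof (rule divide_right_mono)
    have "(\<Sum>\<sigma>\<in>configs ?V start. \<Sum>\<tau>\<in>configs ?V start. ?B \<sigma> * ?B \<tau> * ?nc \<sigma> \<tau>) =
      (\<Sum>a\<in>{-1, 1}. \<Sum>b\<in>{-1, 1}. \<Sum>a'\<in>{-1, 1}. \<Sum>b'\<in>{-1, 1}.
        \<Sum>\<rho>\<in>configs ?I (start(PoleA := a, PoleB := b)). \<Sum>\<pi>\<in>configs ?I (start(PoleA := a', PoleB := b')).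
          ?B \<rho> * ?B \<pi> * ?nc \<rho> \<pi>)"
      unfolding sum_diamond_configs
      by (rule sum.cong[OF refl], rule sum.cong[OF refl], rule sum_swap3[symmetric])
    also have "\<dots> \<le> (\<Sum>a\<in>{-1, 1}. \<Sum>b\<in>{-1, 1}. \<Sum>a'\<in>{-1, 1}. \<Sum>b'\<in>{-1, 1}.
        ?K\<^sup>2 * (exp (x * a * b) * exp (x * a' * b') *
      (if x * a * b \<ge> 0 \<and> x * a' * b' \<ge> 0 then exp (-4 * \<bar>x\<bar>) else 1)))"
    proof (intro sum_mono)
      fix a b a' b' :: real assume ab: "a \<in> {-1, 1}" "b \<in> {-1, 1}" "a' \<in> {-1, 1}" "b' \<in> {-1, 1}"
      show "(\<Sum>\<rho>\<in>configs ?I (start(PoleA := a, PoleB := b)). \<Sum>\<pi>\<in>configs ?I (start(PoleA := a', PoleB := b')).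
          ?B \<rho> * ?B \<pi> * ?nc \<rho> \<pi>) \<le> ?K\<^sup>2 * (exp (x * a * b) * exp (x * a' * b') *
        (if x * a * b \<ge> 0 \<and> x * a' * b' \<ge> 0 then exp (-4 * \<bar>x\<bar>) else 1))"
        using effective_bond[OF \<beta>, of "start(PoleA := a, PoleB := b)" "[]" "start(PoleA := a', PoleB := b')" n N J] ab
        by (simp add: interior_sum_eff_coupling x_def[symmetric] power2_eq_square mult_ac del: if_split cong: if_cong)
    qed
    also have "\<dots> = ?K\<^sup>2 * ((1 - tanh \<bar>x\<bar>) * (4 * cosh x)\<^sup>2)"
      unfolding pole_disconnection_sum[symmetric] sum_distrib_left ..
    also have "\<dots> = (1 - tanh \<bar>x\<bar>) * ?Z\<^sup>2"
      by (simp add: partition_sum_eq x_def[symmetric] power_mult_distrib)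
    finally show "(\<Sum>\<sigma>\<in>configs ?V start. \<Sum>\<tau>\<in>configs ?V start. ?B \<sigma> * ?B \<tau> * ?nc \<sigma> \<tau>) \<le> (1 - tanh \<bar>x\<bar>) * ?Z\<^sup>2" .
  qed simp
  also have "\<dots> = 1 - tanh \<bar>x\<bar>" using partition_sum_pos[of n \<beta> N J] by simp
  finally show ?thesis by (simp add: x_def)
qed

text \<open>It suffices that the stronger half joins the midpoint to its other pole.\<close>

lemma midpoint_disconnected_prob:
  assumes \<beta>: "\<beta> \<ge> 0" and w: "addr n w" "length w < N" "i < n"
  shows "measure_pmf.prob (replicas_bonds n \<beta> N J) {(\<sigma>, \<tau>, b).
      \<not> connected_by b (fst (poles w)) (Mid w i) \<and> \<not> connected_by b (Mid w i) (snd (poles w))} \<le>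
    \<psi> (half_gap n \<beta> N J w i) + exp (-4 * half_max n \<beta> N J w i)"
proof -
  define k where "k = N - Suc (length w)"
  have N: "length w + Suc k = N" using w by (simp add: k_def)
  let ?c = "\<lambda>h. \<bar>eff_coupling n \<beta> k ((i, h) # w) J\<bar>"
  let ?S = "{(\<sigma>, \<tau>, b). \<not> connected_by b (fst (poles w)) (Mid w i) \<and> \<not> connected_by b (Mid w i) (snd (poles w))}"
  obtain h where h: "?c (\<not> h) \<le> ?c h"
  proof (cases "?c True \<le> ?c False")
    case True
    then show ?thesis using that[of False] by simp
  next
    case False
    then show ?thesis using that[of True] by simp
  qed
  let ?E = "edges n k ((i, h) # w)" and ?x = "fst (poles ((i, h) # w))" and ?y = "snd (poles ((i, h) # w))"
  let ?G = "gibbs_free n \<beta> N J"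
  have EE: "?E \<subseteq> edges n N []"
    using branch_in_diamond(2)[of i n w k N] w N by (cases h) (auto simp: branch_edges_def)
  have "measure_pmf.prob (replicas_bonds n \<beta> N J) ?S = measure_pmf.expectation (pair_pmf ?G ?G)
      (\<lambda>(\<sigma>, \<tau>). measure_pmf.prob (blue_law \<beta> (edges n N []) J \<sigma> \<tau>) {b. (\<sigma>, \<tau>, b) \<in> ?S})"
    by (rule replicas_bonds_prob)
  also have "\<dots> \<le> measure_pmf.expectation (pair_pmf ?G ?G) (\<lambda>(\<sigma>, \<tau>). noncon_prob \<beta> ?E J ?x ?y \<sigma> \<tau>)"
  proof (rule integral_mono)
    show "(case z of (\<sigma>, \<tau>) \<Rightarrow> measure_pmf.prob (blue_law \<beta> (edges n N []) J \<sigma> \<tau>) {b. (\<sigma>, \<tau>, b) \<in> ?S}) \<le>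
        (case z of (\<sigma>, \<tau>) \<Rightarrow> noncon_prob \<beta> ?E J ?x ?y \<sigma> \<tau>)" for z
    proof (cases z)
      case (Pair \<sigma> \<tau>)
      have "noncon_prob \<beta> ?E J ?x ?y \<sigma> \<tau> =
          measure_pmf.prob (blue_law \<beta> (edges n N []) J \<sigma> \<tau>) {b. \<not> connected_by (b \<inter> ?E) ?x ?y}"
        unfolding noncon_prob_def blue_law_restrict[OF finite_edges EE, symmetric] by (simp add: vimage_def)
      moreover have "{b. (\<sigma>, \<tau>, b) \<in> ?S} \<subseteq> {b. \<not> connected_by (b \<inter> ?E) ?x ?y}"
        using connected_by_mono[OF Int_lower1] by (cases h) auto
      ultimately show ?thesis by (simp add: Pair measure_pmf.finite_measure_mono)
    qed
    have "finite (set_pmf (pair_pmf ?G ?G))"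
      using finite_set_pole_gibbs[OF pole_gibbs_free, of n \<beta> N J] by simp
    then show "integrable (pair_pmf ?G ?G) (\<lambda>(\<sigma>, \<tau>). noncon_prob \<beta> ?E J ?x ?y \<sigma> \<tau>)"
      "integrable (pair_pmf ?G ?G) (\<lambda>(\<sigma>, \<tau>). measure_pmf.prob (blue_law \<beta> (edges n N []) J \<sigma> \<tau>) {b. (\<sigma>, \<tau>, b) \<in> ?S})"
      by (rule integrable_measure_pmf_finite)+
  qed
  also have "\<dots> \<le> \<psi> (\<bar>?c h - ?c (\<not> h)\<bar>) + exp (-4 * ?c h)"
    by (rule pole_gibbs_branch_bound[OF pole_gibbs_free w(1) N w(3)], rule disconnection_local[OF \<beta> _ _ _ _ h])
  finally have le: "measure_pmf.prob (replicas_bonds n \<beta> N J) ?S \<le> \<psi> (\<bar>?c h - ?c (\<not> h)\<bar>) + exp (-4 * ?c h)" .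
  have "\<bar>?c h - ?c (\<not> h)\<bar> = half_gap n \<beta> N J w i" "?c h = half_max n \<beta> N J w i"
    using h by (cases h; auto simp: half_gap_def half_max_def k_def)+
  with le show ?thesis by simp
qed

text \<open>If every midpoint on the way down to \<open>w\<close> is joined to a pole of the sub-diamond that it
  splits, then by induction all these midpoints, and with them the poles of \<open>w\<close>, are joined to \<open>A\<close>
  or \<open>B\<close>.\<close>

lemma connection_chain:
  assumes \<beta>: "\<beta> \<ge> 0" and w: "addr n w" "length w \<le> N"
  shows "measure_pmf.prob (replicas_bonds n \<beta> N J) {(\<sigma>, \<tau>, b).
      \<not> {fst (poles w), snd (poles w)} \<subseteq> cluster b PoleA \<union> cluster b PoleB} \<le>
    chain_cost (\<lambda>v i. \<psi> (half_gap n \<beta> N J v i) + exp (-4 * half_max n \<beta> N J v i)) w"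
  using w
proof (induction w)
  case Nil
  then show ?case by (simp add: cluster_def case_prod_unfold)
next
  case (Cons x w)
  obtain i h where x: "x = (i, h)" by (cases x)
  let ?p = "replicas_bonds n \<beta> N J"
  let ?bad = "\<lambda>w. {(\<sigma>, \<tau>, b). \<not> {fst (poles w), snd (poles w)} \<subseteq> cluster b PoleA \<union> cluster b PoleB}"
  let ?M = "{(\<sigma>, \<tau>, b). \<not> connected_by b (fst (poles w)) (Mid w i) \<and> \<not> connected_by b (Mid w i) (snd (poles w))}"
  have "z \<in> ?bad w \<union> ?M" if z: "z \<in> ?bad (x # w)" for z :: "spins \<times> spins \<times> address set"
  proof (rule ccontr)
    assume not: "z \<notin> ?bad w \<union> ?M"
    obtain \<sigma> \<tau> b where zz: "z = (\<sigma>, \<tau>, b)" by (cases z)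
    let ?S = "cluster b PoleA \<union> cluster b PoleB"
    have p: "fst (poles w) \<in> ?S" "snd (poles w) \<in> ?S" using not zz by auto
    have "connected_by b (fst (poles w)) (Mid w i) \<or> connected_by b (snd (poles w)) (Mid w i)"
      using not zz connected_by_sym by auto
    then have "Mid w i \<in> ?S"
      using p unfolding cluster_def by (auto intro: connected_by_trans)
    then show False using z zz p x by (cases h) auto
  qed
  then have "measure_pmf.prob ?p (?bad (x # w)) \<le> measure_pmf.prob ?p (?bad w \<union> ?M)"
    by (intro measure_pmf.finite_measure_mono) auto
  also have "\<dots> \<le> measure_pmf.prob ?p (?bad w) + measure_pmf.prob ?p ?M"
    by (rule measure_Un_le) auto
  finally show ?case
    using Cons midpoint_disconnected_prob[OF \<beta>, of n w N i J] x by auto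
qed

section \<open>The law of the effective coupling\<close>

text \<open>The embedding of the diamond of scale \<open>k\<close> onto the sub-diamond \<open>w\<close>, and a left inverse of it
  on interior vertices.\<close>

fun embed_vertex :: "address \<Rightarrow> vertex \<Rightarrow> vertex" where
  "embed_vertex w PoleA = fst (poles w)"
| "embed_vertex w PoleB = snd (poles w)"
| "embed_vertex w (Mid u i) = Mid (u @ w) i"

fun strip_vertex :: "address \<Rightarrow> vertex \<Rightarrow> vertex" where
  "strip_vertex w (Mid v i) = Mid (take (length v - length w) v) i"
| "strip_vertex w v = v"

lemma poles_append:
  "fst (poles (u @ w)) = embed_vertex w (fst (poles u))"
  "snd (poles (u @ w)) = embed_vertex w (snd (poles u))"
proof -
  have "fst (poles (u @ w)) = embed_vertex w (fst (poles u)) \<and>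
    snd (poles (u @ w)) = embed_vertex w (snd (poles u))"
  proof (induction u)
    case (Cons x u)
    then show ?case by (cases x) auto
  qed auto
  then show "fst (poles (u @ w)) = embed_vertex w (fst (poles u))"
    "snd (poles (u @ w)) = embed_vertex w (snd (poles u))" by auto
qed

lemma inner_vertices_embed:
  "embed_vertex w v \<in> inner_vertices n k w \<longleftrightarrow> v \<in> inner_vertices n k []"
  by (cases v) (auto simp: inner_vertices_eq)

lemma edges_embed: "edges n k w = (\<lambda>u. u @ w) ` edges n k []"
  by (auto simp: edges_eq)

lemma interior_sum_embed:
  "interior_sum n \<beta> k w J \<sigma> = interior_sum n \<beta> k [] (\<lambda>u. J (u @ w)) (\<lambda>v. \<sigma> (embed_vertex w v))"
  unfolding interior_sum_def
proof (rule sum.reindex_bij_witness[where j = "\<lambda>\<rho> v. \<rho> (embed_vertex w v)"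
      and i = "\<lambda>\<pi> v. if v \<in> inner_vertices n k w then \<pi> (strip_vertex w v) else \<sigma> v"])
  have strip: "strip_vertex w v \<in> inner_vertices n k [] \<and> embed_vertex w (strip_vertex w v) = v"
    if "v \<in> inner_vertices n k w" for v
    using that by (auto simp: inner_vertices_eq)
  fix \<rho> assume \<rho>: "\<rho> \<in> configs (inner_vertices n k w) \<sigma>"
  show "(\<lambda>v. if v \<in> inner_vertices n k w then \<rho> (embed_vertex w (strip_vertex w v)) else \<sigma> v) = \<rho>"
    using strip configs_off[OF \<rho>] by (auto simp: fun_eq_iff)
  show "(\<lambda>v. \<rho> (embed_vertex w v)) \<in> configs (inner_vertices n k []) (\<lambda>v. \<sigma> (embed_vertex w v))"
    using \<rho> by (simp add: configs_def inner_vertices_embed)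
  show "boltzmann \<beta> (edges n k []) (\<lambda>u. J (u @ w)) (\<lambda>v. \<rho> (embed_vertex w v)) =
      boltzmann \<beta> (edges n k w) J \<rho>"
    unfolding boltzmann_def edges_embed[of n k w]
    by (subst sum.reindex) (auto simp: inj_on_def poles_append)
next
  fix \<pi> assume \<pi>: "\<pi> \<in> configs (inner_vertices n k []) (\<lambda>v. \<sigma> (embed_vertex w v))"
  have strip: "strip_vertex w v \<in> inner_vertices n k []" if "v \<in> inner_vertices n k w" for v
    using that by (auto simp: inner_vertices_eq)
  have strip': "strip_vertex w (embed_vertex w v) = v" if "v \<in> inner_vertices n k []" for v
    using that by (auto simp: inner_vertices_eq)
  show "(\<lambda>v. if embed_vertex w v \<in> inner_vertices n k w then \<pi> (strip_vertex w (embed_vertex w v))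
      else \<sigma> (embed_vertex w v)) = \<pi>"
    using strip' configs_off[OF \<pi>] by (auto simp: fun_eq_iff inner_vertices_embed)
  show "(\<lambda>v. if v \<in> inner_vertices n k w then \<pi> (strip_vertex w v) else \<sigma> v) \<in> configs (inner_vertices n k w) \<sigma>"
    using \<pi> strip by (simp add: configs_def)
qed

lemma eff_coupling_embed: "eff_coupling n \<beta> k w J = eff_coupling n \<beta> k [] (\<lambda>u. J (u @ w))"
proof -
  have "sub_partition n \<beta> k w J s s' = sub_partition n \<beta> k [] (\<lambda>u. J (u @ w)) s s'"
    if "s \<in> {-1, 1}" "s' \<in> {-1, 1}" for s s'
  proof -
    define \<sigma> where "\<sigma> = (\<lambda>_. s)(snd (poles w) := s')"
    have "sub_partition n \<beta> k w J s s' = interior_sum n \<beta> k w J \<sigma>"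
      by (rule sub_partition_eq[OF that]) (simp_all add: \<sigma>_def)
    also have "\<dots> = sub_partition n \<beta> k [] (\<lambda>u. J (u @ w)) s s'"
      by (subst interior_sum_embed, rule sub_partition_eq[OF that, symmetric]) (simp_all add: \<sigma>_def)
    finally show ?thesis .
  qed
  then show ?thesis by (simp add: eff_coupling_def)
qed

lemma boltzmann_cong_couplings:
  "(\<And>e. e \<in> E \<Longrightarrow> J e = J' e) \<Longrightarrow> boltzmann \<beta> E J \<sigma> = boltzmann \<beta> E J' \<sigma>"
  by (simp add: boltzmann_def cong: sum.cong)

lemma eff_coupling_cong:
  assumes "\<And>e. e \<in> edges n k w \<Longrightarrow> J e = J' e"
  shows "eff_coupling n \<beta> k w J = eff_coupling n \<beta> k w J'"
  using boltzmann_cong_couplings[OF assms, of "edges n k w"]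
  by (simp add: eff_coupling_def sub_partition_def)

lemma measurable_boltzmann:
  assumes "\<And>e. e \<in> E \<Longrightarrow> (\<lambda>\<omega>. J e \<omega>) \<in> borel_measurable L"
  shows "(\<lambda>\<omega>. boltzmann \<beta> E (\<lambda>e. J e \<omega>) \<sigma>) \<in> borel_measurable L"
  unfolding boltzmann_def
  by (rule measurable_compose[OF _ borel_measurable_exp])
     (intro borel_measurable_times borel_measurable_const borel_measurable_sum assms)

lemma measurable_eff_coupling:
  assumes "\<And>e. e \<in> edges n k w \<Longrightarrow> (\<lambda>\<omega>. J e \<omega>) \<in> borel_measurable L"
  shows "(\<lambda>\<omega>. eff_coupling n \<beta> k w (\<lambda>e. J e \<omega>)) \<in> borel_measurable L"
proof -
  have [measurable]: "(\<lambda>\<omega>. sub_partition n \<beta> k w (\<lambda>e. J e \<omega>) s s') \<in> borel_measurable L" for s s'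
    unfolding sub_partition_def by (intro borel_measurable_sum measurable_boltzmann assms)
  show ?thesis unfolding eff_coupling_def by measurable
qed

locale iid_couplings = prob_space M for M :: "'a measure" +
  fixes n :: nat and \<beta> :: real and J :: "address \<Rightarrow> 'a \<Rightarrow> real"
  assumes n: "n \<ge> 1" and \<beta>: "\<beta> \<ge> 0"
    and indep: "\<And>N. indep_vars (\<lambda>_. borel) J (edges n N [])"
    and ident: "\<And>e e'. e \<in> (\<Union>N. edges n N []) \<Longrightarrow> e' \<in> (\<Union>N. edges n N []) \<Longrightarrow>
                   distr M borel (J e) = distr M borel (J e')"
begin

lemma measurable_coupling: "addr n e \<Longrightarrow> J e \<in> borel_measurable M"
  using indep[of "length e"] by (auto simp: indep_vars_def edges_eq)

lemma measurable_coupling_edge: "e \<in> edges n k w \<Longrightarrow> addr n w \<Longrightarrow> (\<lambda>\<omega>. J e \<omega>) \<in> borel_measurable M"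
  using measurable_coupling[of e] by (auto simp: edges_eq)

lemma edges_nonempty: "edges n k w \<noteq> {}"
proof -
  have "replicate k (0, False) @ w \<in> edges n k w"
    using n by (auto simp: edges_eq addr_def)
  then show ?thesis by blast
qed

definition eff :: "nat \<Rightarrow> address \<Rightarrow> 'a \<Rightarrow> real" where
  "eff k w \<omega> = eff_coupling n \<beta> k w (\<lambda>e. J e \<omega>)"

lemma measurable_eff [measurable (raw)]: "addr n w \<Longrightarrow> eff k w \<in> borel_measurable M"
  unfolding eff_def[abs_def] by (intro measurable_eff_coupling measurable_coupling_edge)

text \<open>Both families of couplings are independent with the same marginals. Any function of the
  couplings of a sub-diamond, such as its effective coupling, then has a law depending only on the
  scale.\<close>

lemma distr_couplings_embed:
  assumes w: "addr n w"
  shows "distr M (Pi\<^sub>M (edges n k []) (\<lambda>_. borel)) (\<lambda>\<omega>. \<lambda>u\<in>edges n k []. J (u @ w) \<omega>) =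
    (\<Pi>\<^sub>M u\<in>edges n k []. distr M borel (J u))"
proof -
  let ?K = "edges n k []" and ?K' = "edges n k w"
  have K': "?K' \<subseteq> edges n (k + length w) []"
    using w by (auto simp: edges_eq)
  have rv: "random_variable borel (J e)" if "e \<in> ?K'" for e
    using measurable_coupling_edge[OF that w] by simp
  have "indep_vars (\<lambda>_. borel) J ?K'" by (rule indep_vars_subset[OF indep K'])
  then have law: "distr M (Pi\<^sub>M ?K' (\<lambda>_. borel)) (\<lambda>\<omega>. \<lambda>e\<in>?K'. J e \<omega>) = (\<Pi>\<^sub>M e\<in>?K'. distr M borel (J e))"
    by (subst indep_vars_iff_distr_eq_PiM'[symmetric]) (use edges_nonempty rv in auto)
  have inj: "inj_on (\<lambda>u. u @ w) ?K" by (auto simp: inj_on_def)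
  have maps: "(\<lambda>u. u @ w) \<in> ?K \<rightarrow> ?K'" by (auto simp: edges_embed[of n k w])
  have meas: "(\<lambda>f. \<lambda>u\<in>?K. f (u @ w)) \<in> Pi\<^sub>M ?K' (\<lambda>_. borel :: real measure) \<rightarrow>\<^sub>M Pi\<^sub>M ?K (\<lambda>_. borel)"
    using maps by (intro measurable_restrict measurable_component_singleton) auto
  have meas': "(\<lambda>\<omega>. \<lambda>e\<in>?K'. J e \<omega>) \<in> M \<rightarrow>\<^sub>M Pi\<^sub>M ?K' (\<lambda>_. borel)"
    by (intro measurable_restrict rv)
  have "distr M (Pi\<^sub>M ?K (\<lambda>_. borel)) (\<lambda>\<omega>. \<lambda>u\<in>?K. J (u @ w) \<omega>) =
      distr M (Pi\<^sub>M ?K (\<lambda>_. borel)) ((\<lambda>f. \<lambda>u\<in>?K. f (u @ w)) \<circ> (\<lambda>\<omega>. \<lambda>e\<in>?K'. J e \<omega>))"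
    using maps by (intro distr_cong refl) (auto simp: fun_eq_iff restrict_def)
  also have "\<dots> = distr (\<Pi>\<^sub>M e\<in>?K'. distr M borel (J e)) (Pi\<^sub>M ?K (\<lambda>_. borel)) (\<lambda>f. \<lambda>u\<in>?K. f (u @ w))"
    by (subst distr_distr[OF meas meas', symmetric]) (simp only: law)
  also have "\<dots> = distr (\<Pi>\<^sub>M e\<in>?K'. distr M borel (J e)) (\<Pi>\<^sub>M u\<in>?K. distr M borel (J (u @ w))) (\<lambda>f. \<lambda>u\<in>?K. f (u @ w))"
    by (intro distr_cong refl sets_PiM_cong) auto
  also have "\<dots> = (\<Pi>\<^sub>M u\<in>?K. distr M borel (J (u @ w)))"
    by (rule distr_PiM_reindex) (use inj maps rv in \<open>auto intro: prob_space_distr\<close>)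
  also have "\<dots> = (\<Pi>\<^sub>M u\<in>?K. distr M borel (J u))"
    by (intro PiM_cong refl ident) (use w in \<open>auto simp: edges_eq\<close>)
  finally show ?thesis .
qed

lemma distr_eff:
  assumes w: "addr n w"
  shows "distr M borel (eff k w) = distr M borel (\<xi> n \<beta> J k)"
proof -
  let ?K = "edges n k []" and ?S = "Pi\<^sub>M (edges n k []) (\<lambda>_. borel :: real measure)"
  let ?f = "\<lambda>g. eff_coupling n \<beta> k [] g"
  have f: "?f \<in> borel_measurable ?S"
    by (rule measurable_eff_coupling) (rule measurable_component_singleton)
  have *: "distr M borel (eff k u) = distr (\<Pi>\<^sub>M u\<in>?K. distr M borel (J u)) borel ?f" if u: "addr n u" for u
  proof -
    have X: "(\<lambda>\<omega>. \<lambda>v\<in>?K. J (v @ u) \<omega>) \<in> M \<rightarrow>\<^sub>M ?S"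
      by (intro measurable_restrict measurable_coupling) (use u in \<open>auto simp: edges_eq\<close>)
    have "eff k u = ?f \<circ> (\<lambda>\<omega>. \<lambda>v\<in>?K. J (v @ u) \<omega>)"
      by (auto simp: fun_eq_iff eff_def eff_coupling_embed[of n \<beta> k u] intro!: eff_coupling_cong)
    then have "distr M borel (eff k u) = distr (distr M ?S (\<lambda>\<omega>. \<lambda>v\<in>?K. J (v @ u) \<omega>)) borel ?f"
      by (simp add: distr_distr[OF f X])
    then show ?thesis by (simp add: distr_couplings_embed[OF u])
  qed
  have "\<xi> n \<beta> J k = eff k []" by (simp add: fun_eq_iff \<xi>_def eff_def)
  then show ?thesis using *[OF w] *[of "[]"] by simp
qed

lemma prob_eff:
  assumes "addr n w" "S \<in> sets borel"
  shows "prob {\<omega> \<in> space M. eff k w \<omega> \<in> S} = prob {\<omega> \<in> space M. \<xi> n \<beta> J k \<omega> \<in> S}"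
proof -
  have \<xi>: "\<xi> n \<beta> J k = eff k []" by (simp add: fun_eq_iff \<xi>_def eff_def)
  have "prob {\<omega> \<in> space M. eff k u \<omega> \<in> S} = measure (distr M borel (eff k u)) S" if "addr n u" for u
    using that assms(2) by (subst measure_distr) (auto simp: vimage_def Int_def conj_commute)
  from this[of w] this[of "[]"] show ?thesis
    using assms distr_eff[OF assms(1), of k] by (simp add: \<xi>)
qed

lemma indep_halves:
  assumes "addr n w" "i < n"
  shows "indep_var borel (eff k ((i, False) # w)) borel (eff k ((i, True) # w))"
proof -
  let ?E = "\<lambda>h. edges n k ((i, h) # w)"
  have sub: "?E h \<subseteq> edges n (k + Suc (length w)) []" for h
    using assms by (auto simp: edges_eq)
  have "indep_var (Pi\<^sub>M (?E False) (\<lambda>_. borel)) (\<lambda>\<omega>. restrict (\<lambda>i. J i \<omega>) (?E False))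
      (Pi\<^sub>M (?E True) (\<lambda>_. borel)) (\<lambda>\<omega>. restrict (\<lambda>i. J i \<omega>) (?E True))"
    by (rule indep_var_restrict[OF indep halves_disjoint(1) sub sub])
  then have "indep_var borel (eff_coupling n \<beta> k ((i, False) # w) \<circ> (\<lambda>\<omega>. restrict (\<lambda>i. J i \<omega>) (?E False)))
      borel (eff_coupling n \<beta> k ((i, True) # w) \<circ> (\<lambda>\<omega>. restrict (\<lambda>i. J i \<omega>) (?E True)))"
    by (rule indep_var_compose)
       (rule measurable_eff_coupling, rule measurable_component_singleton, assumption)+
  moreover have "eff_coupling n \<beta> k ((i, h) # w) \<circ> (\<lambda>\<omega>. restrict (\<lambda>i. J i \<omega>) (?E h)) = eff k ((i, h) # w)" for h
    by (auto simp: fun_eq_iff eff_def intro!: eff_coupling_cong)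
  ultimately show ?thesis by simp
qed

end

section \<open>Expectations from small-ball bounds\<close>

text \<open>Since \<open>g\<close> vanishes at infinity and \<open>g' = - d\<close>, \<open>g x\<close> is the integral of \<open>d\<close> over the \<open>t\<close> with
  \<open>x < t\<close>; exchanging the integrals writes the expectation of \<open>g X\<close> as the integral of
  \<open>d t\<close> times the probability that \<open>X < t\<close>.\<close>

lemma (in prob_space) expectation_le_small_ball_integral:
  fixes X :: "'a \<Rightarrow> real" and g d H :: "real \<Rightarrow> real"
  assumes X [measurable]: "X \<in> borel_measurable M" and X0: "\<And>\<omega>. X \<omega> \<ge> 0"
    and d [measurable]: "d \<in> borel_measurable borel" and d0: "\<And>t. t \<ge> 0 \<Longrightarrow> d t \<ge> 0"
    and g: "\<And>t. t \<ge> 0 \<Longrightarrow> (g has_real_derivative - d t) (at t)" and lim: "(g \<longlongrightarrow> 0) at_top"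
    and H: "mono_on {0..} H" "\<And>t. t \<ge> 0 \<Longrightarrow> H t \<ge> 0"
    and le: "\<And>t. t \<ge> 0 \<Longrightarrow> prob {\<omega> \<in> space M. X \<omega> < t} \<le> H t"
  shows "expectation (\<lambda>\<omega>. g (X \<omega>)) \<le> (LBINT t:{0..}. d t * min 1 (H t))"
proof -
  have tail: "ennreal (g x) = (\<integral>\<^sup>+t. ennreal (d t) * indicator {x<..} t \<partial>lborel)" and g0: "g x \<ge> 0" if "x \<ge> 0" for x
  proof -
    have D: "DERIV (\<lambda>t. - g t) t :> d t" if "x \<le> t" for t
      using g[of t] that \<open>x \<ge> 0\<close> by (auto intro!: derivative_eq_intros)
    have "(\<integral>\<^sup>+t. ennreal (d t) * indicator {x..} t \<partial>lborel) = ennreal (0 - (- g x))"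
      by (rule nn_integral_FTC_atLeast[where F = "\<lambda>t. - g t"])
         (use D that d0 in \<open>auto intro: tendsto_eq_intros lim\<close>)
    \<comment> \<open>Small-ball bounds are stated with strict inequalities; the end point is a null set.\<close>
    moreover have "(\<integral>\<^sup>+t. ennreal (d t) * indicator {x..} t \<partial>lborel) = (\<integral>\<^sup>+t. ennreal (d t) * indicator {x<..} t \<partial>lborel)"
      by (rule nn_integral_cong_AE) (use AE_lborel_singleton[of x] in \<open>auto simp: indicator_def\<close>)
    ultimately show "ennreal (g x) = (\<integral>\<^sup>+t. ennreal (d t) * indicator {x<..} t \<partial>lborel)" by simp
    have "- g x \<le> 0"
    proof (rule tendsto_lowerbound[where f = "\<lambda>t. - g t" and F = at_top])
      show "((\<lambda>t. - g t) \<longlongrightarrow> 0) at_top" using tendsto_minus[OF lim] by simp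
      show "\<forall>\<^sub>F t in at_top. - g x \<le> - g t"
        using eventually_ge_at_top[of x]
      proof eventually_elim
        case (elim t)
        show ?case
          by (rule DERIV_nonneg_imp_nondecreasing[of x t "\<lambda>t. - g t"]) (use elim D d0 that in force)+
      qed
    qed simp
    then show "g x \<ge> 0" by simp
  qed
  have [measurable]: "(\<lambda>t. indicator {0..} t * min 1 (H t)) \<in> borel_measurable borel"
  proof -
    have "H \<in> borel_measurable (restrict_space borel {0..})" by (rule borel_measurable_mono_on_fnc[OF H(1)])
    then have "(\<lambda>t. min 1 (H t)) \<in> borel_measurable (restrict_space borel {0..})" by simp
    then show ?thesis by (subst (asm) borel_measurable_restrict_space_iff) (auto simp: mult.commute)
  qed
  have "(\<integral>\<^sup>+\<omega>. ennreal (g (X \<omega>)) \<partial>M) = (\<integral>\<^sup>+\<omega>. \<integral>\<^sup>+t. ennreal (d t) * indicator {X \<omega><..} t \<partial>lborel \<partial>M)"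
    using tail[OF X0] by simp
  also have "\<dots> = (\<integral>\<^sup>+t. \<integral>\<^sup>+\<omega>. ennreal (d t) * indicator {X \<omega><..} t \<partial>M \<partial>lborel)"
  proof (rule pair_sigma_finite.Fubini'[symmetric])
    show "pair_sigma_finite M lborel" by unfold_locales
    have "(\<lambda>(\<omega>, t). ennreal (d t) * indicator {X \<omega><..} t) = (\<lambda>(\<omega>, t). ennreal (d t) * (if X \<omega> < t then 1 else 0))"
      by (auto simp: fun_eq_iff)
    then show "(\<lambda>(\<omega>, t). ennreal (d t) * indicator {X \<omega><..} t) \<in> borel_measurable (M \<Otimes>\<^sub>M lborel)"
      by simp
  qed
  also have "\<dots> \<le> (\<integral>\<^sup>+t. ennreal (d t * (indicator {0..} t * min 1 (H t))) \<partial>lborel)"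
  proof (rule nn_integral_mono)
    fix t :: real
    have "(\<integral>\<^sup>+\<omega>. ennreal (d t) * indicator {X \<omega><..} t \<partial>M) = ennreal (d t) * (\<integral>\<^sup>+\<omega>. indicator {\<omega> \<in> space M. X \<omega> < t} \<omega> \<partial>M)"
      by (subst nn_integral_cmult[symmetric]) (auto intro!: nn_integral_cong simp: indicator_def)
    also have "\<dots> = ennreal (d t) * emeasure M {\<omega> \<in> space M. X \<omega> < t}" by simp
    also have "\<dots> \<le> ennreal (d t * (indicator {0..} t * min 1 (H t)))"
    proof (cases "t \<ge> 0")
      case True
      then show ?thesis
        using le[OF True] d0[OF True]
        by (simp add: emeasure_eq_measure ennreal_mult'[symmetric] ennreal_leI mult_left_mono)
    next
      case False
      then have *: "{\<omega> \<in> space M. X \<omega> < t} = {}"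
        using X0 by (auto simp: not_less intro: order_trans[of t 0])
      show ?thesis unfolding * by simp
    qed
    finally show "(\<integral>\<^sup>+\<omega>. ennreal (d t) * indicator {X \<omega><..} t \<partial>M) \<le> ennreal (d t * (indicator {0..} t * min 1 (H t)))" .
  qed
  also have "\<dots> = ennreal (LBINT t. d t * (indicator {0..} t * min 1 (H t)))"
  proof (rule nn_integral_eq_integral)
    show nn: "AE t in lborel. 0 \<le> d t * (indicator {0..} t * min 1 (H t))"
      by (intro AE_I2) (auto simp: indicator_def d0 H)
    have "(\<integral>\<^sup>+t. ennreal (norm (d t * (indicator {0..} t * min 1 (H t)))) \<partial>lborel) \<le> (\<integral>\<^sup>+t. ennreal (d t) * indicator {0..} t \<partial>lborel)"
      by (rule nn_integral_mono)
         (auto simp: indicator_def d0 H abs_mult intro!: ennreal_leI mult_left_le)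
    also have "\<dots> = (\<integral>\<^sup>+t. ennreal (d t) * indicator {0<..} t \<partial>lborel)"
      by (rule nn_integral_cong_AE) (use AE_lborel_singleton[of 0] in \<open>auto simp: indicator_def\<close>)
    also have "\<dots> = ennreal (g 0)" using tail[of 0] by simp
    also have "\<dots> < \<infinity>" by simp
    finally show "integrable lborel (\<lambda>t. d t * (indicator {0..} t * min 1 (H t)))"
      by (intro integrableI_bounded) (auto intro!: borel_measurable_times)
  qed
  finally have "(\<integral>\<^sup>+\<omega>. ennreal (g (X \<omega>)) \<partial>M) \<le> ennreal (LBINT t. d t * (indicator {0..} t * min 1 (H t)))" .
  then have "expectation (\<lambda>\<omega>. g (X \<omega>)) \<le> (LBINT t. d t * (indicator {0..} t * min 1 (H t)))"
  proof (cases "integrable M (\<lambda>\<omega>. g (X \<omega>))")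
    case True
    assume *: "(\<integral>\<^sup>+\<omega>. ennreal (g (X \<omega>)) \<partial>M) \<le> ennreal (LBINT t. d t * (indicator {0..} t * min 1 (H t)))"
    have "0 \<le> (LBINT t. d t * (indicator {0..} t * min 1 (H t)))"
      by (intro integral_nonneg_AE AE_I2) (auto simp: indicator_def d0 H)
    with * show ?thesis
      by (simp add: nn_integral_eq_integral[OF True] g0 X0)
  next
    case False
    have "0 \<le> (LBINT t. d t * (indicator {0..} t * min 1 (H t)))"
      by (intro integral_nonneg_AE AE_I2) (auto simp: indicator_def d0 H)
    then show ?thesis by (simp add: not_integrable_integral_eq[OF False])
  qed
  then show ?thesis
    unfolding set_lebesgue_integral_def by (simp add: mult_ac)
qed

lemma sech_sq: "(sech x)\<^sup>2 = 1 - (tanh x)\<^sup>2"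
proof -
  have "(cosh x)\<^sup>2 = (sinh x)\<^sup>2 + 1" using cosh_square_eq[of x] by simp
  then have "(sinh x)\<^sup>2 = (cosh x)\<^sup>2 - 1" by simp
  then show ?thesis by (simp add: sech_def tanh_def power_divide field_simps)
qed

lemma sech_bounds: "0 \<le> (sech x)\<^sup>2" "(sech x)\<^sup>2 \<le> 1"
  by simp (simp add: sech_sq)

lemma sech_sq_has_derivative:
  "((\<lambda>t. (sech t)\<^sup>2) has_real_derivative - (2 * (sech t)\<^sup>2 * tanh t)) (at t)"
  unfolding sech_sq[abs_def] 
  by (auto intro!: derivative_eq_intros simp: sech_sq)

lemma tendsto_sech_sq: "((\<lambda>t. (sech t)\<^sup>2) \<longlongrightarrow> 0) at_top"
proof -
  have "((\<lambda>t :: real. 1 - (tanh t)\<^sup>2) \<longlongrightarrow> 1 - 1\<^sup>2) at_top"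
    by (intro tendsto_intros tanh_real_at_top)
  then show ?thesis by (simp only: sech_sq) simp
qed

lemma tendsto_sech: "(sech \<longlongrightarrow> 0) at_top"
  using tendsto_sech_sq by simp

lemma measurable_sech [measurable]: "sech \<in> borel_measurable borel"
  unfolding sech_def[abs_def] by (intro borel_measurable_continuous_onI continuous_intros) auto

lemma measurable_tanh [measurable]: "(tanh :: real \<Rightarrow> real) \<in> borel_measurable borel"
  by (intro borel_measurable_continuous_onI continuous_intros) auto

text \<open>The closed form of \<open>- \<psi>'\<close>, from which its sign is clear.\<close>

definition psi_decay :: "real \<Rightarrow> real" where
  "psi_decay s = 2 * (1 - p_fun s) * (2 * exp (2 * s) / (1 + exp (2 * s))\<^sup>2)"

lemma psi_has_derivative: "(\<psi> has_real_derivative - psi_decay s) (at s)"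
proof -
  have "1 + exp (2 * s) \<noteq> 0" using exp_gt_zero[of "2 * s"] by linarith
  then have "(p_fun has_real_derivative - (2 * exp (2 * s) / (1 + exp (2 * s))\<^sup>2)) (at s)"
    unfolding p_fun_def[abs_def]
    by (auto intro!: derivative_eq_intros simp: power2_eq_square)
  then show ?thesis
    unfolding \<psi>_def[abs_def] by (auto intro!: derivative_eq_intros simp: psi_decay_def)
qed

lemma deriv_psi: "deriv \<psi> s = - psi_decay s"
  by (rule DERIV_imp_deriv[OF psi_has_derivative])

lemma psi_decay_nonneg: "psi_decay s \<ge> 0"
  using p_fun_bounds[of s] by (simp add: psi_decay_def)

lemma measurable_p_fun [measurable]: "p_fun \<in> borel_measurable borel"
  unfolding p_fun_def[abs_def] by measurable

lemma measurable_psi [measurable]: "\<psi> \<in> borel_measurable borel"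
  unfolding \<psi>_def[abs_def] by measurable

lemma measurable_psi_decay [measurable]: "psi_decay \<in> borel_measurable borel"
  unfolding psi_decay_def[abs_def] by measurable

lemma psi_bounds: "0 \<le> \<psi> s" "\<psi> s \<le> 1"
  using p_fun_bounds[of s] power_le_one[of "1 - p_fun s" 2] by (auto simp: \<psi>_def)

lemma tendsto_psi: "(\<psi> \<longlongrightarrow> 0) at_top"
proof -
  have "filterlim (\<lambda>s. 1 + exp (2 * s :: real)) at_top at_top"
    by (intro filterlim_tendsto_add_at_top[OF tendsto_const] filterlim_compose[OF exp_at_top]
        filterlim_tendsto_pos_mult_at_top[OF tendsto_const]) (auto simp: filterlim_ident)
  then have "(p_fun \<longlongrightarrow> 0) at_top"
    unfolding p_fun_def[abs_def] by (intro tendsto_divide_0[OF tendsto_const] filterlim_at_top_imp_at_infinity)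
  then show ?thesis unfolding \<psi>_def[abs_def] by (auto intro!: tendsto_eq_intros)
qed

lemma exp4_has_derivative: "((\<lambda>s. exp (-4 * s)) has_real_derivative - (4 * exp (-4 * s))) (at s)"
  by (auto intro!: derivative_eq_intros)

lemma tendsto_exp4: "((\<lambda>s :: real. exp (-4 * s)) \<longlongrightarrow> 0) at_top"
proof -
  have "filterlim (\<lambda>s :: real. -4 * s) at_bot at_top"
    by (rule filterlim_tendsto_neg_mult_at_bot[OF tendsto_const]) (auto simp: filterlim_ident)
  then show ?thesis by (rule filterlim_compose[OF exp_at_bot])
qed

locale profiled_couplings = iid_couplings M n \<beta> J
  for M :: "'a measure" and n \<beta> J +
  fixes F Q :: "nat \<Rightarrow> real \<Rightarrow> real"
  assumes profile: "small_ball_profile M n \<beta> J F Q"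
begin

lemma F_mono: "mono_on {0..} (F k)" and Q_mono: "mono_on {0..} (Q k)"
  and F_nonneg: "t \<ge> 0 \<Longrightarrow> F k t \<ge> 0" and Q_nonneg: "t \<ge> 0 \<Longrightarrow> Q k t \<ge> 0"
  using profile by (auto simp: small_ball_profile_def)

lemma small_ball_F:
  assumes "addr n w" "t \<ge> 0"
  shows "prob {\<omega> \<in> space M. \<bar>eff k w \<omega>\<bar> < t} \<le> F k t"
proof -
  have "prob {\<omega> \<in> space M. eff k w \<omega> \<in> {-t<..<t}} = prob {\<omega> \<in> space M. \<xi> n \<beta> J k \<omega> \<in> {-t<..<t}}"
    by (rule prob_eff[OF assms(1)]) simp
  also have "\<dots> = \<P>(\<omega> in M. \<bar>\<xi> n \<beta> J k \<omega>\<bar> < t)" by (auto intro!: arg_cong[where f = prob])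
  also have "\<dots> \<le> F k t" using profile assms(2) by (auto simp: small_ball_profile_def)
  finally show ?thesis by (auto simp: abs_less_iff minus_less_iff conj_commute)
qed

lemma small_ball_Q:
  assumes "addr n w" "t \<ge> 0" "y \<ge> 0"
  shows "prob {\<omega> \<in> space M. \<bar>\<bar>eff k w \<omega>\<bar> - y\<bar> < t} \<le> Q k t"
proof -
  have S: "{x :: real. \<bar>\<bar>x\<bar> - y\<bar> < t} \<in> sets borel" by measurable
  have "prob {\<omega> \<in> space M. \<bar>\<bar>eff k w \<omega>\<bar> - y\<bar> < t} = \<P>(\<omega> in M. \<bar>\<bar>\<xi> n \<beta> J k \<omega>\<bar> - y\<bar> < t)"
    using prob_eff[OF assms(1) S] by simp
  also have "\<dots> \<le> (SUP y\<in>{0..}. \<P>(\<omega> in M. \<bar>\<bar>\<xi> n \<beta> J k \<omega>\<bar> - y\<bar> < t))"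
    using assms(3) by (intro cSUP_upper bdd_aboveI2[where M = 1]) auto
  also have "\<dots> \<le> Q k t" using profile assms(2) by (auto simp: small_ball_profile_def)
  finally show ?thesis .
qed

text \<open>The two halves of a branch are independent: condition on one of them for the gap, and
  multiply for the maximum.\<close>

lemma small_ball_gap:
  assumes w: "addr n w" "i < n" and t: "t \<ge> 0"
  shows "prob {\<omega> \<in> space M. \<bar>\<bar>eff k ((i, False) # w) \<omega>\<bar> - \<bar>eff k ((i, True) # w) \<omega>\<bar>\<bar> < t} \<le> Q k t"
proof -
  let ?X = "eff k ((i, False) # w)" and ?Y = "eff k ((i, True) # w)"
  have X [measurable]: "?X \<in> borel_measurable M" and Y [measurable]: "?Y \<in> borel_measurable M"
    using w by (auto intro: measurable_eff)
  let ?A = "{p \<in> space (borel \<Otimes>\<^sub>M borel). \<bar>\<bar>fst p\<bar> - \<bar>snd p\<bar>\<bar> < t} :: (real \<times> real) set"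
  have A: "?A \<in> sets (borel \<Otimes>\<^sub>M borel)" by measurable
  interpret DX: prob_space "distr M borel ?X" by (rule prob_space_distr) measurable
  interpret DY: prob_space "distr M borel ?Y" by (rule prob_space_distr) measurable
  interpret P: pair_sigma_finite "distr M borel ?X" "distr M borel ?Y" ..
  have J: "distr M borel ?X \<Otimes>\<^sub>M distr M borel ?Y = distr M (borel \<Otimes>\<^sub>M borel) (\<lambda>\<omega>. (?X \<omega>, ?Y \<omega>))"
    using indep_halves[OF w, of k] by (simp add: indep_var_distribution_eq)
  have "emeasure M {\<omega> \<in> space M. \<bar>\<bar>?X \<omega>\<bar> - \<bar>?Y \<omega>\<bar>\<bar> < t} = emeasure (distr M (borel \<Otimes>\<^sub>M borel) (\<lambda>\<omega>. (?X \<omega>, ?Y \<omega>))) ?A"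
    by (subst emeasure_distr) (use A in \<open>auto simp: space_pair_measure intro!: arg_cong[where f = "emeasure M"]\<close>)
  also have "\<dots> = (\<integral>\<^sup>+y. emeasure (distr M borel ?X) ((\<lambda>x. (x, y)) -` ?A) \<partial>distr M borel ?Y)"
    unfolding J[symmetric] by (rule P.emeasure_pair_measure_alt2) (use A in simp)
  also have "\<dots> \<le> (\<integral>\<^sup>+y. ennreal (Q k t) \<partial>distr M borel ?Y)"
  proof (rule nn_integral_mono)
    fix y :: real
    have "emeasure (distr M borel ?X) ((\<lambda>x. (x, y)) -` ?A) = emeasure M {\<omega> \<in> space M. \<bar>\<bar>?X \<omega>\<bar> - \<bar>y\<bar>\<bar> < t}"
      by (subst emeasure_distr) (auto simp: space_pair_measure intro!: arg_cong[where f = "emeasure M"])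
    also have "\<dots> \<le> ennreal (Q k t)"
      unfolding emeasure_eq_measure using small_ball_Q[of "(i, False) # w" t "\<bar>y\<bar>" k] w t by (intro ennreal_leI) auto
    finally show "emeasure (distr M borel ?X) ((\<lambda>x. (x, y)) -` ?A) \<le> ennreal (Q k t)" .
  qed
  also have "\<dots> = ennreal (Q k t)" using DY.emeasure_space_1 by simp
  finally show ?thesis using Q_nonneg[OF t] by (simp add: emeasure_eq_measure)
qed

lemma small_ball_max:
  assumes w: "addr n w" "i < n" and t: "t \<ge> 0"
  shows "prob {\<omega> \<in> space M. max \<bar>eff k ((i, False) # w) \<omega>\<bar> \<bar>eff k ((i, True) # w) \<omega>\<bar> < t} \<le> (min 1 (F k t))\<^sup>2"
proof -
  let ?X = "eff k ((i, False) # w)" and ?Y = "eff k ((i, True) # w)"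
  have "prob ((\<lambda>\<omega>. (?X \<omega>, ?Y \<omega>)) -` ({-t<..<t} \<times> {-t<..<t}) \<inter> space M) =
      prob (?X -` {-t<..<t} \<inter> space M) * prob (?Y -` {-t<..<t} \<inter> space M)"
    by (rule indep_varD[OF indep_halves[OF w]]) auto
  also have "(\<lambda>\<omega>. (?X \<omega>, ?Y \<omega>)) -` ({-t<..<t} \<times> {-t<..<t}) \<inter> space M = {\<omega> \<in> space M. max \<bar>?X \<omega>\<bar> \<bar>?Y \<omega>\<bar> < t}"
    by (auto simp: abs_less_iff minus_less_iff)
  also have "?X -` {-t<..<t} \<inter> space M = {\<omega> \<in> space M. \<bar>?X \<omega>\<bar> < t}" by (auto simp: abs_less_iff minus_less_iff)
  also have "?Y -` {-t<..<t} \<inter> space M = {\<omega> \<in> space M. \<bar>?Y \<omega>\<bar> < t}" by (auto simp: abs_less_iff minus_less_iff)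
  also have "prob {\<omega> \<in> space M. \<bar>?X \<omega>\<bar> < t} * prob {\<omega> \<in> space M. \<bar>?Y \<omega>\<bar> < t} \<le> min 1 (F k t) * min 1 (F k t)"
    using small_ball_F[of "(i, False) # w" t k] small_ball_F[of "(i, True) # w" t k] w t
    by (intro mult_mono) (auto simp: F_nonneg)
  finally show ?thesis by (simp add: power2_eq_square)
qed

lemma S_N_bound: "expectation (\<lambda>\<omega>. (sech (\<xi> n \<beta> J N \<omega>))\<^sup>2) \<le> S_N F N"
  and P_N_bound: "expectation (\<lambda>\<omega>. 1 - tanh \<bar>\<xi> n \<beta> J N \<omega>\<bar>) \<le> P_N F N"
proof -
  have \<xi>: "\<xi> n \<beta> J N = eff N []" by (simp add: fun_eq_iff \<xi>_def eff_def)
  have [measurable]: "(\<lambda>\<omega>. \<bar>eff N [] \<omega>\<bar>) \<in> borel_measurable M" using measurable_eff[of "[]" N] by simp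
  have "expectation (\<lambda>\<omega>. (sech \<bar>eff N [] \<omega>\<bar>)\<^sup>2) \<le> (LBINT t:{0..}. (2 * (sech t)\<^sup>2 * tanh t) * min 1 (F N t))"
    by (rule expectation_le_small_ball_integral[where d = "\<lambda>t. 2 * (sech t)\<^sup>2 * tanh t" and g = "\<lambda>t. (sech t)\<^sup>2"])
       (auto intro: sech_sq_has_derivative tendsto_sech F_mono F_nonneg small_ball_F)
  then show "expectation (\<lambda>\<omega>. (sech (\<xi> n \<beta> J N \<omega>))\<^sup>2) \<le> S_N F N"
    by (simp add: S_N_def \<xi> sech_def)
  have "expectation (\<lambda>\<omega>. 1 - tanh \<bar>eff N [] \<omega>\<bar>) \<le> (LBINT t:{0..}. (sech t)\<^sup>2 * min 1 (F N t))"
  proof (rule expectation_le_small_ball_integral[where d = "\<lambda>t. (sech t)\<^sup>2" and g = "\<lambda>t. 1 - tanh t"])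
    show "((\<lambda>t. 1 - tanh t) has_real_derivative - (sech t)\<^sup>2) (at t)" for t
      by (auto intro!: derivative_eq_intros simp: sech_sq)
    show "((\<lambda>t :: real. 1 - tanh t) \<longlongrightarrow> 0) at_top" using tendsto_diff[OF tendsto_const tanh_real_at_top, of 1] by simp
  qed (auto intro: F_mono F_nonneg small_ball_F)
  then show "expectation (\<lambda>\<omega>. 1 - tanh \<bar>\<xi> n \<beta> J N \<omega>\<bar>) \<le> P_N F N" by (simp add: P_N_def \<xi>)
qed

definition gap_var :: "nat \<Rightarrow> address \<Rightarrow> nat \<Rightarrow> 'a \<Rightarrow> real" where
  "gap_var N w i \<omega> = half_gap n \<beta> N (\<lambda>e. J e \<omega>) w i"

definition max_var :: "nat \<Rightarrow> address \<Rightarrow> nat \<Rightarrow> 'a \<Rightarrow> real" where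
  "max_var N w i \<omega> = half_max n \<beta> N (\<lambda>e. J e \<omega>) w i"

lemma gap_var_eq: "gap_var N w i = (\<lambda>\<omega>. \<bar>\<bar>eff (N - Suc (length w)) ((i, False) # w) \<omega>\<bar> - \<bar>eff (N - Suc (length w)) ((i, True) # w) \<omega>\<bar>\<bar>)"
  and max_var_eq: "max_var N w i = (\<lambda>\<omega>. max \<bar>eff (N - Suc (length w)) ((i, False) # w) \<omega>\<bar> \<bar>eff (N - Suc (length w)) ((i, True) # w) \<omega>\<bar>)"
  by (simp_all add: fun_eq_iff gap_var_def max_var_def half_gap_def half_max_def eff_def)

lemma measurable_gap_max:
  assumes "addr n w" "i < n"
  shows "gap_var N w i \<in> borel_measurable M" "max_var N w i \<in> borel_measurable M"
proof -
  have [measurable]: "eff k ((i, h) # w) \<in> borel_measurable M" for k h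
    using assms by (intro measurable_eff) simp
  show "gap_var N w i \<in> borel_measurable M" "max_var N w i \<in> borel_measurable M"
    unfolding gap_var_eq max_var_eq by measurable
qed

lemma expectation_sech_gap:
  assumes w: "addr n w" "i < n" "length w < N"
  shows "expectation (\<lambda>\<omega>. (sech (gap_var N w i \<omega>))\<^sup>2) \<le> 2 * a_s Q (N - length w)"
proof -
  have "expectation (\<lambda>\<omega>. (sech (gap_var N w i \<omega>))\<^sup>2) \<le>
      (LBINT t:{0..}. (2 * (sech t)\<^sup>2 * tanh t) * min 1 (Q (N - Suc (length w)) t))"
    using w
    by (intro expectation_le_small_ball_integral[where d = "\<lambda>t. 2 * (sech t)\<^sup>2 * tanh t" and g = "\<lambda>t. (sech t)\<^sup>2"])
       (auto intro: sech_sq_has_derivative tendsto_sech Q_mono Q_nonneg measurable_gap_max small_ball_gap simp: gap_var_eq)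
  also have "\<dots> = (LBINT t:{0..}. 2 * ((sech t)\<^sup>2 * tanh t * min 1 (Q (N - Suc (length w)) t)))"
    by (simp add: mult.assoc)
  also have "\<dots> = 2 * a_s Q (N - length w)"
    unfolding set_integral_mult_right a_s_def by simp
  finally show ?thesis .
qed

definition bond_cost :: "nat \<Rightarrow> address \<Rightarrow> nat \<Rightarrow> 'a \<Rightarrow> real" where
  "bond_cost N w i \<omega> = \<psi> (gap_var N w i \<omega>) + exp (-4 * max_var N w i \<omega>)"

lemma integrable_bounded_var:
  assumes "f \<in> borel_measurable M" "\<And>\<omega>. \<bar>f \<omega>\<bar> \<le> (c :: real)"
  shows "integrable M f"
  using assms by (intro integrable_const_bound[where B = c]) auto

lemma integrable_costs:
  assumes "addr n w" "i < n"
  shows "integrable M (\<lambda>\<omega>. (sech (gap_var N w i \<omega>))\<^sup>2)"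
    "integrable M (\<lambda>\<omega>. \<psi> (gap_var N w i \<omega>))" "integrable M (\<lambda>\<omega>. exp (-4 * max_var N w i \<omega>))"
proof -
  note [measurable] = measurable_gap_max[OF assms]
  show "integrable M (\<lambda>\<omega>. (sech (gap_var N w i \<omega>))\<^sup>2)"
    by (rule integrable_bounded_var[where c = 1]) (measurable, simp add: sech_bounds)
  show "integrable M (\<lambda>\<omega>. \<psi> (gap_var N w i \<omega>))"
    by (rule integrable_bounded_var[where c = 1]) (measurable, simp add: psi_bounds)
  show "integrable M (\<lambda>\<omega>. exp (-4 * max_var N w i \<omega>))"
    by (rule integrable_bounded_var[where c = 1]) (measurable, simp add: max_var_eq le_max_iff_disj)
qed

lemma expectation_bond_cost:
  assumes w: "addr n w" "i < n" "length w < N"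
  shows "expectation (bond_cost N w i) \<le> a_b F Q (N - length w)"
proof -
  let ?k = "N - Suc (length w)"
  have k: "?k = N - length w - 1" by simp
  have "expectation (\<lambda>\<omega>. \<psi> (gap_var N w i \<omega>)) \<le> (LBINT t:{0..}. psi_decay t * min 1 (Q ?k t))"
    using w
    by (intro expectation_le_small_ball_integral[where d = psi_decay and g = \<psi>])
       (auto intro: psi_has_derivative tendsto_psi psi_decay_nonneg Q_mono Q_nonneg measurable_gap_max small_ball_gap simp: gap_var_eq)
  moreover have "expectation (\<lambda>\<omega>. exp (-4 * max_var N w i \<omega>)) \<le> (LBINT t:{0..}. (4 * exp (-4 * t)) * min 1 ((min 1 (F ?k t))\<^sup>2))"
  proof (rule expectation_le_small_ball_integral[where g = "\<lambda>t. exp (-4 * t)"])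
    show "mono_on {0..} (\<lambda>t. (min 1 (F ?k t))\<^sup>2)"
    proof (rule mono_onI)
      fix r s :: real assume rs: "r \<in> {0..}" "s \<in> {0..}" "r \<le> s"
      then have "F ?k r \<le> F ?k s" using F_mono by (auto simp: mono_on_def)
      then show "(min 1 (F ?k r))\<^sup>2 \<le> (min 1 (F ?k s))\<^sup>2" using F_nonneg rs by (intro power_mono) auto
    qed
    show "prob {\<omega> \<in> space M. max_var N w i \<omega> < t} \<le> (min 1 (F ?k t))\<^sup>2" if "t \<ge> 0" for t
      unfolding max_var_eq by (rule small_ball_max) (use w that in auto)
    show "max_var N w i \<omega> \<ge> 0" for \<omega> by (simp add: max_var_eq le_max_iff_disj)
    show "((\<lambda>t. exp (-4 * t)) has_real_derivative - (4 * exp (-4 * t))) (at t)" for t :: real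
      by (rule exp4_has_derivative)
    show "((\<lambda>t :: real. exp (-4 * t)) \<longlongrightarrow> 0) at_top" by (rule tendsto_exp4)
  qed (use w in \<open>auto intro: measurable_gap_max\<close>)
  moreover have "(LBINT t:{0..}. (4 * exp (-4 * t)) * min 1 ((min 1 (F ?k t))\<^sup>2)) = (LBINT t:{0..}. 4 * exp (-4 * t) * (min 1 (F ?k t))\<^sup>2)"
    by (intro set_lebesgue_integral_cong) (auto simp: F_nonneg power_le_one min.absorb2)
  ultimately show ?thesis
    using integrable_costs[OF w(1,2), of N]
    unfolding a_b_def bond_cost_def[abs_def] deriv_psi k by simp
qed

lemma integrable_bond_cost: "addr n w \<Longrightarrow> i < n \<Longrightarrow> integrable M (bond_cost N w i)"
  unfolding bond_cost_def[abs_def] by (intro Bochner_Integration.integrable_add integrable_costs)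

text \<open>The chain down to an address of length \<open>l\<close> passes branches of sub-diamonds of the scales
  \<open>N - l + 1\<close> to \<open>N\<close>, one for each scale.\<close>

lemma chain_cost_expectation:
  assumes r: "\<And>v i. addr n v \<Longrightarrow> i < n \<Longrightarrow> length v < N \<Longrightarrow> integrable M (r v i)"
      "\<And>v i. addr n v \<Longrightarrow> i < n \<Longrightarrow> length v < N \<Longrightarrow> expectation (r v i) \<le> c (N - length v)"
    and u: "addr n u" "length u \<le> N"
  shows "integrable M (\<lambda>\<omega>. chain_cost (\<lambda>v i. r v i \<omega>) u) \<and>
    expectation (\<lambda>\<omega>. chain_cost (\<lambda>v i. r v i \<omega>) u) \<le> (\<Sum>k=Suc (N - length u)..N. c k)"
  using u
proof (induction u)
  case (Cons x w)
  obtain i h where x: "x = (i, h)" by (cases x)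
  have w: "addr n w" "i < n" "length w < N" using Cons.prems x by auto
  have IH: "integrable M (\<lambda>\<omega>. chain_cost (\<lambda>v i. r v i \<omega>) w)"
    "expectation (\<lambda>\<omega>. chain_cost (\<lambda>v i. r v i \<omega>) w) \<le> (\<Sum>k=Suc (N - length w)..N. c k)"
    using Cons.IH w by auto
  have "(\<Sum>k=Suc (N - length (x # w))..N. c k) = (\<Sum>k=N - length w..N. c k)"
    using w by (simp add: Suc_diff_Suc)
  also have "\<dots> = c (N - length w) + (\<Sum>k=Suc (N - length w)..N. c k)"
    by (rule sum.atLeast_Suc_atMost) simp
  finally have "(\<Sum>k=Suc (N - length (x # w))..N. c k) = c (N - length w) + (\<Sum>k=Suc (N - length w)..N. c k)" .
  then show ?case using IH r[OF w] x by simp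
qed simp

lemma expectation_overlap_chain:
  assumes w: "addr n w" "i < n" "length w < N"
  defines "C \<equiv> \<lambda>\<omega>. chain_cost (\<lambda>v i. (sech (half_gap n \<beta> N (\<lambda>e. J e \<omega>) v i))\<^sup>2) ((i, False) # w)"
  shows "integrable M C" "expectation C \<le> 2 * T_s Q N (N - length w)"
proof -
  have C: "C = (\<lambda>\<omega>. chain_cost (\<lambda>v i. (sech (gap_var N v i \<omega>))\<^sup>2) ((i, False) # w))"
    by (simp add: C_def gap_var_def)
  have "Suc (N - length ((i, False) # w)) = N - length w" using w by simp
  then show "integrable M C" "expectation C \<le> 2 * T_s Q N (N - length w)"
    using chain_cost_expectation[of N "\<lambda>v i \<omega>. (sech (gap_var N v i \<omega>))\<^sup>2" "\<lambda>k. 2 * a_s Q k" "(i, False) # w"] w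
      integrable_costs(1) expectation_sech_gap
    unfolding C T_s_def sum_distrib_left by auto
qed

lemma expectation_bond_chain:
  assumes w: "addr n w" "i < n" "length w < N"
  defines "C \<equiv> \<lambda>\<omega>. chain_cost (\<lambda>v i. \<psi> (half_gap n \<beta> N (\<lambda>e. J e \<omega>) v i) + exp (-4 * half_max n \<beta> N (\<lambda>e. J e \<omega>) v i)) ((i, False) # w)"
  shows "integrable M C" "expectation C \<le> T_b F Q N (N - length w)"
proof -
  have C: "C = (\<lambda>\<omega>. chain_cost (\<lambda>v i. bond_cost N v i \<omega>) ((i, False) # w))"
    by (simp add: C_def bond_cost_def gap_var_def max_var_def)
  have "Suc (N - length ((i, False) # w)) = N - length w" using w by simp
  then show "integrable M C" "expectation C \<le> T_b F Q N (N - length w)"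
    using chain_cost_expectation[of N "\<lambda>v i \<omega>. bond_cost N v i \<omega>" "\<lambda>k. a_b F Q k" "(i, False) # w"] w
      integrable_bond_cost expectation_bond_cost
    unfolding C T_b_def by auto
qed

lemma profile_integrals_nonneg: "a_s Q k \<ge> 0" "a_b F Q k \<ge> 0" "S_N F k \<ge> 0" "P_N F k \<ge> 0"
proof -
  show "a_s Q k \<ge> 0" "S_N F k \<ge> 0" "P_N F k \<ge> 0"
    unfolding a_s_def S_N_def P_N_def set_lebesgue_integral_def
    by (intro Bochner_Integration.integral_nonneg; auto simp: indicator_def Q_nonneg F_nonneg)+
  show "a_b F Q k \<ge> 0"
    unfolding a_b_def deriv_psi set_lebesgue_integral_def
    by (intro add_nonneg_nonneg Bochner_Integration.integral_nonneg; auto simp: indicator_def Q_nonneg F_nonneg psi_decay_nonneg)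
qed

end

section \<open>The joint law of replicas and bonds, averaged over the disorder\<close>

definition outcomes :: "nat \<Rightarrow> nat \<Rightarrow> (spins \<times> spins \<times> address set) set" where
  "outcomes n N = configs (vertices n N []) start \<times> configs (vertices n N []) start \<times> Pow (edges n N [])"

lemma finite_outcomes [simp]: "finite (outcomes n N)"
  by (simp add: outcomes_def)

lemma set_replicas_bonds_outcomes:
  "\<beta> \<ge> 0 \<Longrightarrow> set_pmf (replicas_bonds n \<beta> N J) \<subseteq> outcomes n N"
proof
  fix r assume "\<beta> \<ge> 0" "r \<in> set_pmf (replicas_bonds n \<beta> N J)"
  then show "r \<in> outcomes n N"
    using set_replicas_bonds[of "fst r" "fst (snd r)" "snd (snd r)" n \<beta> N J]
    by (cases r) (auto simp: outcomes_def)
qed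

context iid_couplings
begin

abbreviation "law N \<omega> \<equiv> replicas_bonds n \<beta> N (\<lambda>e. J e \<omega>)"
abbreviation "gibbs N \<omega> \<equiv> gibbs_free n \<beta> N (\<lambda>e. J e \<omega>)"

lemma measurable_pmf_gibbs:
  "(\<lambda>\<omega>. pmf (gibbs N \<omega>) \<sigma>) \<in> borel_measurable M"
proof -
  have [measurable]: "(\<lambda>\<omega>. boltzmann \<beta> (edges n N []) (\<lambda>e. J e \<omega>) \<sigma>) \<in> borel_measurable M" for \<sigma>
    by (rule measurable_boltzmann) (rule measurable_coupling_edge, auto)
  have [measurable]: "(\<lambda>\<omega>. partition_sum n \<beta> N (\<lambda>e. J e \<omega>)) \<in> borel_measurable M"
    unfolding partition_sum_def by measurable
  show ?thesis unfolding pmf_gibbs_free by simp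
qed

lemma measurable_law:
  "(\<lambda>\<omega>. measure_pmf.prob (law N \<omega>) S) \<in> borel_measurable M"
proof -
  let ?V = "configs (vertices n N []) start"
  have p: "(\<lambda>\<omega>. blue_prob \<beta> (\<lambda>e. J e \<omega>) \<sigma> \<tau> e) \<in> borel_measurable M" if "e \<in> edges n N []" for \<sigma> \<tau> e
  proof -
    have [measurable]: "J e \<in> borel_measurable M" using measurable_coupling_edge[OF that] by simp
    show ?thesis unfolding blue_prob_def Let_def by measurable
  qed
  have b: "(\<lambda>\<omega>. measure_pmf.prob (blue_law \<beta> (edges n N []) (\<lambda>e. J e \<omega>) \<sigma> \<tau>) T) \<in> borel_measurable M" for \<sigma> \<tau> T
  proof -
    have "measure_pmf.prob (blue_law \<beta> (edges n N []) (\<lambda>e. J e \<omega>) \<sigma> \<tau>) T =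
        (\<Sum>b\<in>T \<inter> Pow (edges n N []). bond_weight \<beta> (edges n N []) (\<lambda>e. J e \<omega>) \<sigma> \<tau> b)" for \<omega>
    proof -
      have "measure_pmf.prob (blue_law \<beta> (edges n N []) (\<lambda>e. J e \<omega>) \<sigma> \<tau>) T =
          measure_pmf.prob (blue_law \<beta> (edges n N []) (\<lambda>e. J e \<omega>) \<sigma> \<tau>) (T \<inter> Pow (edges n N []))"
        by (rule prob_cong_support) (use set_blue_law in blast)
      then show ?thesis
        by (simp add: measure_measure_pmf_finite pmf_blue_law[OF _ \<beta>])
    qed
    moreover have "(\<lambda>\<omega>. bond_weight \<beta> (edges n N []) (\<lambda>e. J e \<omega>) \<sigma> \<tau> b) \<in> borel_measurable M" for b
      unfolding bond_weight_def
    proof (rule borel_measurable_prod)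
      fix e assume "e \<in> edges n N []"
      from p[OF this] show "(\<lambda>\<omega>. if e \<in> b then blue_prob \<beta> (\<lambda>e. J e \<omega>) \<sigma> \<tau> e else 1 - blue_prob \<beta> (\<lambda>e. J e \<omega>) \<sigma> \<tau> e)
          \<in> borel_measurable M" by simp
    qed
    ultimately show ?thesis by simp
  qed
  have eq: "measure_pmf.prob (law N \<omega>) S = (\<Sum>\<sigma>\<in>?V. \<Sum>\<tau>\<in>?V. pmf (gibbs N \<omega>) \<sigma> * pmf (gibbs N \<omega>) \<tau> *
      measure_pmf.prob (blue_law \<beta> (edges n N []) (\<lambda>e. J e \<omega>) \<sigma> \<tau>) {b. (\<sigma>, \<tau>, b) \<in> S})" for \<omega>
    unfolding replicas_bonds_prob
    by (subst expectation_pair_finite[of ?V ?V]) (use set_pole_gibbs[OF pole_gibbs_free, of n \<beta> N "\<lambda>e. J e \<omega>"] in auto)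
  show ?thesis unfolding eq
    by (intro borel_measurable_sum borel_measurable_times measurable_pmf_gibbs b)
qed

text \<open>There are uncountably many spin functions, but the kernel charges only the finitely many
  outcomes above, so its value on a measurable set is a finite sum over sections of that set.\<close>

lemma measurable_joint_kernel:
  "(\<lambda>\<omega>. distr (measure_pmf (law N \<omega>)) (M \<Otimes>\<^sub>M count_space UNIV) (Pair \<omega>))
     \<in> M \<rightarrow>\<^sub>M subprob_algebra (M \<Otimes>\<^sub>M count_space UNIV)"
proof (rule measurable_subprob_algebra)
  fix \<omega> assume \<omega>: "\<omega> \<in> space M"
  have m: "Pair \<omega> \<in> measure_pmf (law N \<omega>) \<rightarrow>\<^sub>M M \<Otimes>\<^sub>M count_space UNIV"
    by (subst measurable_pmf_measure1) (rule Pi_I, simp add: space_pair_measure \<omega>)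
  have "prob_space (distr (measure_pmf (law N \<omega>)) (M \<Otimes>\<^sub>M count_space UNIV) (Pair \<omega>))"
    by (rule measure_pmf.prob_space_distr[OF m])
  then show "subprob_space (distr (measure_pmf (law N \<omega>)) (M \<Otimes>\<^sub>M count_space UNIV) (Pair \<omega>))"
    by (rule prob_space_imp_subprob_space)
next
  fix A assume A: "A \<in> sets (M \<Otimes>\<^sub>M count_space (UNIV :: (spins \<times> spins \<times> address set) set))"
  have "emeasure (distr (measure_pmf (law N \<omega>)) (M \<Otimes>\<^sub>M count_space UNIV) (Pair \<omega>)) A =
      ennreal (\<Sum>r\<in>outcomes n N. measure_pmf.prob (law N \<omega>) {r} * indicator A (\<omega>, r))" if \<omega>: "\<omega> \<in> space M" for \<omega>
  proof -
    have "emeasure (distr (measure_pmf (law N \<omega>)) (M \<Otimes>\<^sub>M count_space UNIV) (Pair \<omega>)) A =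
        emeasure (measure_pmf (law N \<omega>)) (Pair \<omega> -` A)"
      using A \<omega> by (subst emeasure_distr) (auto simp: space_pair_measure)
    also have "\<dots> = ennreal (measure_pmf.prob (law N \<omega>) (Pair \<omega> -` A))"
      by (simp add: measure_pmf.emeasure_eq_measure)
    also have "measure_pmf.prob (law N \<omega>) (Pair \<omega> -` A) = measure_pmf.prob (law N \<omega>) (Pair \<omega> -` A \<inter> outcomes n N)"
      by (rule prob_cong_support) (use set_replicas_bonds_outcomes[OF \<beta>] in blast)
    also have "\<dots> = (\<Sum>r\<in>Pair \<omega> -` A \<inter> outcomes n N. pmf (law N \<omega>) r)"
      by (rule measure_measure_pmf_finite) simp
    also have "\<dots> = (\<Sum>r\<in>outcomes n N. measure_pmf.prob (law N \<omega>) {r} * indicator A (\<omega>, r))"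
      by (rule sum.mono_neutral_cong_left) (auto simp: indicator_def measure_pmf_single)
    finally show ?thesis .
  qed
  moreover have "(\<lambda>\<omega>. ennreal (\<Sum>r\<in>outcomes n N. measure_pmf.prob (law N \<omega>) {r} * indicator A (\<omega>, r))) \<in> borel_measurable M"
  proof (intro measurable_compose[OF _ measurable_ennreal] borel_measurable_sum borel_measurable_times measurable_law)
    fix r :: "spins \<times> spins \<times> address set"
    have "(\<lambda>\<omega>. (\<omega>, r)) \<in> M \<rightarrow>\<^sub>M M \<Otimes>\<^sub>M count_space UNIV" by simp
    then show "(\<lambda>\<omega>. indicator A (\<omega>, r)) \<in> borel_measurable M"
      by (rule measurable_compose) (use A in simp)
  qed
  ultimately show "(\<lambda>\<omega>. emeasure (distr (measure_pmf (law N \<omega>)) (M \<Otimes>\<^sub>M count_space UNIV) (Pair \<omega>)) A) \<in> borel_measurable M"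
    by (subst measurable_cong) auto
qed simp

lemma sets_joint_law: "sets (joint_law M n \<beta> J N) = sets (M \<Otimes>\<^sub>M count_space UNIV)"
  unfolding joint_law_def by (rule sets_bind) (auto simp: not_empty)

lemma emeasure_joint_law_snd:
  "emeasure (distr (joint_law M n \<beta> J N) (count_space UNIV) snd) S =
    ennreal (expectation (\<lambda>\<omega>. measure_pmf.prob (law N \<omega>) S))"
proof -
  have m: "snd \<in> joint_law M n \<beta> J N \<rightarrow>\<^sub>M count_space UNIV"
    unfolding measurable_cong_sets[OF sets_joint_law refl] by simp
  have sp: "space (joint_law M n \<beta> J N) = space M \<times> UNIV"
    using sets_eq_imp_space_eq[OF sets_joint_law] by (simp add: space_pair_measure)
  have MS: "space M \<times> S \<in> sets (M \<Otimes>\<^sub>M count_space UNIV)" by simp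
  have "emeasure (distr (joint_law M n \<beta> J N) (count_space UNIV) snd) S = emeasure (joint_law M n \<beta> J N) (space M \<times> S)"
    by (subst emeasure_distr[OF m]) (auto simp: sp intro!: arg_cong[where f = "emeasure _"])
  also have "\<dots> = (\<integral>\<^sup>+\<omega>. emeasure (distr (measure_pmf (law N \<omega>)) (M \<Otimes>\<^sub>M count_space UNIV) (Pair \<omega>)) (space M \<times> S) \<partial>M)"
    unfolding joint_law_def by (rule emeasure_bind[OF not_empty measurable_joint_kernel MS])
  also have "\<dots> = (\<integral>\<^sup>+\<omega>. ennreal (measure_pmf.prob (law N \<omega>) S) \<partial>M)"
  proof (rule nn_integral_cong)
    fix \<omega> assume \<omega>: "\<omega> \<in> space M"
    then have "Pair \<omega> -` (space M \<times> S) = S" by auto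
    then show "emeasure (distr (measure_pmf (law N \<omega>)) (M \<Otimes>\<^sub>M count_space UNIV) (Pair \<omega>)) (space M \<times> S) =
        ennreal (measure_pmf.prob (law N \<omega>) S)"
      using \<omega> MS by (subst emeasure_distr) (auto simp: space_pair_measure measure_pmf.emeasure_eq_measure)
  qed
  also have "\<dots> = ennreal (expectation (\<lambda>\<omega>. measure_pmf.prob (law N \<omega>) S))"
    by (rule nn_integral_eq_integral)
       (auto intro!: integrable_const_bound[where B = 1] measurable_law)
  finally show ?thesis .
qed

text \<open>None of the events and observables in question involves the disorder, so the joint law may be
  replaced by its marginal, a discrete distribution with finite support.\<close>

definition averaged :: "nat \<Rightarrow> (spins \<times> spins \<times> address set) pmf" where
  "averaged N = Abs_pmf (distr (joint_law M n \<beta> J N) (count_space UNIV) snd)"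

lemma measure_averaged: "measure_pmf (averaged N) = distr (joint_law M n \<beta> J N) (count_space UNIV) snd"
  unfolding averaged_def
proof (rule Abs_pmf_inverse, intro CollectI conjI)
  let ?L = "distr (joint_law M n \<beta> J N) (count_space UNIV) snd"
  show 1: "prob_space ?L"
    by (rule prob_spaceI) (use emeasure_joint_law_snd[of N UNIV] in \<open>simp add: prob_space\<close>)
  show "sets ?L = UNIV" by simp
  \<comment> \<open>\<open>Z\<close> contains all points without mass: almost every outcome is in a finite set, and only
    finitely many points of that set have no mass.\<close>
  define Z where "Z = {r \<in> outcomes n N. measure ?L {r} = 0} \<union> (- outcomes n N)"
  have "emeasure ?L (- outcomes n N) = 0"
  proof -
    have "measure_pmf.prob (law N \<omega>) (- outcomes n N) = 0" for \<omega>
      using set_replicas_bonds_outcomes[OF \<beta>] by (force simp: measure_pmf_zero_iff)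
    then show ?thesis by (simp add: emeasure_joint_law_snd)
  qed
  moreover have "emeasure ?L {r \<in> outcomes n N. measure ?L {r} = 0} = 0"
  proof -
    have "emeasure ?L {r \<in> outcomes n N. measure ?L {r} = 0} =
        (\<Sum>r\<in>{r \<in> outcomes n N. measure ?L {r} = 0}. emeasure ?L {r})"
      by (rule emeasure_eq_sum_singleton) auto
    also have "\<dots> = 0"
      using 1 by (intro sum.neutral) (auto simp: finite_measure.emeasure_eq_measure prob_space_def)
    finally show ?thesis .
  qed
  ultimately have "Z \<in> null_sets ?L"
    unfolding Z_def by (intro null_sets.Un) (auto simp: null_sets_def)
  then show "AE r in ?L. measure ?L {r} \<noteq> 0"
    by (rule AE_I') (auto simp: Z_def)
qed

lemma prob_averaged: "measure_pmf.prob (averaged N) S = expectation (\<lambda>\<omega>. measure_pmf.prob (law N \<omega>) S)"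
  unfolding measure_averaged measure_def emeasure_joint_law_snd
  by (simp add: Bochner_Integration.integral_nonneg)

lemma measurable_joint_law_snd: "snd \<in> joint_law M n \<beta> J N \<rightarrow>\<^sub>M count_space UNIV"
  unfolding measurable_cong_sets[OF sets_joint_law refl] by simp

lemma prob_joint_law:
  "\<P>((\<omega>, \<sigma>, \<tau>, b) in joint_law M n \<beta> J N. R \<sigma> \<tau> b) = measure_pmf.prob (averaged N) {(\<sigma>, \<tau>, b). R \<sigma> \<tau> b}"
  unfolding measure_averaged
  by (subst measure_distr[OF measurable_joint_law_snd]) (auto intro!: arg_cong[where f = "measure _"])

lemma integral_joint_law:
  fixes f :: "spins \<Rightarrow> spins \<Rightarrow> address set \<Rightarrow> real"
  shows "(\<integral>(\<omega>, \<sigma>, \<tau>, b). f \<sigma> \<tau> b \<partial>joint_law M n \<beta> J N) =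
    measure_pmf.expectation (averaged N) (\<lambda>(\<sigma>, \<tau>, b). f \<sigma> \<tau> b)"
  unfolding measure_averaged
  by (subst integral_distr[OF measurable_joint_law_snd]) (auto simp: case_prod_unfold)

lemma set_averaged:
  assumes "r \<in> set_pmf (averaged N)"
  obtains \<omega> where "r \<in> set_pmf (law N \<omega>)"
proof -
  have "\<exists>\<omega>. r \<in> set_pmf (law N \<omega>)"
  proof (rule ccontr)
    assume "\<nexists>\<omega>. r \<in> set_pmf (law N \<omega>)"
    then have "measure_pmf.prob (law N \<omega>) {r} = 0" for \<omega> by (simp add: measure_pmf_zero_iff)
    then have "measure_pmf.prob (averaged N) {r} = 0" by (simp add: prob_averaged)
    with assms show False by (simp add: measure_pmf_zero_iff)
  qed
  then show ?thesis using that by blast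
qed

lemma averaged_support:
  assumes "(\<sigma>, \<tau>, b) \<in> set_pmf (averaged N)"
  shows "\<sigma> \<in> configs (vertices n N []) start" "\<tau> \<in> configs (vertices n N []) start" "b \<subseteq> edges n N []"
    and "\<And>e. e \<in> b \<Longrightarrow> \<sigma> (fst (poles e)) * \<tau> (fst (poles e)) = \<sigma> (snd (poles e)) * \<tau> (snd (poles e))"
  using set_averaged[OF assms] set_replicas_bonds[OF _ \<beta>] by metis+

lemma finite_averaged: "finite (set_pmf (averaged N))"
proof (rule finite_subset)
  show "set_pmf (averaged N) \<subseteq> outcomes n N"
    using averaged_support by (fastforce simp: outcomes_def)
qed simp

end

context profiled_couplings
begin

lemma averaged_poles_disconnected:
  "measure_pmf.prob (averaged N) {(\<sigma>, \<tau>, b). \<not> connected_by b PoleA PoleB} \<le> P_N F N"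
proof -
  have \<xi>: "\<xi> n \<beta> J N = eff N []" by (simp add: fun_eq_iff \<xi>_def eff_def)
  have [measurable]: "\<xi> n \<beta> J N \<in> borel_measurable M" unfolding \<xi> by (rule measurable_eff) simp
  have tanh: "\<bar>1 - tanh \<bar>y\<bar>\<bar> \<le> 1" for y :: real
    using tanh_real_bounds[of "\<bar>y\<bar>"] tanh_real_nonneg_iff[of "\<bar>y\<bar>"] by (auto simp del: tanh_real_abs)
  have "measure_pmf.prob (averaged N) {(\<sigma>, \<tau>, b). \<not> connected_by b PoleA PoleB} \<le>
      expectation (\<lambda>\<omega>. 1 - tanh \<bar>\<xi> n \<beta> J N \<omega>\<bar>)"
    unfolding prob_averaged
  proof (rule integral_mono)
    show "integrable M (\<lambda>\<omega>. measure_pmf.prob (law N \<omega>) {(\<sigma>, \<tau>, b). \<not> connected_by b PoleA PoleB})"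
      by (intro integrable_const_bound[where B = 1] measurable_law) simp
    show "integrable M (\<lambda>\<omega>. 1 - tanh \<bar>\<xi> n \<beta> J N \<omega>\<bar>)"
      by (rule integrable_bounded_var[where c = 1]) (measurable, rule tanh)
    show "measure_pmf.prob (law N \<omega>) {(\<sigma>, \<tau>, b). \<not> connected_by b PoleA PoleB} \<le> 1 - tanh \<bar>\<xi> n \<beta> J N \<omega>\<bar>" for \<omega>
      using poles_disconnected_prob[OF \<beta>] by (simp add: \<xi>_def)
  qed
  also have "\<dots> \<le> P_N F N" by (rule P_N_bound)
  finally show ?thesis .
qed

lemma averaged_midpoint_off:
  assumes w: "addr n w" "i < n" "length w < N"
  shows "measure_pmf.prob (averaged N) {(\<sigma>, \<tau>, b). Mid w i \<notin> cluster b PoleA \<union> cluster b PoleB} \<le>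
    T_b F Q N (N - length w)"
proof -
  let ?C = "\<lambda>\<omega>. chain_cost (\<lambda>v i. \<psi> (half_gap n \<beta> N (\<lambda>e. J e \<omega>) v i) + exp (-4 * half_max n \<beta> N (\<lambda>e. J e \<omega>) v i)) ((i, False) # w)"
  have "measure_pmf.prob (averaged N) {(\<sigma>, \<tau>, b). Mid w i \<notin> cluster b PoleA \<union> cluster b PoleB} \<le> expectation ?C"
    unfolding prob_averaged
  proof (rule integral_mono)
    show "integrable M (\<lambda>\<omega>. measure_pmf.prob (law N \<omega>) {(\<sigma>, \<tau>, b). Mid w i \<notin> cluster b PoleA \<union> cluster b PoleB})"
      by (intro integrable_const_bound[where B = 1] measurable_law) simp
    show "integrable M ?C" by (rule expectation_bond_chain(1)[OF w])
    show "measure_pmf.prob (law N \<omega>) {(\<sigma>, \<tau>, b). Mid w i \<notin> cluster b PoleA \<union> cluster b PoleB} \<le> ?C \<omega>" for \<omega>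
      by (rule order_trans[OF _ connection_chain[OF \<beta>]])
         (use w in \<open>auto intro!: measure_pmf.finite_measure_mono\<close>)
  qed
  also have "\<dots> \<le> T_b F Q N (N - length w)" by (rule expectation_bond_chain(2)[OF w])
  finally show ?thesis .
qed

lemma averaged_vertex_off:
  assumes "z \<in> vertices n N []"
  shows "measure_pmf.prob (averaged N) {(\<sigma>, \<tau>, b). z \<notin> cluster b PoleA \<union> cluster b PoleB} \<le> T_b_at F Q N z"
proof (cases "z \<in> {PoleA, PoleB}")
  case True
  then have "{(\<sigma> :: spins, \<tau> :: spins, b). z \<notin> cluster b PoleA \<union> cluster b PoleB} = {}" by (auto simp: cluster_def)
  then have "measure_pmf.prob (averaged N) {(\<sigma>, \<tau>, b). z \<notin> cluster b PoleA \<union> cluster b PoleB} = 0"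
    by (simp only: measure_empty)
  then show ?thesis using True by (simp add: T_b_at_def)
next
  case False
  then obtain w i where z: "z = Mid w i" "addr n w" "i < n" "length w < N"
    using assms by (auto simp: vertices_def inner_vertices_eq)
  then show ?thesis using averaged_midpoint_off[of w i N] by (simp add: T_b_at_def)
qed

end

section \<open>Clusters\<close>

lemma cluster_subset_vertices:
  assumes "b \<subseteq> edges n N []" "x \<in> vertices n N []"
  shows "cluster b x \<subseteq> vertices n N []"
  using assms edge_ends_in_vertices by (intro cluster_subset) blast+

lemma mem_cluster_self [simp]: "x \<in> cluster b x"
  by (simp add: cluster_def)

lemma cluster_eq: "y \<in> cluster b x \<Longrightarrow> cluster b y = cluster b x"
  unfolding cluster_def using connected_by_sym connected_by_trans by blast

lemma clusters_subset:
  "b \<subseteq> edges n N [] \<Longrightarrow> C \<in> clusters n N b \<Longrightarrow> C \<subseteq> vertices n N []"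
  by (auto simp: clusters_def dest: cluster_subset_vertices[THEN subsetD, rotated 2])

lemma finite_clusters [simp]: "finite (clusters n N b)"
  by (simp add: clusters_def)

lemma card_cluster_le_max_off:
  assumes "C \<in> clusters n N b" "PoleA \<notin> C"
  shows "card C \<le> max_off_cluster n N b"
  unfolding max_off_cluster_def
proof (rule Max_ge)
  show "finite (insert 0 {card C |C. C \<in> clusters n N b \<and> PoleA \<notin> C})"
    by (rule finite_subset[of _ "insert 0 (card ` clusters n N b)"]) auto
qed (use assms in auto)

lemma max_off_cluster_le:
  assumes "\<And>C. C \<in> clusters n N b \<Longrightarrow> PoleA \<notin> C \<Longrightarrow> card C \<le> m"
  shows "max_off_cluster n N b \<le> m"
  unfolding max_off_cluster_def
proof (rule Max.boundedI)
  show "finite (insert 0 {card C |C. C \<in> clusters n N b \<and> PoleA \<notin> C})"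
    by (rule finite_subset[of _ "insert 0 (card ` clusters n N b)"]) auto
qed (use assms in auto)

text \<open>The vertices of level above \<open>N - m\<close> cut the diamond into the interiors of the \<open>(2 n) ^ m\<close>
  sub-diamonds of scale \<open>N - m\<close>.\<close>

lemma card_edges: "card (edges n m []) = (2 * n) ^ m"
proof -
  have "edges n m [] = {u. set u \<subseteq> {..<n} \<times> UNIV \<and> length u = m}"
    by (auto simp: edges_eq addr_def)
  then show ?thesis
    using card_lists_length_eq[of "{..<n} \<times> (UNIV :: bool set)" m]
    by (simp add: card_cartesian_product mult.commute)
qed

lemma inner_vertices_image: "inner_vertices n k w = embed_vertex w ` inner_vertices n k []"
  by (force simp: inner_vertices_eq)

lemma card_inner_vertices: "card (inner_vertices n k w) = card (inner_vertices n k [])"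
  unfolding inner_vertices_image[of n k w]
  by (rule card_image) (auto simp: inj_on_def inner_vertices_eq)

lemma blocks_fit:
  assumes "m \<le> N"
  shows "(2 * n) ^ m * card (inner_vertices n (N - m) []) \<le> card (vertices n N [])"
proof -
  let ?U = "\<lambda>w. inner_vertices n (N - m) w"
  have "card (\<Union>w\<in>edges n m []. ?U w) = (\<Sum>w\<in>edges n m []. card (?U w))"
  proof (rule card_UN_disjoint)
    show "\<forall>w\<in>edges n m []. \<forall>w'\<in>edges n m []. w \<noteq> w' \<longrightarrow> ?U w \<inter> ?U w' = {}"
    proof (intro ballI impI, rule ccontr)
      fix w w' assume w: "w \<in> edges n m []" "w' \<in> edges n m []" "w \<noteq> w'" "?U w \<inter> ?U w' \<noteq> {}"
      then obtain u u' where "u @ w = u' @ w'" by (auto simp: inner_vertices_eq)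
      moreover have "length w = length w'" using w by (auto simp: edges_eq)
      ultimately show False using w(3) by simp
    qed
  qed auto
  also have "\<dots> = (\<Sum>w\<in>edges n m []. card (inner_vertices n (N - m) []))"
    by (rule sum.cong[OF refl card_inner_vertices])
  also have "\<dots> = (2 * n) ^ m * card (inner_vertices n (N - m) [])"
    by (simp add: card_edges)
  finally have "(2 * n) ^ m * card (inner_vertices n (N - m) []) = card (\<Union>w\<in>edges n m []. ?U w)" ..
  also have "\<dots> \<le> card (vertices n N [])"
  proof (rule card_mono)
    show "(\<Union>w\<in>edges n m []. ?U w) \<subseteq> vertices n N []"
      using assms by (auto simp: edges_eq inner_vertices_eq vertices_def)
  qed simp
  finally show ?thesis .
qed

text \<open>A blue path leaving the interior of one of these blocks passes through a pole of the block,
  which is a pole of the diamond or a vertex of level above \<open>N - m\<close> and so belongs to the cluster of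
  \<open>A\<close>. Clusters avoiding \<open>A\<close> are therefore confined to the interior of a block.\<close>

lemma off_cluster_small:
  assumes b: "b \<subseteq> edges n N []" and m: "m \<le> N"
    and AB: "connected_by b PoleA PoleB"
    and skeleton: "\<And>z. z \<in> inner_vertices n m [] \<Longrightarrow> z \<in> cluster b PoleA \<union> cluster b PoleB"
    and C: "C \<in> clusters n N b" "PoleA \<notin> C"
  shows "(2 * n) ^ m * card C \<le> card (vertices n N [])"
proof -
  obtain y where y: "y \<in> vertices n N []" "C = cluster b y" using C by (auto simp: clusters_def)
  have CB: "cluster b PoleB = cluster b PoleA"
    using AB by (intro cluster_eq) (simp add: cluster_def)
  have off: "z \<notin> cluster b PoleA" if "z \<in> C" for z
  proof
    assume "z \<in> cluster b PoleA"
    then have "cluster b z = cluster b PoleA" by (rule cluster_eq)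
    moreover have "cluster b z = C" using that y cluster_eq by blast
    ultimately show False using C(2) by auto
  qed
  have skel: "z \<notin> C" if "z \<in> vertices n m []" for z
    using that off skeleton[of z] CB AB C(2) by (auto simp: vertices_def cluster_def)
  have yC: "y \<in> C" using y by simp
  then have "y \<notin> vertices n m []" using skel by blast
  then obtain u i where u: "y = Mid u i" "length u < N" "m \<le> length u" "addr n u" "i < n"
    using y(1) by (fastforce simp: vertices_def inner_vertices_eq)
  define w where "w = drop (length u - m) u"
  define t where "t = take (length u - m) u"
  have tw: "u = t @ w" "length w = m" "addr n t" "addr n w"
    using u by (auto simp: t_def w_def addr_def dest: in_set_takeD in_set_dropD)
  let ?U = "inner_vertices n (N - m) w"
  have yU: "y \<in> ?U" using u tw by (auto simp: inner_vertices_eq)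
  have step: "z' \<in> ?U" if e: "e \<in> b" and z: "z \<in> ?U" "z \<in> {fst (poles e), snd (poles e)}"
    and z': "z' \<in> {fst (poles e), snd (poles e)}" "z' \<in> C" for e z z'
  proof -
    have "e \<in> edges n (N - m) w"
    proof (rule ccontr)
      assume "e \<notin> edges n (N - m) w"
      then have "e \<in> edges n N [] - edges n (N - m) w" using e b by auto
      from edge_off_inner[OF this] show False using tw m z by auto
    qed
    then have "z' \<in> vertices n (N - m) w" using z' edge_ends_in_vertices by auto
    moreover have "fst (poles w) \<notin> C" "snd (poles w) \<notin> C"
      using skel poles_in_diamond[of n w m] tw by auto
    ultimately show ?thesis using z'(2) by (auto simp: vertices_def)
  qed
  have "C \<subseteq> ?U"
  proof
    fix z assume "z \<in> C"
    then have "(blue_adjacent b)\<^sup>*\<^sup>* y z" by (simp add: y(2) cluster_def connected_by_def)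
    then show "z \<in> ?U"
    proof induction
      case base
      show ?case by (rule yU)
    next
      case (step z z')
      then obtain e where e: "e \<in> b" "poles e = (z, z') \<or> poles e = (z', z)"
        by (auto simp: blue_adjacent_def)
      have "z' \<in> C" using step.hyps by (auto simp: y(2) cluster_def connected_by_def)
      then show ?case using \<open>\<lbrakk>e \<in> b; z \<in> ?U; z \<in> {fst (poles e), snd (poles e)};
          z' \<in> {fst (poles e), snd (poles e)}; z' \<in> C\<rbrakk> \<Longrightarrow> z' \<in> ?U\<close> e step.IH by auto
    qed
  qed
  then have "card C \<le> card (inner_vertices n (N - m) [])"
    using card_mono[of ?U C] card_inner_vertices[of n "N - m" w] by simp
  then have "(2 * n) ^ m * card C \<le> (2 * n) ^ m * card (inner_vertices n (N - m) [])" by simp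
  then show ?thesis using blocks_fit[OF m, of n] by linarith
qed

lemma overlap_const_on_cluster:
  assumes "\<And>e. e \<in> b \<Longrightarrow> \<sigma> (fst (poles e)) * \<tau> (fst (poles e)) = \<sigma> (snd (poles e)) * \<tau> (snd (poles e))"
    and "y \<in> cluster b x"
  shows "\<sigma> y * \<tau> y = \<sigma> x * (\<tau> x :: real)"
proof -
  have "(blue_adjacent b)\<^sup>*\<^sup>* x y" using assms(2) by (simp add: cluster_def connected_by_def)
  then show ?thesis
  proof induction
    case (step y z)
    then obtain e where "e \<in> b" "poles e = (y, z) \<or> poles e = (z, y)" by (auto simp: blue_adjacent_def)
    then show ?case using assms(1)[of e] step.IH by auto
  qed simp
qed

lemma largest_cluster_props:
  assumes b: "b \<subseteq> edges n N []"
  shows "largest_cluster n N s \<sigma> \<tau> b = {} \<or>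
      (largest_cluster n N s \<sigma> \<tau> b \<in> clusters n N b \<and> (\<forall>y\<in>largest_cluster n N s \<sigma> \<tau> b. \<sigma> y * \<tau> y = s))"
    and "C \<in> clusters n N b \<Longrightarrow> \<forall>y\<in>C. \<sigma> y * \<tau> y = s \<Longrightarrow> card C \<le> card (largest_cluster n N s \<sigma> \<tau> b)"
proof -
  define P where "P = (\<lambda>C. C \<in> clusters n N b \<and> (\<forall>y\<in>C. \<sigma> y * \<tau> y = s))"
  have L: "largest_cluster n N s \<sigma> \<tau> b = (if \<exists>C. P C then arg_max card P else {})"
    unfolding largest_cluster_def P_def Let_def by (rule refl)
  have bound: "\<forall>C. P C \<longrightarrow> card C < Suc (card (vertices n N []))"
    using clusters_subset[OF b] card_mono[OF finite_vertices] by (auto simp: P_def less_Suc_eq_le)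
  have max: "P (arg_max card P) \<and> (\<forall>C. P C \<longrightarrow> card C \<le> card (arg_max card P))" if "P C" for C
    by (rule arg_max_nat_lemma[OF that bound])
  show "largest_cluster n N s \<sigma> \<tau> b = {} \<or>
      (largest_cluster n N s \<sigma> \<tau> b \<in> clusters n N b \<and> (\<forall>y\<in>largest_cluster n N s \<sigma> \<tau> b. \<sigma> y * \<tau> y = s))"
  proof -
    have "largest_cluster n N s \<sigma> \<tau> b = {} \<or> P (largest_cluster n N s \<sigma> \<tau> b)"
      unfolding L using max by auto
    then show ?thesis unfolding P_def by blast
  qed
  show "card C \<le> card (largest_cluster n N s \<sigma> \<tau> b)" if "C \<in> clusters n N b" "\<forall>y\<in>C. \<sigma> y * \<tau> y = s"
  proof -
    have "P C" using that by (simp add: P_def)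
    then show ?thesis using max unfolding L by auto
  qed
qed

text \<open>The overlap is constant on the cluster of \<open>A\<close>. So the largest cluster of this overlap is at
  least as large, and the largest cluster of the opposite overlap avoids \<open>A\<close>.\<close>

lemma imbalance_ge:
  assumes b: "b \<subseteq> edges n N []"
    and q: "\<And>e. e \<in> b \<Longrightarrow> \<sigma> (fst (poles e)) * \<tau> (fst (poles e)) = \<sigma> (snd (poles e)) * \<tau> (snd (poles e))"
    and A: "\<sigma> PoleA \<in> {-1, 1}" "\<tau> PoleA \<in> {-1, 1}"
  defines "V \<equiv> real (card (vertices n N []))"
  shows "real (card (cluster b PoleA)) - real (max_off_cluster n N b) \<le> \<bar>imbalance n N \<sigma> \<tau> b\<bar> * V"
    and "2 * real (card (cluster b PoleA)) - V \<le> \<bar>imbalance n N \<sigma> \<tau> b\<bar> * V"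
proof -
  define s where "s = \<sigma> PoleA * \<tau> PoleA"
  have s: "s \<in> {-1, 1}" using A by (auto simp: s_def)
  let ?L = "\<lambda>s. largest_cluster n N s \<sigma> \<tau> b"
  have CA: "cluster b PoleA \<in> clusters n N b" by (simp add: clusters_def)
  have ge: "card (cluster b PoleA) \<le> card (?L s)"
    using overlap_const_on_cluster[OF q] CA by (intro largest_cluster_props(2)[OF b]) (auto simp: s_def)
  have other: "?L (-s) = {} \<or> (?L (-s) \<in> clusters n N b \<and> (\<forall>y\<in>?L (-s). \<sigma> y * \<tau> y = - s))"
    by (rule largest_cluster_props(1)[OF b])
  have "PoleA \<notin> ?L (-s)" using other s by (auto simp: s_def)
  then have le: "card (?L (-s)) \<le> max_off_cluster n N b"
    using other card_cluster_le_max_off by auto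
  have own: "?L s = {} \<or> (?L s \<in> clusters n N b \<and> (\<forall>y\<in>?L s. \<sigma> y * \<tau> y = s))"
    by (rule largest_cluster_props(1)[OF b])
  have sub: "?L s \<subseteq> vertices n N []" "?L (-s) \<subseteq> vertices n N []"
    using own other clusters_subset[OF b] by auto
  have disj: "?L s \<inter> ?L (-s) = {}" using own other s by fastforce
  have "card (?L s) + card (?L (-s)) \<le> card (vertices n N [])"
    using sub disj card_mono[of "vertices n N []" "?L s \<union> ?L (-s)"]
      card_Un_disjoint[of "?L s" "?L (-s)"] finite_subset[OF _ finite_vertices] by auto
  then have sum: "real (card (?L s)) + real (card (?L (-s))) \<le> V" by (simp add: V_def)
  have V: "V > 0" by (auto simp: V_def vertices_def card_gt_0_iff)
  have "\<bar>imbalance n N \<sigma> \<tau> b\<bar> * V = \<bar>real (card (?L 1)) - real (card (?L (-1)))\<bar>"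
    using V unfolding imbalance_def V_def[symmetric] by simp
  also have "\<dots> \<ge> real (card (?L s)) - real (card (?L (-s)))" using s by auto
  finally have I: "real (card (?L s)) - real (card (?L (-s))) \<le> \<bar>imbalance n N \<sigma> \<tau> b\<bar> * V" .
  show "real (card (cluster b PoleA)) - real (max_off_cluster n N b) \<le> \<bar>imbalance n N \<sigma> \<tau> b\<bar> * V"
    using I ge le by linarith
  show "2 * real (card (cluster b PoleA)) - V \<le> \<bar>imbalance n N \<sigma> \<tau> b\<bar> * V"
    using I ge sum by linarith
qed

definition off_count :: "nat \<Rightarrow> nat \<Rightarrow> address set \<Rightarrow> nat" where
  "off_count n N b = card {z \<in> vertices n N []. z \<notin> cluster b PoleA \<union> cluster b PoleB}"

lemma card_cluster_pole:
  assumes "b \<subseteq> edges n N []" "connected_by b PoleA PoleB"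
  shows "card (cluster b PoleA) + off_count n N b = card (vertices n N [])"
proof -
  have CB: "cluster b PoleB = cluster b PoleA"
    using assms by (intro cluster_eq) (simp add: cluster_def)
  have sub: "cluster b PoleA \<subseteq> vertices n N []"
    using cluster_subset_vertices[OF assms(1)] by simp
  have "off_count n N b = card (vertices n N [] - cluster b PoleA)"
    unfolding off_count_def CB by (auto intro!: arg_cong[where f = card])
  then show ?thesis
    using card_Diff_subset[OF finite_subset[OF sub] sub] card_mono[OF _ sub] by simp
qed

lemma real_off_count: "real (off_count n N b) = (\<Sum>z\<in>vertices n N []. indicator {b. z \<notin> cluster b PoleA \<union> cluster b PoleB} b)"
proof -
  have "real (off_count n N b) = (\<Sum>z\<in>{z \<in> vertices n N []. z \<notin> cluster b PoleA \<union> cluster b PoleB}. 1)"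
    by (simp add: off_count_def)
  also have "\<dots> = (\<Sum>z\<in>vertices n N []. indicator {b. z \<notin> cluster b PoleA \<union> cluster b PoleB} b)"
    by (rule sum.mono_neutral_cong_left) (auto simp: indicator_def)
  finally show ?thesis .
qed

section \<open>Moment inequalities\<close>

lemma (in prob_space) square_expectation_le:
  fixes X :: "'a \<Rightarrow> real"
  assumes "X \<in> borel_measurable M" and "\<And>\<omega>. \<omega> \<in> space M \<Longrightarrow> \<bar>X \<omega>\<bar> \<le> c"
  shows "(expectation X)\<^sup>2 \<le> expectation (\<lambda>\<omega>. (X \<omega>)\<^sup>2)"
proof -
  have "integrable M X" using assms by (intro integrable_const_bound[where B = c]) auto
  moreover have "integrable M (\<lambda>\<omega>. (X \<omega>)\<^sup>2)"
  proof (intro integrable_const_bound[where B = "c\<^sup>2"] AE_I2 borel_measurable_power assms(1))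
    fix \<omega> assume "\<omega> \<in> space M"
    then have "\<bar>X \<omega>\<bar>\<^sup>2 \<le> c\<^sup>2" using assms(2) by (intro power_mono) auto
    then show "norm ((X \<omega>)\<^sup>2) \<le> c\<^sup>2" by simp
  qed
  ultimately show ?thesis using variance_eq[of X] variance_positive[of X] by simp
qed

lemma square_expectation_pmf_le:
  fixes f :: "'a \<Rightarrow> real"
  assumes "finite (set_pmf p)"
  shows "(measure_pmf.expectation p f)\<^sup>2 \<le> measure_pmf.expectation p (\<lambda>x. (f x)\<^sup>2)"
proof -
  have "measure_pmf.expectation p (\<lambda>x. (f x - measure_pmf.expectation p f)\<^sup>2) =
      measure_pmf.expectation p (\<lambda>x. (f x)\<^sup>2) - (measure_pmf.expectation p f)\<^sup>2"
    by (rule measure_pmf.variance_eq) (rule integrable_measure_pmf_finite[OF assms])+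
  moreover have "0 \<le> measure_pmf.expectation p (\<lambda>x. (f x - measure_pmf.expectation p f)\<^sup>2)"
    by (intro Bochner_Integration.integral_nonneg) simp
  ultimately show ?thesis by simp
qed

lemma expectation_pmf_mono:
  fixes f g :: "'a \<Rightarrow> real"
  assumes "finite (set_pmf p)" "\<And>x. x \<in> set_pmf p \<Longrightarrow> f x \<le> g x"
  shows "measure_pmf.expectation p f \<le> measure_pmf.expectation p g"
  using assms by (intro integral_mono_AE integrable_measure_pmf_finite) (auto simp: AE_measure_pmf_iff)

section \<open>Gibbs means averaged over the disorder\<close>

abbreviation (input) "pole_start sA sB \<equiv> (\<lambda>_. undefined)(PoleA := sA, PoleB := sB) :: spins"

lemma expectation_gibbs_fixed:
  fixes f :: "spins \<Rightarrow> real"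
  assumes s: "s \<in> {-1, 1}" "s' \<in> {-1, 1}"
  shows "measure_pmf.expectation (gibbs_fixed n \<beta> N J s s') f =
    (\<Sum>\<rho>\<in>configs (inner_vertices n N []) (pole_start s s'). boltzmann \<beta> (edges n N []) J \<rho> * f \<rho>) /
    (\<Sum>\<rho>\<in>configs (inner_vertices n N []) (pole_start s s'). boltzmann \<beta> (edges n N []) J \<rho>)"
proof -
  let ?p = "gibbs_fixed n \<beta> N J s s'" and ?C = "configs (inner_vertices n N []) (pole_start s s')"
  let ?B = "boltzmann \<beta> (edges n N []) J"
  define c where "c = 1 / partition_sum n \<beta> N J / measure (gibbs_free n \<beta> N J) {\<sigma>. \<sigma> PoleA = s \<and> \<sigma> PoleB = s'}"
  have I: "PoleA \<notin> inner_vertices n N []" "PoleB \<notin> inner_vertices n N []" by (auto simp: inner_vertices_eq)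
  have C: "\<sigma> \<in> ?C \<longleftrightarrow> \<sigma> \<in> configs (vertices n N []) start \<and> \<sigma> PoleA = s \<and> \<sigma> PoleB = s'" for \<sigma>
    using s I by (auto simp: configs_def vertices_def)
  have pmf: "pmf ?p \<sigma> = (if \<sigma> \<in> ?C then c * ?B \<sigma> else 0)" for \<sigma>
    unfolding pmf_gibbs_fixed[OF s] C by (simp add: pmf_gibbs_free c_def)
  have supp: "set_pmf ?p \<subseteq> ?C"
  proof
    fix \<sigma> assume "\<sigma> \<in> set_pmf ?p"
    then show "\<sigma> \<in> ?C" using pmf[of \<sigma>] by (simp add: set_pmf_iff split: if_splits)
  qed
  have E: "measure_pmf.expectation ?p h = c * (\<Sum>\<rho>\<in>?C. ?B \<rho> * h \<rho>)" for h :: "spins \<Rightarrow> real"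
  proof -
    have "measure_pmf.expectation ?p h = (\<Sum>\<sigma>\<in>?C. pmf ?p \<sigma> *\<^sub>R h \<sigma>)"
      by (rule integral_measure_pmf) (use supp in auto)
    then show ?thesis by (simp add: pmf sum_distrib_left mult.assoc)
  qed
  have "(\<Sum>\<rho>\<in>?C. ?B \<rho>) > 0"
    by (rule sum_pos) auto
  moreover have "c * (\<Sum>\<rho>\<in>?C. ?B \<rho>) = 1" using E[of "\<lambda>_. 1"] by simp
  ultimately have "c = 1 / (\<Sum>\<rho>\<in>?C. ?B \<rho>)" by (simp add: field_simps)
  then show ?thesis unfolding E by simp
qed

text \<open>Reversing the couplings of all edges at \<open>x\<close> amounts to reversing the spin at \<open>x\<close>.\<close>

definition gauge :: "vertex \<Rightarrow> address \<Rightarrow> real" where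
  "gauge x e = (if x \<in> {fst (poles e), snd (poles e)} then -1 else 1)"

lemma boltzmann_gauge: "boltzmann \<beta> E (\<lambda>e. gauge x e * J e) \<sigma> = boltzmann \<beta> E J (flip {x} \<sigma>)"
proof -
  have "gauge x e * J e * \<sigma> (fst (poles e)) * \<sigma> (snd (poles e)) =
      J e * flip {x} \<sigma> (fst (poles e)) * flip {x} \<sigma> (snd (poles e))" for e
    using poles_neq[of e] by (auto simp: gauge_def flip_def)
  then show ?thesis unfolding boltzmann_def by (simp only:)
qed

lemma magnetisation_gauge:
  assumes s: "s \<in> {-1, 1}" "s' \<in> {-1, 1}" and x: "x \<in> inner_vertices n N []"
  shows "measure_pmf.expectation (gibbs_fixed n \<beta> N (\<lambda>e. gauge x e * J e) s s') (\<lambda>\<sigma>. \<sigma> x) =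
    - measure_pmf.expectation (gibbs_fixed n \<beta> N J s s') (\<lambda>\<sigma>. \<sigma> x)"
proof -
  let ?C = "configs (inner_vertices n N []) (pole_start s s')"
  let ?B = "boltzmann \<beta> (edges n N []) J"
  have flip_C: "flip {x} \<rho> \<in> ?C" if "\<rho> \<in> ?C" for \<rho>
    using that x by (auto simp: configs_def flip_def)
  have ff: "flip {x} (flip {x} \<rho>) = \<rho>" for \<rho> by (auto simp: flip_def fun_eq_iff)
  have re: "(\<Sum>\<rho>\<in>?C. ?B (flip {x} \<rho>) * h \<rho>) = (\<Sum>\<rho>\<in>?C. ?B \<rho> * h (flip {x} \<rho>))" for h
    by (rule sum.reindex_bij_witness[where i = "flip {x}" and j = "flip {x}"]) (simp_all add: ff flip_C)
  have re1: "(\<Sum>\<rho>\<in>?C. ?B (flip {x} \<rho>)) = (\<Sum>\<rho>\<in>?C. ?B \<rho>)" using re[of "\<lambda>_. 1"] by simp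
  show ?thesis
    unfolding expectation_gibbs_fixed[OF s] boltzmann_gauge re re1
    by (simp add: flip_def sum_negf)
qed

lemma gibbs_expectation_bounded:
  assumes p: "pole_gibbs n \<beta> N J p" and f: "\<And>\<sigma>. \<sigma> \<in> set_pmf p \<Longrightarrow> \<bar>f \<sigma>\<bar> \<le> (1 :: real)"
  shows "\<bar>measure_pmf.expectation p f\<bar> \<le> 1"
proof -
  note fin = finite_set_pole_gibbs[OF p]
  have b: "f \<sigma> \<le> 1" "-1 \<le> f \<sigma>" if "\<sigma> \<in> set_pmf p" for \<sigma>
    using f[OF that] by linarith+
  have "measure_pmf.expectation p f \<le> measure_pmf.expectation p (\<lambda>_. 1)"
    by (rule expectation_pmf_mono[OF fin b(1)])
  moreover have "measure_pmf.expectation p (\<lambda>_. -1) \<le> measure_pmf.expectation p f"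
    by (rule expectation_pmf_mono[OF fin b(2)])
  ultimately show ?thesis by simp
qed

context iid_couplings
begin

lemma measurable_expectation_gibbs:
  "(\<lambda>\<omega>. measure_pmf.expectation (gibbs N \<omega>) f) \<in> borel_measurable M" for f :: "spins \<Rightarrow> real"
proof -
  have [measurable]: "(\<lambda>\<omega>. boltzmann \<beta> (edges n N []) (\<lambda>e. J e \<omega>) \<sigma>) \<in> borel_measurable M" for \<sigma>
    by (rule measurable_boltzmann) (rule measurable_coupling_edge, auto)
  show ?thesis unfolding expectation_gibbs_free partition_sum_def by measurable
qed

lemma measurable_expectation_gibbs_fixed:
  fixes f :: "spins \<Rightarrow> real"
  assumes "s \<in> {-1, 1}" "s' \<in> {-1, 1}"
  shows "(\<lambda>\<omega>. measure_pmf.expectation (gibbs_fixed n \<beta> N (\<lambda>e. J e \<omega>) s s') f) \<in> borel_measurable M"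
proof -
  have [measurable]: "(\<lambda>\<omega>. boltzmann \<beta> (edges n N []) (\<lambda>e. J e \<omega>) \<sigma>) \<in> borel_measurable M" for \<sigma>
    by (rule measurable_boltzmann) (rule measurable_coupling_edge, auto)
  show ?thesis unfolding expectation_gibbs_fixed[OF assms] by measurable
qed

lemma free_pair_squared_bounds:
  assumes "x \<in> vertices n N []" "y \<in> vertices n N []"
  shows "(\<lambda>\<omega>. (measure_pmf.expectation (gibbs N \<omega>) (\<lambda>\<sigma>. \<sigma> x * \<sigma> y))\<^sup>2) \<in> borel_measurable M"
    "(measure_pmf.expectation (gibbs N \<omega>) (\<lambda>\<sigma>. \<sigma> x * \<sigma> y))\<^sup>2 \<le> 1"
    "integrable M (\<lambda>\<omega>. (measure_pmf.expectation (gibbs N \<omega>) (\<lambda>\<sigma>. \<sigma> x * \<sigma> y))\<^sup>2)"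
proof -
  show 1: "(\<lambda>\<omega>. (measure_pmf.expectation (gibbs N \<omega>) (\<lambda>\<sigma>. \<sigma> x * \<sigma> y))\<^sup>2) \<in> borel_measurable M"
    by (intro borel_measurable_power measurable_expectation_gibbs)
  have "\<bar>measure_pmf.expectation (gibbs N \<omega>) (\<lambda>\<sigma>. \<sigma> x * \<sigma> y)\<bar> \<le> 1" for \<omega>
  proof (rule gibbs_expectation_bounded[OF pole_gibbs_free])
    fix \<sigma> assume "\<sigma> \<in> set_pmf (gibbs N \<omega>)"
    then show "\<bar>\<sigma> x * \<sigma> y\<bar> \<le> 1"
      using pole_gibbs_spins[OF pole_gibbs_free _ assms(1)] pole_gibbs_spins[OF pole_gibbs_free _ assms(2)]
      by (fastforce simp: abs_mult)
  qed
  then show 2: "(measure_pmf.expectation (gibbs N \<omega>) (\<lambda>\<sigma>. \<sigma> x * \<sigma> y))\<^sup>2 \<le> 1" for \<omega>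
    by (simp add: abs_square_le_1)
  show "integrable M (\<lambda>\<omega>. (measure_pmf.expectation (gibbs N \<omega>) (\<lambda>\<sigma>. \<sigma> x * \<sigma> y))\<^sup>2)"
    using 1 2 by (intro integrable_const_bound[where B = 1]) auto
qed

lemma xi_eq_eff: "\<xi> n \<beta> J N = eff N []"
  by (simp add: fun_eq_iff \<xi>_def eff_def)

lemma measurable_xi: "\<xi> n \<beta> J N \<in> borel_measurable M"
  unfolding xi_eq_eff by (rule measurable_eff) simp

lemma pole_correlation_squared:
  "expectation (\<lambda>\<omega>. (measure_pmf.expectation (gibbs N \<omega>) (\<lambda>\<sigma>. \<sigma> PoleA * \<sigma> PoleB))\<^sup>2) =
    1 - expectation (\<lambda>\<omega>. (sech (\<xi> n \<beta> J N \<omega>))\<^sup>2)"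
proof -
  have "integrable M (\<lambda>\<omega>. (sech (\<xi> n \<beta> J N \<omega>))\<^sup>2)"
    using measurable_xi sech_bounds by (intro integrable_const_bound[where B = 1]) auto
  moreover have "(measure_pmf.expectation (gibbs N \<omega>) (\<lambda>\<sigma>. \<sigma> PoleA * \<sigma> PoleB))\<^sup>2 = 1 - (sech (\<xi> n \<beta> J N \<omega>))\<^sup>2" for \<omega>
    by (simp add: pole_correlation sech_sq \<xi>_def)
  ultimately show ?thesis by (simp add: prob_space)
qed

text \<open>For symmetric couplings the gauge transformation preserves the joint law of the couplings, and
  it reverses the magnetisation.\<close>

lemma symmetric_magnetisation:
  assumes s: "s \<in> {-1, 1}" "s' \<in> {-1, 1}" and x: "x \<in> inner_vertices n N []"
    and sym: "\<forall>e\<in>edges n N []. distr M borel (J e) = distr M borel (\<lambda>\<omega>. - J e \<omega>)"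
  shows "expectation (\<lambda>\<omega>. measure_pmf.expectation (gibbs_fixed n \<beta> N (\<lambda>e. J e \<omega>) s s') (\<lambda>\<sigma>. \<sigma> x)) = 0"
proof -
  let ?E = "edges n N []" and ?S = "Pi\<^sub>M (edges n N []) (\<lambda>_. borel :: real measure)"
  define h where "h g = measure_pmf.expectation (gibbs_fixed n \<beta> N g s s') (\<lambda>\<sigma>. \<sigma> x)" for g
  have h_cong: "h g = h g'" if "\<And>e. e \<in> ?E \<Longrightarrow> g e = g' e" for g g'
    unfolding h_def expectation_gibbs_fixed[OF s] using boltzmann_cong_couplings[OF that, of ?E] by simp
  have h_meas: "h \<in> borel_measurable ?S"
  proof -
    have [measurable]: "(\<lambda>g. boltzmann \<beta> ?E g \<sigma>) \<in> borel_measurable ?S" for \<sigma>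
      by (rule measurable_boltzmann) (rule measurable_component_singleton)
    show ?thesis unfolding h_def[abs_def] expectation_gibbs_fixed[OF s] by measurable
  qed
  have rv: "random_variable borel (J e)" if "e \<in> ?E" for e using measurable_coupling_edge[OF that] by simp
  have law: "distr M ?S (\<lambda>\<omega>. \<lambda>e\<in>?E. J e \<omega>) = (\<Pi>\<^sub>M e\<in>?E. distr M borel (J e))"
    by (subst indep_vars_iff_distr_eq_PiM'[symmetric]) (use edges_nonempty rv indep in auto)
  have rv': "random_variable borel (\<lambda>\<omega>. gauge x e * J e \<omega>)" if "e \<in> ?E" for e
    using rv[OF that] by simp
  have "indep_vars (\<lambda>_. borel) (\<lambda>e \<omega>. gauge x e * J e \<omega>) ?E"
    by (rule indep_vars_compose2[OF indep]) simp
  then have law': "distr M ?S (\<lambda>\<omega>. \<lambda>e\<in>?E. gauge x e * J e \<omega>) = (\<Pi>\<^sub>M e\<in>?E. distr M borel (\<lambda>\<omega>. gauge x e * J e \<omega>))"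
    by (subst indep_vars_iff_distr_eq_PiM'[symmetric]) (use edges_nonempty rv' in auto)
  have "(\<Pi>\<^sub>M e\<in>?E. distr M borel (\<lambda>\<omega>. gauge x e * J e \<omega>)) = (\<Pi>\<^sub>M e\<in>?E. distr M borel (J e))"
    by (intro PiM_cong refl) (use sym in \<open>auto simp: gauge_def\<close>)
  then have same: "distr M ?S (\<lambda>\<omega>. \<lambda>e\<in>?E. gauge x e * J e \<omega>) = distr M ?S (\<lambda>\<omega>. \<lambda>e\<in>?E. J e \<omega>)"
    by (simp add: law law')
  have "expectation (\<lambda>\<omega>. h (\<lambda>e. gauge x e * J e \<omega>)) = expectation (\<lambda>\<omega>. h (\<lambda>e\<in>?E. gauge x e * J e \<omega>))"
    by (intro Bochner_Integration.integral_cong refl h_cong) simp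
  also have "\<dots> = integral\<^sup>L (distr M ?S (\<lambda>\<omega>. \<lambda>e\<in>?E. gauge x e * J e \<omega>)) h"
    by (rule integral_distr[OF measurable_restrict[OF rv'] h_meas, symmetric])
  also have "\<dots> = expectation (\<lambda>\<omega>. h (\<lambda>e\<in>?E. J e \<omega>))"
    unfolding same by (rule integral_distr[OF measurable_restrict[OF rv] h_meas])
  also have "\<dots> = expectation (\<lambda>\<omega>. h (\<lambda>e. J e \<omega>))"
    by (intro Bochner_Integration.integral_cong refl h_cong) simp
  finally have "expectation (\<lambda>\<omega>. h (\<lambda>e. J e \<omega>)) = expectation (\<lambda>\<omega>. h (\<lambda>e. gauge x e * J e \<omega>))" ..
  also have "\<dots> = - expectation (\<lambda>\<omega>. h (\<lambda>e. J e \<omega>))"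
    using magnetisation_gauge[OF s x] by (simp add: h_def)
  finally show ?thesis by (simp add: h_def)
qed

text \<open>In the second moment of the overlap, multiply the overlap by \<open>q\<close> at \<open>A\<close>, whose square is \<open>1\<close>,
  before applying the Cauchy-Schwarz inequality.\<close>

lemma overlap_second_moment:
  fixes N :: nat
  defines "V \<equiv> vertices n N []"
  shows "((\<Sum>z\<in>V. expectation (\<lambda>\<omega>. (measure_pmf.expectation (gibbs N \<omega>) (\<lambda>\<sigma>. \<sigma> PoleA * \<sigma> z))\<^sup>2)) / real (card V))\<^sup>2 \<le>
    expectation (\<lambda>\<omega>. measure_pmf.expectation (pair_pmf (gibbs N \<omega>) (gibbs N \<omega>)) (\<lambda>(\<sigma>, \<tau>). (overlap n N \<sigma> \<tau>)\<^sup>2))"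
proof -
  define c where "c z \<omega> = (measure_pmf.expectation (gibbs N \<omega>) (\<lambda>\<sigma>. \<sigma> PoleA * \<sigma> z))\<^sup>2" for z \<omega>
  define X where "X \<omega> = (\<Sum>z\<in>V. c z \<omega>) / real (card V)" for \<omega>
  have V: "real (card V) > 0" by (auto simp: V_def vertices_def card_gt_0_iff)
  have c: "c z \<in> borel_measurable M" "c z \<omega> \<le> 1" "integrable M (c z)" if "z \<in> V" for z \<omega>
    unfolding c_def[abs_def] using free_pair_squared_bounds(1,3)[of PoleA N z] free_pair_squared_bounds(2)[of PoleA N z \<omega>] that
    by (auto simp: V_def)
  have X0: "0 \<le> X \<omega>" for \<omega> by (auto simp: X_def c_def intro!: divide_nonneg_nonneg sum_nonneg)
  have X1: "X \<omega> \<le> 1" for \<omega>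
    using V sum_bounded_above[of V "\<lambda>z. c z \<omega>" 1] c(2) by (simp add: X_def divide_le_eq)
  have Xm: "X \<in> borel_measurable M" unfolding X_def[abs_def] using c(1) by auto
  have le: "(X \<omega>)\<^sup>2 \<le> measure_pmf.expectation (pair_pmf (gibbs N \<omega>) (gibbs N \<omega>)) (\<lambda>(\<sigma>, \<tau>). (overlap n N \<sigma> \<tau>)\<^sup>2)"
    (is "_ \<le> measure_pmf.expectation ?P _") for \<omega>
  proof -
    have fin: "finite (set_pmf (gibbs N \<omega>))" by (rule finite_set_pole_gibbs[OF pole_gibbs_free])
    then have finP: "finite (set_pmf ?P)" by simp
    have pm: "\<sigma> v \<in> {-1, 1}" if "\<sigma> \<in> set_pmf (gibbs N \<omega>)" "v \<in> V" for \<sigma> v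
      using pole_gibbs_spins[OF pole_gibbs_free that(1)] that(2) by (simp add: V_def)
    have A: "PoleA \<in> V" by (simp add: V_def)
    have cz: "c z \<omega> = measure_pmf.expectation ?P (\<lambda>(\<sigma>, \<tau>). (\<sigma> PoleA * \<sigma> z) * (\<tau> PoleA * \<tau> z))" if "z \<in> V" for z
      unfolding c_def
    proof (rule expectation_spin_squared(1)[OF fin])
      fix \<sigma> assume "\<sigma> \<in> set_pmf (gibbs N \<omega>)"
      from pm[OF this A] pm[OF this that] show "\<sigma> PoleA * \<sigma> z \<in> {-1, 1}" by auto
    qed
    have "X \<omega> = measure_pmf.expectation ?P (\<lambda>(\<sigma>, \<tau>). \<sigma> PoleA * \<tau> PoleA * overlap n N \<sigma> \<tau>)"
    proof -
      have "X \<omega> = (\<Sum>z\<in>V. measure_pmf.expectation ?P (\<lambda>(\<sigma>, \<tau>). (\<sigma> PoleA * \<sigma> z) * (\<tau> PoleA * \<tau> z))) / real (card V)"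
        by (simp add: X_def cz)
      also have "\<dots> = measure_pmf.expectation ?P (\<lambda>x. (\<Sum>z\<in>V. (\<lambda>(\<sigma>, \<tau>). (\<sigma> PoleA * \<sigma> z) * (\<tau> PoleA * \<tau> z)) x) / real (card V))"
        by (subst integral_divide_zero, subst Bochner_Integration.integral_sum)
           (auto intro: integrable_measure_pmf_finite[OF finP])
      also have "\<dots> = measure_pmf.expectation ?P (\<lambda>(\<sigma>, \<tau>). \<sigma> PoleA * \<tau> PoleA * overlap n N \<sigma> \<tau>)"
        by (intro Bochner_Integration.integral_cong refl)
           (auto simp: overlap_def V_def sum_distrib_left mult_ac)
      finally show ?thesis .
    qed
    then have "(X \<omega>)\<^sup>2 \<le> measure_pmf.expectation ?P (\<lambda>x. ((\<lambda>(\<sigma>, \<tau>). \<sigma> PoleA * \<tau> PoleA * overlap n N \<sigma> \<tau>) x)\<^sup>2)"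
      using square_expectation_pmf_le[OF finP] by simp
    also have "\<dots> \<le> measure_pmf.expectation ?P (\<lambda>(\<sigma>, \<tau>). (overlap n N \<sigma> \<tau>)\<^sup>2)"
    proof (rule expectation_pmf_mono[OF finP])
      fix x assume "x \<in> set_pmf ?P"
      then obtain \<sigma> \<tau> where x: "x = (\<sigma>, \<tau>)" "\<sigma> \<in> set_pmf (gibbs N \<omega>)" "\<tau> \<in> set_pmf (gibbs N \<omega>)" by auto
      have "(\<sigma> PoleA)\<^sup>2 = 1" "(\<tau> PoleA)\<^sup>2 = 1" using pm[OF x(2) A] pm[OF x(3) A] by auto
      then show "((\<lambda>(\<sigma>, \<tau>). \<sigma> PoleA * \<tau> PoleA * overlap n N \<sigma> \<tau>) x)\<^sup>2 \<le> (\<lambda>(\<sigma>, \<tau>). (overlap n N \<sigma> \<tau>)\<^sup>2) x"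
        by (simp add: x(1) power_mult_distrib)
    qed
    finally show ?thesis .
  qed
  have E: "expectation X = (\<Sum>z\<in>V. expectation (c z)) / real (card V)"
    unfolding X_def[abs_def] using c(3) by (simp add: Bochner_Integration.integral_sum)
  have "(expectation X)\<^sup>2 \<le> expectation (\<lambda>\<omega>. (X \<omega>)\<^sup>2)"
    by (rule square_expectation_le[OF Xm, of 1]) (use X0 X1 in auto)
  also have "\<dots> \<le> expectation (\<lambda>\<omega>. measure_pmf.expectation (pair_pmf (gibbs N \<omega>) (gibbs N \<omega>)) (\<lambda>(\<sigma>, \<tau>). (overlap n N \<sigma> \<tau>)\<^sup>2))"
  proof (rule integral_mono)
    show "integrable M (\<lambda>\<omega>. (X \<omega>)\<^sup>2)"
      using Xm X0 X1 by (intro integrable_const_bound[where B = 1]) (auto simp: power_le_one)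
    let ?C = "configs V start"
    have eq: "measure_pmf.expectation (pair_pmf (gibbs N \<omega>) (gibbs N \<omega>)) (\<lambda>(\<sigma>, \<tau>). (overlap n N \<sigma> \<tau>)\<^sup>2) =
        (\<Sum>\<sigma>\<in>?C. \<Sum>\<tau>\<in>?C. pmf (gibbs N \<omega>) \<sigma> * pmf (gibbs N \<omega>) \<tau> * (overlap n N \<sigma> \<tau>)\<^sup>2)" for \<omega>
      by (subst expectation_pair_finite[of ?C ?C])
         (use set_pole_gibbs[OF pole_gibbs_free, of n \<beta> N "\<lambda>e. J e \<omega>"] in \<open>auto simp: V_def\<close>)
    show "integrable M (\<lambda>\<omega>. measure_pmf.expectation (pair_pmf (gibbs N \<omega>) (gibbs N \<omega>)) (\<lambda>(\<sigma>, \<tau>). (overlap n N \<sigma> \<tau>)\<^sup>2))"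
      unfolding eq
    proof (intro Bochner_Integration.integrable_sum integrable_mult_left)
      fix \<sigma> \<tau>
      show "integrable M (\<lambda>\<omega>. pmf (gibbs N \<omega>) \<sigma> * pmf (gibbs N \<omega>) \<tau>)"
        by (rule integrable_const_bound[where B = 1])
           (auto intro!: borel_measurable_times measurable_pmf_gibbs AE_I2 mult_le_one pmf_le_1)
    qed
  qed (rule le)
  finally show ?thesis unfolding E by (simp add: c_def[abs_def])
qed

end

section \<open>Disorder-averaged bounds\<close>

context profiled_couplings
begin

lemma T_b_antimono: "j \<le> j' \<Longrightarrow> T_b F Q N j' \<le> T_b F Q N j"
  unfolding T_b_def using profile_integrals_nonneg by (intro sum_mono2) auto

lemma card_vertices_pos: "real (card (vertices n N [])) > 0"
  by (auto simp: vertices_def card_gt_0_iff)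

lemma fixed_magnetisation_bound:
  assumes s: "s \<in> {-1, 1}" "s' \<in> {-1, 1}" and w: "addr n w" "i < n" "length w < N"
  shows "1 - 2 * T_s Q N (N - length w) \<le>
    expectation (\<lambda>\<omega>. (measure_pmf.expectation (gibbs_fixed n \<beta> N (\<lambda>e. J e \<omega>) s s') (\<lambda>\<sigma>. \<sigma> (Mid w i)))\<^sup>2)"
proof -
  let ?C = "\<lambda>\<omega>. chain_cost (\<lambda>v i. (sech (half_gap n \<beta> N (\<lambda>e. J e \<omega>) v i))\<^sup>2) ((i, False) # w)"
  let ?m = "\<lambda>\<omega>. (measure_pmf.expectation (gibbs_fixed n \<beta> N (\<lambda>e. J e \<omega>) s s') (\<lambda>\<sigma>. \<sigma> (Mid w i)))\<^sup>2"
  have V: "Mid w i \<in> vertices n N []" using w by (auto simp: vertices_def inner_vertices_eq)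
  have C: "integrable M ?C" "expectation ?C \<le> 2 * T_s Q N (N - length w)"
    using expectation_overlap_chain[OF w] by auto
  have "1 - 2 * T_s Q N (N - length w) \<le> expectation (\<lambda>\<omega>. 1 - ?C \<omega>)"
    using C by (simp add: prob_space)
  also have "\<dots> \<le> expectation ?m"
  proof (rule integral_mono)
    show "integrable M (\<lambda>\<omega>. 1 - ?C \<omega>)" using C by simp
    have "\<bar>measure_pmf.expectation (gibbs_fixed n \<beta> N (\<lambda>e. J e \<omega>) s s') (\<lambda>\<sigma>. \<sigma> (Mid w i))\<bar> \<le> 1" for \<omega>
      by (rule gibbs_expectation_bounded[OF pole_gibbs_fixed[OF s]])
         (use pole_gibbs_spins[OF pole_gibbs_fixed[OF s] _ V] in fastforce)
    then have "?m \<omega> \<le> 1" for \<omega> by (simp add: abs_square_le_1)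
    then show "integrable M ?m"
      by (intro integrable_const_bound[where B = 1])
         (auto intro!: borel_measurable_power measurable_expectation_gibbs_fixed[OF s])
    show "1 - ?C \<omega> \<le> ?m \<omega>" for \<omega> by (rule fixed_magnetisation_ge[OF s \<beta>]) (use w in auto)
  qed
  finally show ?thesis .
qed

lemma free_correlation_bound:
  assumes z: "z \<in> vertices n N []"
  shows "max (1 - 2 * T_s_at Q N z - S_N F N) 0 \<le>
    expectation (\<lambda>\<omega>. (measure_pmf.expectation (gibbs N \<omega>) (\<lambda>\<sigma>. \<sigma> PoleA * \<sigma> z))\<^sup>2)"
proof -
  let ?c = "\<lambda>z \<omega>. (measure_pmf.expectation (gibbs N \<omega>) (\<lambda>\<sigma>. \<sigma> PoleA * \<sigma> z))\<^sup>2"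
  have nn: "0 \<le> expectation (?c z)" by (intro Bochner_Integration.integral_nonneg) simp
  have B: "1 - S_N F N \<le> expectation (?c PoleB)"
    using S_N_bound[of N] by (simp add: pole_correlation_squared)
  have "1 - 2 * T_s_at Q N z - S_N F N \<le> expectation (?c z)"
  proof (cases z)
    case PoleA
    have "?c PoleA \<omega> = 1" for \<omega>
    proof -
      have "measure_pmf.expectation (gibbs N \<omega>) (\<lambda>\<sigma>. \<sigma> PoleA * \<sigma> PoleA) = measure_pmf.expectation (gibbs N \<omega>) (\<lambda>_. 1)"
      proof (rule integral_cong_AE)
        show "AE \<sigma> in measure_pmf (gibbs N \<omega>). \<sigma> PoleA * \<sigma> PoleA = 1"
          using pole_gibbs_spins[OF pole_gibbs_free _ poles_in_vertices(1)] by (fastforce simp: AE_measure_pmf_iff)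
      qed auto
      then show ?thesis by simp
    qed
    then show ?thesis using profile_integrals_nonneg(3)[of N] by (simp add: PoleA T_s_at_def prob_space)
  next
    case PoleB
    then show ?thesis using B by (simp add: T_s_at_def)
  next
    case (Mid w i)
    then have w: "addr n w" "i < n" "length w < N" using z by (auto simp: vertices_def inner_vertices_eq)
    let ?C = "\<lambda>\<omega>. chain_cost (\<lambda>v i. (sech (half_gap n \<beta> N (\<lambda>e. J e \<omega>) v i))\<^sup>2) ((i, False) # w)"
    have C: "integrable M ?C" "expectation ?C \<le> 2 * T_s Q N (N - length w)"
      using expectation_overlap_chain[OF w] by auto
    have iB: "integrable M (?c PoleB)" by (rule free_pair_squared_bounds(3)) simp_all
    have "1 - 2 * T_s_at Q N z - S_N F N \<le> expectation (?c PoleB) - expectation ?C"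
      using B C by (simp add: Mid T_s_at_def)
    also have "\<dots> = expectation (\<lambda>\<omega>. ?c PoleB \<omega> - ?C \<omega>)"
      using iB C by simp
    also have "\<dots> \<le> expectation (?c z)"
    proof (rule integral_mono)
      show "integrable M (\<lambda>\<omega>. ?c PoleB \<omega> - ?C \<omega>)" using iB C by simp
      show "integrable M (?c z)" by (rule free_pair_squared_bounds(3)) (use z in simp_all)
      show "?c PoleB \<omega> - ?C \<omega> \<le> ?c z \<omega>" for \<omega>
        unfolding Mid by (rule free_correlation_ge[OF \<beta>]) (use w in auto)
    qed
    finally show ?thesis .
  qed
  with nn show ?thesis by simp
qed

lemma overlap_bound:
  "((\<Sum>z\<in>vertices n N []. max (1 - 2 * T_s_at Q N z - S_N F N) 0) / real (card (vertices n N [])))\<^sup>2 \<le>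
    expectation (\<lambda>\<omega>. measure_pmf.expectation (pair_pmf (gibbs N \<omega>) (gibbs N \<omega>)) (\<lambda>(\<sigma>, \<tau>). (overlap n N \<sigma> \<tau>)\<^sup>2))"
proof (rule order_trans[OF _ overlap_second_moment], rule power_mono)
  show "(\<Sum>z\<in>vertices n N []. max (1 - 2 * T_s_at Q N z - S_N F N) 0) / real (card (vertices n N [])) \<le>
      (\<Sum>z\<in>vertices n N []. expectation (\<lambda>\<omega>. (measure_pmf.expectation (gibbs N \<omega>) (\<lambda>\<sigma>. \<sigma> PoleA * \<sigma> z))\<^sup>2)) /
        real (card (vertices n N []))"
    by (intro divide_right_mono sum_mono free_correlation_bound) auto
qed (auto intro!: divide_nonneg_nonneg sum_nonneg)

abbreviation "averaged_expectation N f \<equiv> measure_pmf.expectation (averaged N) (\<lambda>(\<sigma> :: spins, \<tau> :: spins, b). f b :: real)"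

lemma support_bonds: "(\<sigma>, \<tau>, b) \<in> set_pmf (averaged N) \<Longrightarrow> b \<subseteq> edges n N []"
  by (rule averaged_support(3))

lemma indicator_expectation:
  "averaged_expectation N (indicator S) = measure_pmf.prob (averaged N) {(\<sigma>, \<tau>, b). b \<in> S}"
proof -
  have "averaged_expectation N (indicator S) = measure_pmf.expectation (averaged N) (indicator {(\<sigma>, \<tau>, b). b \<in> S})"
    by (intro Bochner_Integration.integral_cong refl) (auto simp: indicator_def)
  then show ?thesis by simp
qed

lemma expected_off_count:
  "averaged_expectation N (\<lambda>b. real (off_count n N b)) \<le> X_bar F Q n N * real (card (vertices n N []))"
proof -
  let ?I = "\<lambda>z. indicator {b. z \<notin> cluster b PoleA \<union> cluster b PoleB} :: address set \<Rightarrow> real"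
  have "averaged_expectation N (\<lambda>b. real (off_count n N b)) =
      measure_pmf.expectation (averaged N) (\<lambda>x. \<Sum>z\<in>vertices n N []. (\<lambda>(\<sigma>, \<tau>, b). ?I z b) x)"
    by (simp add: real_off_count case_prod_unfold)
  also have "\<dots> = (\<Sum>z\<in>vertices n N []. averaged_expectation N (?I z))"
    by (rule Bochner_Integration.integral_sum) (rule integrable_measure_pmf_finite[OF finite_averaged])
  also have "\<dots> \<le> (\<Sum>z\<in>vertices n N []. T_b_at F Q N z)"
    unfolding indicator_expectation by (intro sum_mono) (use averaged_vertex_off in simp)
  also have "\<dots> = X_bar F Q n N * real (card (vertices n N []))"
    using card_vertices_pos[of N] by (simp add: X_bar_def)
  finally show ?thesis .
qed

text \<open>When the poles are joined, the vertices missing from the cluster of \<open>A\<close> are those joined to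
  neither pole; apply Markov's inequality to their number.\<close>

lemma giant_cluster_prob:
  assumes \<theta>: "0 < \<theta>"
  shows "1 - X_bar F Q n N / \<theta> - P_N F N \<le> measure_pmf.prob (averaged N)
    {(\<sigma>, \<tau>, b). PoleB \<in> cluster b PoleA \<and> real (card (cluster b PoleA)) > (1 - \<theta>) * real (card (vertices n N []))}"
proof -
  let ?V = "real (card (vertices n N []))"
  let ?good = "{(\<sigma> :: spins, \<tau> :: spins, b). PoleB \<in> cluster b PoleA \<and> real (card (cluster b PoleA)) > (1 - \<theta>) * ?V}"
  let ?D = "{(\<sigma> :: spins, \<tau> :: spins, b). \<not> connected_by b PoleA PoleB}"
  let ?L = "{(\<sigma> :: spins, \<tau> :: spins, b). real (off_count n N b) \<ge> \<theta> * ?V}"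
  let ?p = "averaged N"
  have V: "?V > 0" by (rule card_vertices_pos)
  have L: "measure_pmf.prob ?p ?L \<le> X_bar F Q n N / \<theta>"
  proof -
    have "measure_pmf.prob ?p {x \<in> space ?p. (case x of (\<sigma>, \<tau>, b) \<Rightarrow> real (off_count n N b)) \<ge> \<theta> * ?V} \<le>
        averaged_expectation N (\<lambda>b. real (off_count n N b)) / (\<theta> * ?V)"
      by (rule integral_Markov_inequality_measure[where A = UNIV])
         (use \<theta> V in \<open>auto intro: integrable_measure_pmf_finite finite_averaged\<close>)
    also have "\<dots> \<le> X_bar F Q n N * ?V / (\<theta> * ?V)"
      by (rule divide_right_mono[OF expected_off_count]) (use \<theta> V in simp)
    also have "\<dots> = X_bar F Q n N / \<theta>"
      by (rule mult_divide_mult_cancel_right) (use V in linarith)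
    also have "{x \<in> space ?p. (case x of (\<sigma>, \<tau>, b) \<Rightarrow> real (off_count n N b)) \<ge> \<theta> * ?V} = ?L" by auto
    finally show ?thesis .
  qed
  have "1 = measure_pmf.prob ?p (?good \<union> (?D \<union> ?L))"
  proof -
    have "measure_pmf.prob ?p UNIV = measure_pmf.prob ?p (?good \<union> (?D \<union> ?L))"
    proof (rule prob_cong_support)
      fix z assume z: "z \<in> set_pmf ?p"
      obtain \<sigma> \<tau> b where zz: "z = (\<sigma>, \<tau>, b)" by (cases z)
      have b: "b \<subseteq> edges n N []" using support_bonds z zz by blast
      have "z \<in> ?good \<union> (?D \<union> ?L)"
      proof (cases "connected_by b PoleA PoleB")
        case True
        have "real (card (cluster b PoleA)) + real (off_count n N b) = ?V"
          using card_cluster_pole[OF b True] by linarith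
        then show ?thesis using True zz by (auto simp: cluster_def algebra_simps)
      qed (simp add: zz)
      then show "z \<in> UNIV \<longleftrightarrow> z \<in> ?good \<union> (?D \<union> ?L)" by simp
    qed
    then show ?thesis by simp
  qed
  also have "\<dots> \<le> measure_pmf.prob ?p ?good + measure_pmf.prob ?p (?D \<union> ?L)"
    by (rule measure_Un_le) auto
  also have "measure_pmf.prob ?p (?D \<union> ?L) \<le> measure_pmf.prob ?p ?D + measure_pmf.prob ?p ?L"
    by (rule measure_Un_le) auto
  finally show ?thesis using L averaged_poles_disconnected[of N] by linarith
qed

lemma expected_cluster_size:
  "(\<Sum>z\<in>vertices n N []. max (1 - T_b_at F Q N z - P_N F N) 0) \<le> averaged_expectation N (\<lambda>b. real (card (cluster b PoleA)))"
proof -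
  let ?p = "averaged N" and ?I = "\<lambda>z. indicator {b. z \<in> cluster b PoleA} :: address set \<Rightarrow> real"
  have "max (1 - T_b_at F Q N z - P_N F N) 0 \<le> averaged_expectation N (?I z)" if z: "z \<in> vertices n N []" for z
  proof -
    let ?off = "{(\<sigma> :: spins, \<tau> :: spins, b). z \<notin> cluster b PoleA \<union> cluster b PoleB}"
    let ?D = "{(\<sigma> :: spins, \<tau> :: spins, b). \<not> connected_by b PoleA PoleB}"
    let ?in = "{(\<sigma> :: spins, \<tau> :: spins, b). z \<in> cluster b PoleA}"
    have "UNIV \<subseteq> ?in \<union> (?off \<union> ?D)"
      unfolding cluster_def by (auto intro: connected_by_trans)
    then have "1 \<le> measure_pmf.prob ?p (?in \<union> (?off \<union> ?D))"
      using measure_pmf.finite_measure_mono[of UNIV "?in \<union> (?off \<union> ?D)" ?p] by simp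
    also have "\<dots> \<le> measure_pmf.prob ?p ?in + measure_pmf.prob ?p (?off \<union> ?D)"
      by (rule measure_Un_le) auto
    also have "measure_pmf.prob ?p (?off \<union> ?D) \<le> measure_pmf.prob ?p ?off + measure_pmf.prob ?p ?D"
      by (rule measure_Un_le) auto
    finally have "1 - T_b_at F Q N z - P_N F N \<le> measure_pmf.prob ?p ?in"
      using averaged_poles_disconnected[of N] averaged_vertex_off[OF z] by linarith
    then show ?thesis by (simp add: indicator_expectation)
  qed
  then have "(\<Sum>z\<in>vertices n N []. max (1 - T_b_at F Q N z - P_N F N) 0) \<le> (\<Sum>z\<in>vertices n N []. averaged_expectation N (?I z))"
    by (rule sum_mono)
  also have "\<dots> = measure_pmf.expectation ?p (\<lambda>x. \<Sum>z\<in>vertices n N []. (\<lambda>(\<sigma>, \<tau>, b). ?I z b) x)"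
    by (rule Bochner_Integration.integral_sum[symmetric]) (rule integrable_measure_pmf_finite[OF finite_averaged])
  also have "\<dots> \<le> averaged_expectation N (\<lambda>b. real (card (cluster b PoleA)))"
  proof (rule expectation_pmf_mono[OF finite_averaged])
    fix x assume x: "x \<in> set_pmf ?p"
    obtain \<sigma> \<tau> b where xx: "x = (\<sigma>, \<tau>, b)" by (cases x)
    have sub: "cluster b PoleA \<subseteq> vertices n N []"
      by (rule cluster_subset_vertices) (use support_bonds x xx in auto)
    have "real (card (cluster b PoleA)) = (\<Sum>z\<in>cluster b PoleA. 1)" by simp
    also have "\<dots> = (\<Sum>z\<in>vertices n N []. ?I z b)"
      by (rule sum.mono_neutral_cong_left) (use sub in \<open>auto simp: indicator_def\<close>)
    finally show "(\<Sum>z\<in>vertices n N []. (\<lambda>(\<sigma>, \<tau>, b). ?I z b) x) \<le> (\<lambda>(\<sigma>, \<tau>, b). real (card (cluster b PoleA))) x"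
      by (simp add: xx)
  qed
  finally show ?thesis .
qed

text \<open>A union bound over the vertices of level above \<open>N - m\<close>; the largest of their bounds is the one
  at level \<open>N - m + 1\<close>.\<close>

lemma off_cluster_prob:
  assumes m: "1 \<le> m" "m \<le> N"
  shows "measure_pmf.prob (averaged N) {(\<sigma>, \<tau>, b).
      real (max_off_cluster n N b) > (1 / (2 * real n)) ^ m * real (card (vertices n N []))} \<le>
    P_N F N + real (card (inner_vertices n m [])) * T_b F Q N (N - m + 1)"
proof -
  let ?p = "averaged N" and ?V = "card (vertices n N [])"
  let ?bad = "{(\<sigma> :: spins, \<tau> :: spins, b). real (max_off_cluster n N b) > (1 / (2 * real n)) ^ m * real ?V}"
  let ?D = "{(\<sigma> :: spins, \<tau> :: spins, b). \<not> connected_by b PoleA PoleB}"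
  let ?off = "\<lambda>z. {(\<sigma> :: spins, \<tau> :: spins, b). z \<notin> cluster b PoleA \<union> cluster b PoleB}"
  let ?U = "\<Union>z\<in>inner_vertices n m []. ?off z"
  have "measure_pmf.prob ?p ?bad = measure_pmf.prob ?p (?bad \<inter> (?D \<union> ?U))"
  proof (rule prob_cong_support)
    fix x assume x: "x \<in> set_pmf ?p"
    obtain \<sigma> \<tau> b where xx: "x = (\<sigma>, \<tau>, b)" by (cases x)
    have b: "b \<subseteq> edges n N []" using support_bonds x xx by blast
    have "x \<notin> ?bad" if not: "x \<notin> ?D \<union> ?U"
    proof -
      have "(2 * n) ^ m * card C \<le> ?V" if "C \<in> clusters n N b" "PoleA \<notin> C" for C
        by (rule off_cluster_small[OF b m(2) _ _ that]) (use not xx in auto)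
      then have "card C \<le> ?V div (2 * n) ^ m" if "C \<in> clusters n N b" "PoleA \<notin> C" for C
        using that n by (simp add: less_eq_div_iff_mult_less_eq mult.commute)
      then have "max_off_cluster n N b \<le> ?V div (2 * n) ^ m" by (rule max_off_cluster_le)
      then have "(2 * n) ^ m * max_off_cluster n N b \<le> ?V"
        using n by (simp add: less_eq_div_iff_mult_less_eq mult.commute)
      then have "real ((2 * n) ^ m * max_off_cluster n N b) \<le> real ?V" by (simp only: of_nat_le_iff)
      then have "real (max_off_cluster n N b) \<le> (1 / (2 * real n)) ^ m * real ?V"
        using n by (simp add: power_divide field_simps)
      then show ?thesis by (simp add: xx)
    qed
    then show "x \<in> ?bad \<longleftrightarrow> x \<in> ?bad \<inter> (?D \<union> ?U)" by blast
  qed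
  also have "\<dots> \<le> measure_pmf.prob ?p (?D \<union> ?U)"
    by (intro measure_pmf.finite_measure_mono) auto
  also have "\<dots> \<le> measure_pmf.prob ?p ?D + measure_pmf.prob ?p ?U"
    by (rule measure_Un_le) auto
  also have "measure_pmf.prob ?p ?U \<le> (\<Sum>z\<in>inner_vertices n m []. measure_pmf.prob ?p (?off z))"
    by (rule measure_pmf.finite_measure_subadditive_finite) auto
  also have "\<dots> \<le> (\<Sum>z\<in>inner_vertices n m []. T_b F Q N (N - m + 1))"
  proof (rule sum_mono)
    fix z assume "z \<in> inner_vertices n m []"
    then obtain w i where z: "z = Mid w i" "addr n w" "i < n" "length w < m" by (auto simp: inner_vertices_eq)
    then have "measure_pmf.prob ?p (?off z) \<le> T_b F Q N (N - length w)"
      using averaged_midpoint_off[of w i N] m by simp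
    also have "\<dots> \<le> T_b F Q N (N - m + 1)" by (rule T_b_antimono) (use z m in auto)
    finally show "measure_pmf.prob ?p (?off z) \<le> T_b F Q N (N - m + 1)" .
  qed
  finally show ?thesis using averaged_poles_disconnected[of N] by simp
qed

lemma max_off_cluster_le_vertices:
  "b \<subseteq> edges n N [] \<Longrightarrow> max_off_cluster n N b \<le> card (vertices n N [])"
  by (rule max_off_cluster_le) (auto intro!: card_mono dest: clusters_subset)

lemma off_cluster_expectation:
  assumes m: "1 \<le> m" "m \<le> N"
  shows "averaged_expectation N (\<lambda>b. real (max_off_cluster n N b)) / real (card (vertices n N [])) \<le>
    (1 / (2 * real n)) ^ m + P_N F N + real (card (inner_vertices n m [])) * T_b F Q N (N - m + 1)"
proof -
  let ?p = "averaged N" and ?V = "real (card (vertices n N []))" and ?c = "(1 / (2 * real n)) ^ m"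
  let ?S = "{b. real (max_off_cluster n N b) > ?c * ?V}"
  have V: "?V > 0" by (rule card_vertices_pos)
  have c: "?c \<ge> 0" by simp
  have "averaged_expectation N (\<lambda>b. real (max_off_cluster n N b)) \<le> averaged_expectation N (\<lambda>b. ?c * ?V + ?V * indicator ?S b)"
  proof (rule expectation_pmf_mono[OF finite_averaged])
    fix x assume x: "x \<in> set_pmf ?p"
    obtain \<sigma> \<tau> b where xx: "x = (\<sigma>, \<tau>, b)" by (cases x)
    have le: "real (max_off_cluster n N b) \<le> ?V"
      using max_off_cluster_le_vertices[OF support_bonds] x xx by (simp only: of_nat_le_iff)
    have "real (max_off_cluster n N b) \<le> ?c * ?V + ?V * indicator ?S b"
    proof (cases "b \<in> ?S")
      case True
      have "0 \<le> ?c * ?V" using c V by (intro mult_nonneg_nonneg) auto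
      with True le show ?thesis unfolding indicator_simps(1)[OF True] by linarith
    qed simp
    then show "(case x of (\<sigma>, \<tau>, b) \<Rightarrow> real (max_off_cluster n N b)) \<le> (case x of (\<sigma>, \<tau>, b) \<Rightarrow> ?c * ?V + ?V * indicator ?S b)"
      by (simp add: xx)
  qed
  also have "\<dots> = ?c * ?V + ?V * averaged_expectation N (indicator ?S)"
  proof -
    have "averaged_expectation N (\<lambda>b. ?c * ?V + ?V * indicator ?S b) =
        measure_pmf.expectation ?p (\<lambda>x. ?c * ?V + ?V * (\<lambda>(\<sigma>, \<tau>, b). indicator ?S b) x)"
      by (intro Bochner_Integration.integral_cong refl) auto
    also have "\<dots> = ?c * ?V + ?V * averaged_expectation N (indicator ?S)"
      by (subst Bochner_Integration.integral_add)
         (auto intro: integrable_measure_pmf_finite finite_averaged)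
    finally show ?thesis .
  qed
  also have "\<dots> \<le> (?c + P_N F N + real (card (inner_vertices n m [])) * T_b F Q N (N - m + 1)) * ?V"
  proof -
    have "averaged_expectation N (indicator ?S) \<le> P_N F N + real (card (inner_vertices n m [])) * T_b F Q N (N - m + 1)"
      using off_cluster_prob[OF m] unfolding indicator_expectation by simp
    then have "?V * averaged_expectation N (indicator ?S) \<le>
        ?V * (P_N F N + real (card (inner_vertices n m [])) * T_b F Q N (N - m + 1))"
      by (rule mult_left_mono) simp
    then show ?thesis unfolding distrib_right distrib_left by (simp add: mult.commute)
  qed
  finally show ?thesis using V by (simp add: divide_le_eq)
qed

lemma support_imbalance:
  assumes "(\<sigma>, \<tau>, b) \<in> set_pmf (averaged N)"
  shows "real (card (cluster b PoleA)) - real (max_off_cluster n N b) \<le> \<bar>imbalance n N \<sigma> \<tau> b\<bar> * real (card (vertices n N []))"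
    and "2 * real (card (cluster b PoleA)) - real (card (vertices n N [])) \<le> \<bar>imbalance n N \<sigma> \<tau> b\<bar> * real (card (vertices n N []))"
  using imbalance_ge[OF averaged_support(3,4)[OF assms]]
    configs_on[OF averaged_support(1)[OF assms] poles_in_vertices(1)]
    configs_on[OF averaged_support(2)[OF assms] poles_in_vertices(1)] by auto

abbreviation "imbalance_moment N \<equiv> measure_pmf.expectation (averaged N) (\<lambda>(\<sigma>, \<tau>, b). (imbalance n N \<sigma> \<tau> b)\<^sup>2)"

text \<open>When the poles are joined, the imbalance is in absolute value at least \<open>1\<close> minus twice the
  fraction of vertices joined to neither pole, and the mean of this fraction is at most \<open>X_bar\<close>.\<close>

lemma imbalance_moment_ge:
  "(max (1 - 2 * X_bar F Q n N) 0)\<^sup>2 - P_N F N \<le> imbalance_moment N"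
proof -
  let ?p = "averaged N" and ?V = "real (card (vertices n N []))"
  let ?X = "\<lambda>b. real (off_count n N b) / ?V" and ?D = "{b. \<not> connected_by b PoleA PoleB}"
  let ?Y = "\<lambda>b. max (1 - 2 * ?X b) 0"
  have V: "?V > 0" by (rule card_vertices_pos)
  note int = integrable_measure_pmf_finite[OF finite_averaged]
  have EX: "averaged_expectation N ?X \<le> X_bar F Q n N"
  proof -
    have "averaged_expectation N ?X = averaged_expectation N (\<lambda>b. real (off_count n N b)) / ?V"
      by (subst integral_divide_zero[symmetric]) (simp add: case_prod_unfold)
    also have "\<dots> \<le> X_bar F Q n N" using expected_off_count[of N] V by (simp add: divide_le_eq)
    finally show ?thesis .
  qed
  have "1 - 2 * averaged_expectation N ?X \<le> averaged_expectation N ?Y"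
  proof -
    have "1 - 2 * averaged_expectation N ?X = measure_pmf.expectation ?p (\<lambda>x. 1 - 2 * (\<lambda>(\<sigma>, \<tau>, b). ?X b) x)"
      by (subst Bochner_Integration.integral_diff) (auto intro: int)
    also have "\<dots> \<le> averaged_expectation N ?Y"
      by (rule expectation_pmf_mono[OF finite_averaged]) auto
    finally show ?thesis .
  qed
  moreover have "0 \<le> averaged_expectation N ?Y"
    by (intro Bochner_Integration.integral_nonneg) auto
  ultimately have EY: "max (1 - 2 * X_bar F Q n N) 0 \<le> averaged_expectation N ?Y" using EX by simp
  have "(max (1 - 2 * X_bar F Q n N) 0)\<^sup>2 \<le> (averaged_expectation N ?Y)\<^sup>2"
    by (rule power_mono[OF EY]) simp
  also have "\<dots> \<le> measure_pmf.expectation ?p (\<lambda>x. ((\<lambda>(\<sigma>, \<tau>, b). ?Y b) x)\<^sup>2)"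
    by (rule square_expectation_pmf_le[OF finite_averaged])
  also have "\<dots> \<le> measure_pmf.expectation ?p (\<lambda>x. (\<lambda>(\<sigma>, \<tau>, b). (imbalance n N \<sigma> \<tau> b)\<^sup>2) x + (\<lambda>(\<sigma>, \<tau>, b). indicator ?D b) x)"
  proof (rule expectation_pmf_mono[OF finite_averaged])
    fix x assume x: "x \<in> set_pmf ?p"
    obtain \<sigma> \<tau> b where xx: "x = (\<sigma>, \<tau>, b)" by (cases x)
    have "(?Y b)\<^sup>2 \<le> (imbalance n N \<sigma> \<tau> b)\<^sup>2 + indicator ?D b"
    proof (cases "connected_by b PoleA PoleB")
      case True
      have c: "real (card (cluster b PoleA)) + real (off_count n N b) = ?V"
      proof -
        have "b \<subseteq> edges n N []" using support_bonds x xx by blast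
        from card_cluster_pole[OF this True] show ?thesis by linarith
      qed
      have "1 - 2 * ?X b = (2 * real (card (cluster b PoleA)) - ?V) / ?V"
      proof -
        have "1 - 2 * (r / v) = (2 * a - v) / v" if "v > 0" "a + r = v" for a r v :: real
          using that by (auto simp: field_simps)
        from this[OF V c] show ?thesis .
      qed
      also have "\<dots> \<le> \<bar>imbalance n N \<sigma> \<tau> b\<bar>"
        using support_imbalance(2)[of \<sigma> \<tau> b N] x xx V by (simp add: divide_le_eq)
      finally have "?Y b \<le> \<bar>imbalance n N \<sigma> \<tau> b\<bar>" by simp
      then have "(?Y b)\<^sup>2 \<le> \<bar>imbalance n N \<sigma> \<tau> b\<bar>\<^sup>2" by (intro power_mono) auto
      then show ?thesis using True by simp
    next
      case False
      have "?Y b \<le> 1" by simp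
      then have "(?Y b)\<^sup>2 \<le> 1" by (intro power_le_one) auto
      then show ?thesis using False by (simp add: add_increasing)
    qed
    then show "((\<lambda>(\<sigma>, \<tau>, b). ?Y b) x)\<^sup>2 \<le> (\<lambda>(\<sigma>, \<tau>, b). (imbalance n N \<sigma> \<tau> b)\<^sup>2) x + (\<lambda>(\<sigma>, \<tau>, b). indicator ?D b) x"
      by (simp add: xx)
  qed
  also have "\<dots> = imbalance_moment N + averaged_expectation N (indicator ?D)"
    by (rule Bochner_Integration.integral_add) (rule int)+
  also have "averaged_expectation N (indicator ?D) \<le> P_N F N"
    using averaged_poles_disconnected[of N] by (simp add: indicator_expectation)
  finally show ?thesis by simp
qed

text \<open>The largest cluster of the overlap opposite to that at \<open>A\<close> avoids \<open>A\<close>, so the difference of the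
  two expected sizes bounds the mean absolute imbalance; then apply Jensen's inequality.\<close>

lemma imbalance_moment_ge_clusters:
  "(max ((averaged_expectation N (\<lambda>b. real (card (cluster b PoleA))) -
      averaged_expectation N (\<lambda>b. real (max_off_cluster n N b))) / real (card (vertices n N []))) 0)\<^sup>2 \<le> imbalance_moment N"
proof -
  let ?p = "averaged N" and ?V = "real (card (vertices n N []))"
  let ?I = "\<lambda>(\<sigma>, \<tau>, b). \<bar>imbalance n N \<sigma> \<tau> b\<bar>"
  have V: "?V > 0" by (rule card_vertices_pos)
  note int = integrable_measure_pmf_finite[OF finite_averaged]
  have "averaged_expectation N (\<lambda>b. real (card (cluster b PoleA))) - averaged_expectation N (\<lambda>b. real (max_off_cluster n N b)) =
      measure_pmf.expectation ?p (\<lambda>x. (\<lambda>(\<sigma>, \<tau>, b). real (card (cluster b PoleA))) x - (\<lambda>(\<sigma>, \<tau>, b). real (max_off_cluster n N b)) x)"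
    by (rule Bochner_Integration.integral_diff[symmetric]) (rule int)+
  also have "\<dots> \<le> measure_pmf.expectation ?p (\<lambda>x. ?I x * ?V)"
  proof (rule expectation_pmf_mono[OF finite_averaged])
    fix x assume x: "x \<in> set_pmf ?p"
    obtain \<sigma> \<tau> b where xx: "x = (\<sigma>, \<tau>, b)" by (cases x)
    show "(\<lambda>(\<sigma>, \<tau>, b). real (card (cluster b PoleA))) x - (\<lambda>(\<sigma>, \<tau>, b). real (max_off_cluster n N b)) x \<le> ?I x * ?V"
      using support_imbalance(1)[of \<sigma> \<tau> b N] x xx by simp
  qed
  also have "\<dots> = measure_pmf.expectation ?p ?I * ?V" by simp
  finally have "(averaged_expectation N (\<lambda>b. real (card (cluster b PoleA))) - averaged_expectation N (\<lambda>b. real (max_off_cluster n N b))) / ?V \<le>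
      measure_pmf.expectation ?p ?I" using V by (simp add: divide_le_eq)
  moreover have "0 \<le> measure_pmf.expectation ?p ?I" by (intro Bochner_Integration.integral_nonneg) auto
  ultimately have "max ((averaged_expectation N (\<lambda>b. real (card (cluster b PoleA))) -
      averaged_expectation N (\<lambda>b. real (max_off_cluster n N b))) / ?V) 0 \<le> measure_pmf.expectation ?p ?I" by simp
  then have "(max ((averaged_expectation N (\<lambda>b. real (card (cluster b PoleA))) -
      averaged_expectation N (\<lambda>b. real (max_off_cluster n N b))) / ?V) 0)\<^sup>2 \<le> (measure_pmf.expectation ?p ?I)\<^sup>2"
    by (rule power_mono) simp
  also have "\<dots> \<le> measure_pmf.expectation ?p (\<lambda>x. (?I x)\<^sup>2)" by (rule square_expectation_pmf_le[OF finite_averaged])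
  also have "\<dots> = imbalance_moment N" by (intro Bochner_Integration.integral_cong refl) auto
  finally show ?thesis .
qed

end

theorem theorem4p6:
  fixes n :: nat and \<beta> :: real
    and M :: "'a measure" and J :: "address \<Rightarrow> 'a \<Rightarrow> real"
    and F Q :: "nat \<Rightarrow> real \<Rightarrow> real"
  assumes n: "n \<ge> 1" and beta: "\<beta> \<ge> 0"
    and M: "prob_space M"
    and indep: "\<And>N. prob_space.indep_vars M (\<lambda>_. borel) J (diamond_edges n N)"
    and ident: "\<And>e e'. e \<in> (\<Union>N. diamond_edges n N) \<Longrightarrow> e' \<in> (\<Union>N. diamond_edges n N) \<Longrightarrow>
                   distr M borel (J e) = distr M borel (J e')"
    and profile: "small_ball_profile M n \<beta> J F Q"
  shows "\<forall>N\<ge>1. \<forall>j. \<forall>x\<in>nonpole_vertices n N. level N x = j \<longrightarrow>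
    (let G = (\<lambda>\<omega>. gibbs_free n \<beta> N (\<lambda>e. J e \<omega>));
         G_fix = (\<lambda>s\<^sub>A s\<^sub>B \<omega>. gibbs_fixed n \<beta> N (\<lambda>e. J e \<omega>) s\<^sub>A s\<^sub>B);
         V = diamond_vertices n N;
         P = joint_law M n \<beta> J N;
         EC = (\<integral>(\<omega>, \<sigma>, \<tau>, b). real (card (cluster b PoleA)) \<partial>P);
         EM = (\<integral>(\<omega>, \<sigma>, \<tau>, b). real (max_off_cluster n N b) \<partial>P);
         EI2 = (\<integral>(\<omega>, \<sigma>, \<tau>, b). (imbalance n N \<sigma> \<tau> b)\<^sup>2 \<partial>P)
     in
      \<comment> \<open>1\<close>
      ((\<integral>\<omega>. (measure_pmf.expectation (G \<omega>) (\<lambda>\<sigma>. \<sigma> PoleA * \<sigma> PoleB))\<^sup>2 \<partial>M)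
          = 1 - (\<integral>\<omega>. (sech (\<xi> n \<beta> J N \<omega>))\<^sup>2 \<partial>M)
       \<and> 1 - (\<integral>\<omega>. (sech (\<xi> n \<beta> J N \<omega>))\<^sup>2 \<partial>M) \<ge> 1 - S_N F N)
      \<and> \<comment> \<open>2\<close>
      (\<forall>s\<^sub>A\<in>{-1, 1}. \<forall>s\<^sub>B\<in>{-1, 1}.
         (\<integral>\<omega>. (measure_pmf.expectation (G_fix s\<^sub>A s\<^sub>B \<omega>) (\<lambda>\<sigma>. \<sigma> x))\<^sup>2 \<partial>M)
            \<ge> 1 - 2 * T_s Q N j
         \<and> ((\<forall>e\<in>diamond_edges n N. distr M borel (J e) = distr M borel (\<lambda>\<omega>. - J e \<omega>)) \<longrightarrow>
              (\<integral>\<omega>. measure_pmf.expectation (G_fix s\<^sub>A s\<^sub>B \<omega>) (\<lambda>\<sigma>. \<sigma> x) \<partial>M) = 0))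
      \<and> \<comment> \<open>3\<close>
      ((\<integral>\<omega>. (measure_pmf.expectation (G \<omega>) (\<lambda>\<sigma>. \<sigma> PoleA * \<sigma> x))\<^sup>2 \<partial>M)
          \<ge> max (1 - 2 * T_s Q N j - S_N F N) 0
       \<and> (\<integral>\<omega>. measure_pmf.expectation (pair_pmf (G \<omega>) (G \<omega>))
                 (\<lambda>(\<sigma>, \<tau>). (overlap n N \<sigma> \<tau>)\<^sup>2) \<partial>M)
          \<ge> ((\<Sum>z\<in>V. max (1 - 2 * T_s_at Q N z - S_N F N) 0) / real (card V))\<^sup>2)
      \<and> \<comment> \<open>4\<close>
      (\<P>((\<omega>, \<sigma>, \<tau>, b) in P. x \<notin> cluster b PoleA \<union> cluster b PoleB) \<le> T_b F Q N j
       \<and> \<P>((\<omega>, \<sigma>, \<tau>, b) in P. \<not> connected_by b PoleA PoleB) \<le> P_N F N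
       \<and> (\<forall>\<theta>. 0 < \<theta> \<and> \<theta> < 1 \<longrightarrow>
            \<P>((\<omega>, \<sigma>, \<tau>, b) in P. PoleB \<in> cluster b PoleA \<and>
                 real (card (cluster b PoleA)) > (1 - \<theta>) * real (card V))
              \<ge> 1 - X_bar F Q n N / \<theta> - P_N F N)
       \<and> EC / real (card V)
          \<ge> (\<Sum>z\<in>V. max (1 - T_b_at F Q N z - P_N F N) 0) / real (card V))
      \<and> \<comment> \<open>5\<close>
      (\<forall>m. 1 \<le> m \<and> m \<le> N \<longrightarrow>
         \<P>((\<omega>, \<sigma>, \<tau>, b) in P.
              real (max_off_cluster n N b) > (1 / (2 * real n)) ^ m * real (card V))
           \<le> P_N F N + real (card (nonpole_vertices n m)) * T_b F Q N (N - m + 1)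
         \<and> EM / real (card V)
           \<le> (1 / (2 * real n)) ^ m
              + P_N F N + real (card (nonpole_vertices n m)) * T_b F Q N (N - m + 1))
      \<and> \<comment> \<open>6\<close>
      (EI2 \<ge> (max (1 - 2 * X_bar F Q n N) 0)\<^sup>2 - P_N F N
       \<and> EI2 \<ge> (max ((EC - EM) / real (card V)) 0)\<^sup>2))"
  (is "\<forall>N\<ge>1. \<forall>j. \<forall>x\<in>_. _ \<longrightarrow> ?claim N j x")
proof -
  interpret prob_space M by (rule M)
  interpret profiled_couplings M n \<beta> J F Q
    by unfold_locales (fact n beta indep ident profile)+
  have "?claim N j x" if N: "N \<ge> 1" and x: "x \<in> nonpole_vertices n N" and j: "level N x = j" for N j x
  proof -
    obtain w i where w: "x = Mid w i" "addr n w" "i < n" "length w < N"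
      using x by (auto simp: inner_vertices_eq)
    have jw: "j = N - length w" using j w by simp
    have xV: "x \<in> diamond_vertices n N" using x by (simp add: vertices_def)
    have at: "T_s_at Q N x = T_s Q N j" "T_b_at F Q N x = T_b F Q N j"
      using j w by (simp_all add: T_s_at_def T_b_at_def)
    have "1 - S_N F N \<le> 1 - expectation (\<lambda>\<omega>. (sech (\<xi> n \<beta> J N \<omega>))\<^sup>2)"
      using S_N_bound[of N] by simp
    moreover have "1 - 2 * T_s Q N j \<le> expectation (\<lambda>\<omega>.
        (measure_pmf.expectation (gibbs_fixed n \<beta> N (\<lambda>e. J e \<omega>) sA sB) (\<lambda>\<sigma>. \<sigma> x))\<^sup>2)"
      if "sA \<in> {-1, 1}" "sB \<in> {-1, 1}" for sA sB
      unfolding jw w(1) by (rule fixed_magnetisation_bound[OF that w(2,3,4)])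
    moreover have "measure_pmf.prob (averaged N) {(\<sigma>, \<tau>, b). x \<notin> cluster b PoleA \<union> cluster b PoleB} \<le> T_b F Q N j"
      using averaged_vertex_off[OF xV] by (simp add: at)
    moreover have "(\<Sum>z\<in>diamond_vertices n N. max (1 - T_b_at F Q N z - P_N F N) 0) / real (card (diamond_vertices n N)) \<le>
        averaged_expectation N (\<lambda>b. real (card (cluster b PoleA))) / real (card (diamond_vertices n N))"
      by (rule divide_right_mono[OF expected_cluster_size]) simp
    ultimately show ?thesis
      unfolding Let_def prob_joint_law integral_joint_law
      using pole_correlation_squared[of N] symmetric_magnetisation[OF _ _ x]
        free_correlation_bound[OF xV, unfolded at] overlap_bound[of N] averaged_poles_disconnected[of N]
        giant_cluster_prob[of _ N] off_cluster_prob[of _ N] off_cluster_expectation[of _ N]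
        imbalance_moment_ge[of N] imbalance_moment_ge_clusters[of N]
      by (intro conjI ballI allI impI) blast+
  qed
  then show ?thesis by blast
qed

end
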